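(* Let $\mathcal{T}$ be a triangulated category. $(\alpha)$ If $\mathcal{X}\subseteq\mathcal{U}$ are full subcategories of $\mathcal{T}$ and $\mathcal{U}$ is an $\mathcal{X}$-Frobenius subcategory of $\mathcal{T}$, then the subfactor category $\mathcal{U}/\mathcal{X}$ is triangulated. $(\beta)$ For any functorially finite subcategory $\mathcal{X}\subseteq\mathcal{T}$, the maps $\mathcal{U}\mapsto\mathcal{U}/\mathcal{X}$ and $\mathcal{S}\mapsto\pi^{-1}(\mathcal{S})$, where $\pi:\mathcal{T}\to\mathcal{T}/\mathcal{X}$ is the projection functor, give mutually inverse bijections between: (I) $\mathcal{X}$-Frobenius subcategories $\mathcal{U}$ of $\mathcal{T}$; (II) thick triangulated subcategories $\mathcal{S}$ of $\mathcal{T}/\mathcal{X}$ such that $\pi^{-1}(\mathcal{S})$ is closed under extensions in $\mathcal{T}$.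
   Context: $\mathcal{T}$ has split idempotents and shift $[1]$; subcategories are full, additive, closed under isomorphisms and direct summands. A right $\mathcal{X}$-approximation of $A$ is a map $X_A\to A$, $X_A\in\mathcal{X}$, with $\mathcal{T}(\mathcal{X},X_A)\to\mathcal{T}(\mathcal{X},A)$ surjective; left approximations are dual. $\mathcal{X}$ is functorially finite in a subcategory $\mathcal{U}$ containing it if every object of $\mathcal{U}$ has both a right and a left $\mathcal{X}$-approximation. $\mathcal{U}/\mathcal{X}$ has the objects of $\mathcal{U}$ and morphisms those of $\mathcal{T}$ modulo maps factoring through an object of $\mathcal{X}$; $\pi^{-1}(\mathcal{S})=\{A\mid\pi(A)\in\mathcal{S}\}$. For an object $A$ choose triangles $\Omega^1_{\mathcal{X}}(A)\to X^0_A\to A\to\Omega^1_{\mathcal{X}}(A)[1]$ and $\Sigma^1_{\mathcal{X}}(A)[-1]\to A\to X^A_0\to\Sigma^1_{\mathcal{X}}(A)$ with $X^0_A\to A$ a right and $A\to X_0^A$ a left $\mathcal{X}$-approximation. A map $f$ is $\mathcal{X}$-ghost if $\mathcal{T}(\mathcal{X},f)=0$ and $\mathcal{X}$-coghost if $\mathcal{T}(f,\mathcal{X})=0$; $\mathsf{Gh}_{\mathcal{X}}(A,B)$, $\mathsf{CoGh}_{\mathcal{X}}(A,B)$ are the corresponding subgroups of $\mathcal{T}(A,B)$. $\mathcal{U}$ is $\mathcal{X}$-Frobenius if: $\mathcal{U}$ is closed under extensions and direct summands in $\mathcal{T}$; $\mathcal{X}\subseteq\mathcal{U}$ is functorially finite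 in $\mathcal{U}$; $\mathsf{Gh}_{\mathcal{X}}(U,X[1])=0=\mathsf{CoGh}_{\mathcal{X}}(X[-1],U)$ for all $U\in\mathcal{U}$, $X\in\mathcal{X}$; and $\Omega^1_{\mathcal{X}}(\mathcal{U})\subseteq\mathcal{U}\supseteq\Sigma^1_{\mathcal{X}}(\mathcal{U})$. Pretriangulated structure: if $\mathcal{X}$ is functorially finite in $\mathcal{U}$, $\mathcal{U}$ is extension closed and $\Omega^1_{\mathcal{X}}(\mathcal{U})\subseteq\mathcal{U}\supseteq\Sigma^1_{\mathcal{X}}(\mathcal{U})$ (for instance $\mathcal{U}=\mathcal{T}$), the assignments $A\mapsto\Sigma^1_{\mathcal{X}}(A)$ and $A\mapsto\Omega^1_{\mathcal{X}}(A)$ induce functors $\Sigma^1_{\mathcal{X}},\Omega^1_{\mathcal{X}}:\mathcal{U}/\mathcal{X}\to\mathcal{U}/\mathcal{X}$ forming an adjoint pair $(\Sigma^1_{\mathcal{X}},\Omega^1_{\mathcal{X}})$. Right triangles are the diagrams isomorphic in $\mathcal{U}/\mathcal{X}$ to $A\to B\to C\to\Sigma^1_{\mathcal{X}}(A)$ obtained from a map $A\to B$ by completing the composite $\Sigma^1_{\mathcal{X}}(A)[-1]\to A\to B$ to a triangle $\Sigma^1_{\mathcal{X}}(A)[-1]\to B\to C\to\Sigma^1_{\mathcal{X}}(A)$ (homotopy push-out); left triangles are the diagrams isomorphic to $\Omega^1_{\mathcal{X}}(C)\to A\to B\to C$ obtained from a map $B\to C$ by completing $B\to C\to\Omega^1_{\mathcal{X}}(C)[1]$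 to a triangle $\Omega^1_{\mathcal{X}}(C)\to A\to B\to\Omega^1_{\mathcal{X}}(C)[1]$ (homotopy pull-back). $\mathcal{U}/\mathcal{X}$ is called triangulated if with this structure it is triangulated, equivalently $\Sigma^1_{\mathcal{X}}$ (equivalently $\Omega^1_{\mathcal{X}}$) is an equivalence. A full subcategory $\mathcal{S}$ of $\mathcal{T}/\mathcal{X}$ is a triangulated subcategory if it is closed under $\Sigma^1_{\mathcal{X}},\Omega^1_{\mathcal{X}}$ and under the left and right triangles built on its morphisms, and the restricted structure is triangulated (the restrictions of $\Sigma^1_{\mathcal{X}},\Omega^1_{\mathcal{X}}$ to $\mathcal{S}$ are equivalences); it is thick if it is also closed under direct factors. *)

theory Defs
  imports "HOL-Algebra.Group"
begin

section \<open>Categories with additive structure\<close>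

record ('o, 'm) cat =
  Ob :: "'o set"
  Hom :: "'o \<Rightarrow> 'o \<Rightarrow> 'm set"
  Ide :: "'o \<Rightarrow> 'm"
  Comp :: "'m \<Rightarrow> 'm \<Rightarrow> 'm"  (infixr "\<cdot>\<index>" 75)
  Add :: "'m \<Rightarrow> 'm \<Rightarrow> 'm"  (infixl "\<boxplus>\<index>" 65)
  Zer :: "'o \<Rightarrow> 'o \<Rightarrow> 'm"

text \<open>The last conjunct says that an arrow determines its source and its target; this is why
  composition and addition need no object indices.\<close>

definition category :: "('o, 'm, 'z) cat_scheme \<Rightarrow> bool" where
  "category C \<longleftrightarrow>
     (\<forall>A\<in>Ob C. Ide C A \<in> Hom C A A) \<and>
     (\<forall>A\<in>Ob C. \<forall>B\<in>Ob C. \<forall>D\<in>Ob C. \<forall>f\<in>Hom C A B. \<forall>g\<in>Hom C B D. g \<cdot>\<^bsub>C\<^esub> f \<in> Hom C A D) \<and>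
     (\<forall>A\<in>Ob C. \<forall>B\<in>Ob C. \<forall>f\<in>Hom C A B. Ide C B \<cdot>\<^bsub>C\<^esub> f = f \<and> f \<cdot>\<^bsub>C\<^esub> Ide C A = f) \<and>
     (\<forall>A\<in>Ob C. \<forall>B\<in>Ob C. \<forall>D\<in>Ob C. \<forall>E\<in>Ob C. \<forall>f\<in>Hom C A B. \<forall>g\<in>Hom C B D. \<forall>h\<in>Hom C D E.
        h \<cdot>\<^bsub>C\<^esub> (g \<cdot>\<^bsub>C\<^esub> f) = (h \<cdot>\<^bsub>C\<^esub> g) \<cdot>\<^bsub>C\<^esub> f) \<and>
     (\<forall>A\<in>Ob C. \<forall>B\<in>Ob C. \<forall>A'\<in>Ob C. \<forall>B'\<in>Ob C. Hom C A B \<inter> Hom C A' B' \<noteq> {} \<longrightarrow> A = A' \<and> B = B')"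

definition hom_group :: "('o, 'm, 'z) cat_scheme \<Rightarrow> 'o \<Rightarrow> 'o \<Rightarrow> 'm monoid" where
  "hom_group C A B = \<lparr>carrier = Hom C A B, mult = Add C, one = Zer C A B\<rparr>"

definition neg :: "('o, 'm, 'z) cat_scheme \<Rightarrow> 'o \<Rightarrow> 'o \<Rightarrow> 'm \<Rightarrow> 'm" where
  "neg C A B f = inv\<^bsub>hom_group C A B\<^esub> f"

definition preadditive :: "('o, 'm, 'z) cat_scheme \<Rightarrow> bool" where
  "preadditive C \<longleftrightarrow> category C \<and>
     (\<forall>A\<in>Ob C. \<forall>B\<in>Ob C. comm_group (hom_group C A B)) \<and>
     (\<forall>A\<in>Ob C. \<forall>B\<in>Ob C. \<forall>D\<in>Ob C. \<forall>f\<in>Hom C A B. \<forall>f'\<in>Hom C A B. \<forall>g\<in>Hom C B D. \<forall>g'\<in>Hom C B D.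
        g \<cdot>\<^bsub>C\<^esub> (f \<boxplus>\<^bsub>C\<^esub> f') = g \<cdot>\<^bsub>C\<^esub> f \<boxplus>\<^bsub>C\<^esub> g \<cdot>\<^bsub>C\<^esub> f' \<and>
        (g \<boxplus>\<^bsub>C\<^esub> g') \<cdot>\<^bsub>C\<^esub> f = g \<cdot>\<^bsub>C\<^esub> f \<boxplus>\<^bsub>C\<^esub> g' \<cdot>\<^bsub>C\<^esub> f)"

definition zero_object :: "('o, 'm, 'z) cat_scheme \<Rightarrow> 'o \<Rightarrow> bool" where
  "zero_object C Z \<longleftrightarrow> Z \<in> Ob C \<and> (\<forall>A\<in>Ob C. (\<exists>!f. f \<in> Hom C Z A) \<and> (\<exists>!f. f \<in> Hom C A Z))"

definition biproduct :: "('o, 'm, 'z) cat_scheme \<Rightarrow> 'o \<Rightarrow> 'o \<Rightarrow> 'o \<Rightarrow> bool" where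
  "biproduct C A B P \<longleftrightarrow> A \<in> Ob C \<and> B \<in> Ob C \<and> P \<in> Ob C \<and>
     (\<exists>i\<in>Hom C A P. \<exists>j\<in>Hom C B P. \<exists>p\<in>Hom C P A. \<exists>q\<in>Hom C P B.
        p \<cdot>\<^bsub>C\<^esub> i = Ide C A \<and> q \<cdot>\<^bsub>C\<^esub> j = Ide C B \<and> p \<cdot>\<^bsub>C\<^esub> j = Zer C B A \<and> q \<cdot>\<^bsub>C\<^esub> i = Zer C A B \<and>
        i \<cdot>\<^bsub>C\<^esub> p \<boxplus>\<^bsub>C\<^esub> j \<cdot>\<^bsub>C\<^esub> q = Ide C P)"

definition additive :: "('o, 'm, 'z) cat_scheme \<Rightarrow> bool" where
  "additive C \<longleftrightarrow> preadditive C \<and> (\<exists>Z. zero_object C Z) \<and>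
     (\<forall>A\<in>Ob C. \<forall>B\<in>Ob C. \<exists>P. biproduct C A B P)"

definition iso_arrow :: "('o, 'm, 'z) cat_scheme \<Rightarrow> 'o \<Rightarrow> 'o \<Rightarrow> 'm \<Rightarrow> bool" where
  "iso_arrow C A B f \<longleftrightarrow> f \<in> Hom C A B \<and>
     (\<exists>g\<in>Hom C B A. g \<cdot>\<^bsub>C\<^esub> f = Ide C A \<and> f \<cdot>\<^bsub>C\<^esub> g = Ide C B)"

definition isomorphic :: "('o, 'm, 'z) cat_scheme \<Rightarrow> 'o \<Rightarrow> 'o \<Rightarrow> bool" where
  "isomorphic C A B \<longleftrightarrow> A \<in> Ob C \<and> B \<in> Ob C \<and> (\<exists>f. iso_arrow C A B f)"

definition split_idempotents :: "('o, 'm, 'z) cat_scheme \<Rightarrow> bool" where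
  "split_idempotents C \<longleftrightarrow> (\<forall>A\<in>Ob C. \<forall>e\<in>Hom C A A. e \<cdot>\<^bsub>C\<^esub> e = e \<longrightarrow>
     (\<exists>B\<in>Ob C. \<exists>r\<in>Hom C A B. \<exists>s\<in>Hom C B A. s \<cdot>\<^bsub>C\<^esub> r = e \<and> r \<cdot>\<^bsub>C\<^esub> s = Ide C B))"

definition op_cat :: "('o, 'm, 'z) cat_scheme \<Rightarrow> ('o, 'm) cat" where
  "op_cat C = \<lparr>Ob = Ob C, Hom = (\<lambda>A B. Hom C B A), Ide = Ide C, Comp = (\<lambda>g f. f \<cdot>\<^bsub>C\<^esub> g),
     Add = Add C, Zer = (\<lambda>A B. Zer C B A)\<rparr>"


section \<open>Full subcategories\<close>

text \<open>A full subcategory is given by its set of objects.\<close>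

definition additive_subcategory :: "('o, 'm, 'z) cat_scheme \<Rightarrow> 'o set \<Rightarrow> bool" where
  "additive_subcategory C S \<longleftrightarrow> S \<subseteq> Ob C \<and> (\<exists>Z\<in>S. zero_object C Z) \<and>
     (\<forall>A\<in>S. \<forall>B\<in>S. \<forall>P. biproduct C A B P \<longrightarrow> P \<in> S) \<and>
     (\<forall>A\<in>S. \<forall>B. isomorphic C A B \<longrightarrow> B \<in> S)"

definition closed_under_summands :: "('o, 'm, 'z) cat_scheme \<Rightarrow> 'o set \<Rightarrow> bool" where
  "closed_under_summands C S \<longleftrightarrow> (\<forall>P\<in>S. \<forall>A B. biproduct C A B P \<longrightarrow> A \<in> S)"

definition subcategory :: "('o, 'm, 'z) cat_scheme \<Rightarrow> 'o set \<Rightarrow> bool" where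
  "subcategory C S \<longleftrightarrow> additive_subcategory C S \<and> closed_under_summands C S"


section \<open>Functors and equivalences\<close>

record ('o, 'm, 'p, 'n) func =
  fob :: "'o \<Rightarrow> 'p"
  fmap :: "'m \<Rightarrow> 'n"

definition is_functor ::
  "('o, 'm, 'y) cat_scheme \<Rightarrow> ('p, 'n, 'z) cat_scheme \<Rightarrow> ('o, 'm, 'p, 'n) func \<Rightarrow> bool" where
  "is_functor C D F \<longleftrightarrow>
     (\<forall>A\<in>Ob C. fob F A \<in> Ob D \<and> fmap F (Ide C A) = Ide D (fob F A)) \<and>
     (\<forall>A\<in>Ob C. \<forall>B\<in>Ob C. \<forall>f\<in>Hom C A B. fmap F f \<in> Hom D (fob F A) (fob F B)) \<and>
     (\<forall>A\<in>Ob C. \<forall>B\<in>Ob C. \<forall>E\<in>Ob C. \<forall>f\<in>Hom C A B. \<forall>g\<in>Hom C B E.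
        fmap F (g \<cdot>\<^bsub>C\<^esub> f) = fmap F g \<cdot>\<^bsub>D\<^esub> fmap F f)"

definition additive_functor ::
  "('o, 'm, 'y) cat_scheme \<Rightarrow> ('p, 'n, 'z) cat_scheme \<Rightarrow> ('o, 'm, 'p, 'n) func \<Rightarrow> bool" where
  "additive_functor C D F \<longleftrightarrow> is_functor C D F \<and>
     (\<forall>A\<in>Ob C. \<forall>B\<in>Ob C. \<forall>f\<in>Hom C A B. \<forall>g\<in>Hom C A B. fmap F (f \<boxplus>\<^bsub>C\<^esub> g) = fmap F f \<boxplus>\<^bsub>D\<^esub> fmap F g)"

definition id_func :: "('o, 'm, 'o, 'm) func" where
  "id_func = \<lparr>fob = (\<lambda>A. A), fmap = (\<lambda>f. f)\<rparr>"

definition comp_func ::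
  "('p, 'n, 'q, 'l) func \<Rightarrow> ('o, 'm, 'p, 'n) func \<Rightarrow> ('o, 'm, 'q, 'l) func" where
  "comp_func G F = \<lparr>fob = fob G \<circ> fob F, fmap = fmap G \<circ> fmap F\<rparr>"

definition naturally_isomorphic ::
  "('o, 'm, 'y) cat_scheme \<Rightarrow> ('p, 'n, 'z) cat_scheme \<Rightarrow>
     ('o, 'm, 'p, 'n) func \<Rightarrow> ('o, 'm, 'p, 'n) func \<Rightarrow> bool" where
  "naturally_isomorphic C D F G \<longleftrightarrow> (\<exists>\<eta>.
     (\<forall>A\<in>Ob C. iso_arrow D (fob F A) (fob G A) (\<eta> A)) \<and>
     (\<forall>A\<in>Ob C. \<forall>B\<in>Ob C. \<forall>f\<in>Hom C A B. fmap G f \<cdot>\<^bsub>D\<^esub> \<eta> A = \<eta> B \<cdot>\<^bsub>D\<^esub> fmap F f))"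

definition equivalence ::
  "('o, 'm, 'y) cat_scheme \<Rightarrow> ('p, 'n, 'z) cat_scheme \<Rightarrow> ('o, 'm, 'p, 'n) func \<Rightarrow> bool" where
  "equivalence C D F \<longleftrightarrow> is_functor C D F \<and> (\<exists>G. is_functor D C G \<and>
     naturally_isomorphic C C (comp_func G F) id_func \<and>
     naturally_isomorphic D D (comp_func F G) id_func)"


section \<open>Triangulated categories\<close>

text \<open>\<open>Tri A B C f g h\<close> stands for a diagram \<open>A \<rightarrow> B \<rightarrow> C \<rightarrow> F A\<close> with arrows \<open>f\<close>, \<open>g\<close>, \<open>h\<close>, where \<open>F\<close> is
  the endofunctor under consideration.\<close>

datatype ('o, 'm) tri =
  Tri (ob1: 'o) (ob2: 'o) (ob3: 'o) (arr1: 'm) (arr2: 'm) (arr3: 'm)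

definition candidate :: "('o, 'm, 'z) cat_scheme \<Rightarrow> ('o, 'm, 'o, 'm) func \<Rightarrow> ('o, 'm) tri \<Rightarrow> bool" where
  "candidate C F t \<longleftrightarrow> ob1 t \<in> Ob C \<and> ob2 t \<in> Ob C \<and> ob3 t \<in> Ob C \<and>
     arr1 t \<in> Hom C (ob1 t) (ob2 t) \<and> arr2 t \<in> Hom C (ob2 t) (ob3 t) \<and>
     arr3 t \<in> Hom C (ob3 t) (fob F (ob1 t))"

definition tri_mor :: "('o, 'm, 'z) cat_scheme \<Rightarrow> ('o, 'm, 'o, 'm) func \<Rightarrow>
     ('o, 'm) tri \<Rightarrow> ('o, 'm) tri \<Rightarrow> 'm \<Rightarrow> 'm \<Rightarrow> 'm \<Rightarrow> bool" where
  "tri_mor C F s t a b c \<longleftrightarrow>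
     a \<in> Hom C (ob1 s) (ob1 t) \<and> b \<in> Hom C (ob2 s) (ob2 t) \<and> c \<in> Hom C (ob3 s) (ob3 t) \<and>
     b \<cdot>\<^bsub>C\<^esub> arr1 s = arr1 t \<cdot>\<^bsub>C\<^esub> a \<and> c \<cdot>\<^bsub>C\<^esub> arr2 s = arr2 t \<cdot>\<^bsub>C\<^esub> b \<and>
     fmap F a \<cdot>\<^bsub>C\<^esub> arr3 s = arr3 t \<cdot>\<^bsub>C\<^esub> c"

definition tri_isomorphic :: "('o, 'm, 'z) cat_scheme \<Rightarrow> ('o, 'm, 'o, 'm) func \<Rightarrow>
     ('o, 'm) tri \<Rightarrow> ('o, 'm) tri \<Rightarrow> bool" where
  "tri_isomorphic C F s t \<longleftrightarrow> candidate C F s \<and> candidate C F t \<and> (\<exists>a b c. tri_mor C F s t a b c \<and>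
     iso_arrow C (ob1 s) (ob1 t) a \<and> iso_arrow C (ob2 s) (ob2 t) b \<and> iso_arrow C (ob3 s) (ob3 t) c)"

record ('o, 'm) tcat = "('o, 'm) cat" +
  Shift :: "('o, 'm, 'o, 'm) func"
  Dist :: "('o, 'm) tri set"

abbreviation shift_ob :: "('o, 'm, 'z) tcat_scheme \<Rightarrow> 'o \<Rightarrow> 'o" where
  "shift_ob T \<equiv> fob (Shift T)"

abbreviation shift_map :: "('o, 'm, 'z) tcat_scheme \<Rightarrow> 'm \<Rightarrow> 'm" where
  "shift_map T \<equiv> fmap (Shift T)"

definition TR1 :: "('o, 'm, 'z) tcat_scheme \<Rightarrow> bool" where
  "TR1 T \<longleftrightarrow>
     (\<forall>s\<in>Dist T. \<forall>t. tri_isomorphic T (Shift T) s t \<longrightarrow> t \<in> Dist T) \<and>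
     (\<forall>A\<in>Ob T. \<forall>Z. zero_object T Z \<longrightarrow> Tri A A Z (Ide T A) (Zer T A Z) (Zer T Z (shift_ob T A)) \<in> Dist T) \<and>
     (\<forall>A\<in>Ob T. \<forall>B\<in>Ob T. \<forall>f\<in>Hom T A B. \<exists>C g h. Tri A B C f g h \<in> Dist T)"

definition TR2 :: "('o, 'm, 'z) tcat_scheme \<Rightarrow> bool" where
  "TR2 T \<longleftrightarrow> (\<forall>A B C f g h. candidate T (Shift T) (Tri A B C f g h) \<longrightarrow>
     (Tri A B C f g h \<in> Dist T \<longleftrightarrow>
      Tri B C (shift_ob T A) g h (neg T (shift_ob T A) (shift_ob T B) (shift_map T f)) \<in> Dist T))"

definition TR3 :: "('o, 'm, 'z) tcat_scheme \<Rightarrow> bool" where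
  "TR3 T \<longleftrightarrow> (\<forall>s\<in>Dist T. \<forall>t\<in>Dist T. \<forall>a\<in>Hom T (ob1 s) (ob1 t). \<forall>b\<in>Hom T (ob2 s) (ob2 t).
     b \<cdot>\<^bsub>T\<^esub> arr1 s = arr1 t \<cdot>\<^bsub>T\<^esub> a \<longrightarrow> (\<exists>c. tri_mor T (Shift T) s t a b c))"

definition TR4 :: "('o, 'm, 'z) tcat_scheme \<Rightarrow> bool" where
  "TR4 T \<longleftrightarrow> (\<forall>A B C C' A' B' f g i i' j j' k k'.
     Tri A B C' f i i' \<in> Dist T \<longrightarrow> Tri B C A' g j j' \<in> Dist T \<longrightarrow>
     Tri A C B' (g \<cdot>\<^bsub>T\<^esub> f) k k' \<in> Dist T \<longrightarrow>
     (\<exists>u\<in>Hom T C' B'. \<exists>v\<in>Hom T B' A'.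
        Tri C' B' A' u v (shift_map T i \<cdot>\<^bsub>T\<^esub> j') \<in> Dist T \<and>
        u \<cdot>\<^bsub>T\<^esub> i = k \<cdot>\<^bsub>T\<^esub> g \<and> k' \<cdot>\<^bsub>T\<^esub> u = i' \<and> v \<cdot>\<^bsub>T\<^esub> k = j \<and> j' \<cdot>\<^bsub>T\<^esub> v = shift_map T f \<cdot>\<^bsub>T\<^esub> k'))"

text \<open>The shift is only required to be an autoequivalence, not an automorphism: the functors induced
  on subfactor categories are not bijective on objects.\<close>

definition triangulated :: "('o, 'm, 'z) tcat_scheme \<Rightarrow> bool" where
  "triangulated T \<longleftrightarrow> additive T \<and> additive_functor T T (Shift T) \<and> equivalence T T (Shift T) \<and>
     (\<forall>t\<in>Dist T. candidate T (Shift T) t) \<and> TR1 T \<and> TR2 T \<and> TR3 T \<and> TR4 T"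

definition closed_under_extensions :: "('o, 'm, 'z) tcat_scheme \<Rightarrow> 'o set \<Rightarrow> bool" where
  "closed_under_extensions T S \<longleftrightarrow> (\<forall>t\<in>Dist T. ob1 t \<in> S \<and> ob3 t \<in> S \<longrightarrow> ob2 t \<in> S)"

definition add_triangles :: "('o, 'm, 'z) cat_scheme \<Rightarrow> ('o, 'm, 'o, 'm) func \<Rightarrow> ('o, 'm) tri set \<Rightarrow>
     ('o, 'm) tcat" where
  "add_triangles C F D = \<lparr>Ob = Ob C, Hom = Hom C, Ide = Ide C, Comp = Comp C, Add = Add C, Zer = Zer C,
     Shift = F, Dist = D\<rparr>"

definition restrict_tcat :: "('o, 'm, 'z) tcat_scheme \<Rightarrow> 'o set \<Rightarrow> ('o, 'm, 'z) tcat_scheme" where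
  "restrict_tcat T S = T\<lparr>Ob := S, Dist := {t \<in> Dist T. ob1 t \<in> S \<and> ob2 t \<in> S \<and> ob3 t \<in> S}\<rparr>"


section \<open>Approximations and ghosts\<close>

definition right_approx :: "('o, 'm, 'z) cat_scheme \<Rightarrow> 'o set \<Rightarrow> 'o \<Rightarrow> 'o \<Rightarrow> 'm \<Rightarrow> bool" where
  "right_approx C X A Y p \<longleftrightarrow> Y \<in> X \<and> p \<in> Hom C Y A \<and>
     (\<forall>X'\<in>X. (\<lambda>u. p \<cdot>\<^bsub>C\<^esub> u) ` Hom C X' Y = Hom C X' A)"

definition left_approx :: "('o, 'm, 'z) cat_scheme \<Rightarrow> 'o set \<Rightarrow> 'o \<Rightarrow> 'o \<Rightarrow> 'm \<Rightarrow> bool" where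
  "left_approx C X A Y i \<longleftrightarrow> Y \<in> X \<and> i \<in> Hom C A Y \<and>
     (\<forall>X'\<in>X. (\<lambda>u. u \<cdot>\<^bsub>C\<^esub> i) ` Hom C Y X' = Hom C A X')"

definition functorially_finite :: "('o, 'm, 'z) cat_scheme \<Rightarrow> 'o set \<Rightarrow> 'o set \<Rightarrow> bool" where
  "functorially_finite C X U \<longleftrightarrow> X \<subseteq> U \<and>
     (\<forall>A\<in>U. (\<exists>Y p. right_approx C X A Y p) \<and> (\<exists>Y i. left_approx C X A Y i))"

definition Gh :: "('o, 'm, 'z) cat_scheme \<Rightarrow> 'o set \<Rightarrow> 'o \<Rightarrow> 'o \<Rightarrow> 'm set" where
  "Gh C X A B = {f \<in> Hom C A B. \<forall>X'\<in>X. \<forall>u\<in>Hom C X' A. f \<cdot>\<^bsub>C\<^esub> u = Zer C X' B}"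

definition CoGh :: "('o, 'm, 'z) cat_scheme \<Rightarrow> 'o set \<Rightarrow> 'o \<Rightarrow> 'o \<Rightarrow> 'm set" where
  "CoGh C X A B = {f \<in> Hom C A B. \<forall>X'\<in>X. \<forall>u\<in>Hom C B X'. u \<cdot>\<^bsub>C\<^esub> f = Zer C A X'}"

text \<open>The chosen triangles \<open>R A = (\<Omega>A \<rightarrow> X\<^sub>A \<rightarrow> A \<rightarrow> \<Omega>A[1])\<close> and \<open>L A = (A \<rightarrow> X\<^sup>A \<rightarrow> \<Sigma>A \<rightarrow> A[1])\<close>.
  The latter is the rotation of \<open>\<Sigma>A[-1] \<rightarrow> A \<rightarrow> X\<^sup>A \<rightarrow> \<Sigma>A\<close>; its last arrow is the negative of the
  shift of \<open>\<Sigma>A[-1] \<rightarrow> A\<close>.\<close>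

definition right_approx_choice ::
  "('o, 'm, 'z) tcat_scheme \<Rightarrow> 'o set \<Rightarrow> 'o set \<Rightarrow> ('o \<Rightarrow> ('o, 'm) tri) \<Rightarrow> bool" where
  "right_approx_choice T X U R \<longleftrightarrow>
     (\<forall>A\<in>U. R A \<in> Dist T \<and> ob3 (R A) = A \<and> right_approx T X A (ob2 (R A)) (arr2 (R A)))"

definition left_approx_choice ::
  "('o, 'm, 'z) tcat_scheme \<Rightarrow> 'o set \<Rightarrow> 'o set \<Rightarrow> ('o \<Rightarrow> ('o, 'm) tri) \<Rightarrow> bool" where
  "left_approx_choice T X U L \<longleftrightarrow>
     (\<forall>A\<in>U. L A \<in> Dist T \<and> ob1 (L A) = A \<and> left_approx T X A (ob2 (L A)) (arr1 (L A)))"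

abbreviation Omega_ob :: "('o \<Rightarrow> ('o, 'm) tri) \<Rightarrow> 'o \<Rightarrow> 'o" where
  "Omega_ob R A \<equiv> ob1 (R A)"

abbreviation Sigma_ob :: "('o \<Rightarrow> ('o, 'm) tri) \<Rightarrow> 'o \<Rightarrow> 'o" where
  "Sigma_ob L A \<equiv> ob3 (L A)"

text \<open>As the shift is an autoequivalence, \<open>Y[-1]\<close> is any object \<open>V\<close> with \<open>V[1]\<close> isomorphic to \<open>Y\<close>.\<close>

definition frobenius :: "('o, 'm, 'z) tcat_scheme \<Rightarrow> 'o set \<Rightarrow>
     ('o \<Rightarrow> ('o, 'm) tri) \<Rightarrow> ('o \<Rightarrow> ('o, 'm) tri) \<Rightarrow> 'o set \<Rightarrow> bool" where
  "frobenius T X L R U \<longleftrightarrow> subcategory T U \<and> closed_under_extensions T U \<and>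
     functorially_finite T X U \<and>
     (\<forall>A\<in>U. \<forall>Y\<in>X. Gh T X A (shift_ob T Y) = {Zer T A (shift_ob T Y)}) \<and>
     (\<forall>A\<in>U. \<forall>Y\<in>X. \<forall>V\<in>Ob T. isomorphic T (shift_ob T V) Y \<longrightarrow> CoGh T X V A = {Zer T V A}) \<and>
     (\<forall>A\<in>U. Omega_ob R A \<in> U \<and> Sigma_ob L A \<in> U)"


section \<open>Subfactor categories and their pretriangulated structure\<close>

definition factoring :: "('o, 'm, 'z) cat_scheme \<Rightarrow> 'o set \<Rightarrow> 'o \<Rightarrow> 'o \<Rightarrow> 'm set" where
  "factoring C X A B = {g \<cdot>\<^bsub>C\<^esub> f | f g. \<exists>Y\<in>X. f \<in> Hom C A Y \<and> g \<in> Hom C Y B}"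

definition cong_mod :: "('o, 'm, 'z) cat_scheme \<Rightarrow> 'o set \<Rightarrow> ('m \<times> 'm) set" where
  "cong_mod C X = {(f, g). \<exists>A\<in>Ob C. \<exists>B\<in>Ob C. f \<in> Hom C A B \<and> g \<in> Hom C A B \<and>
     (\<exists>d\<in>factoring C X A B. f = g \<boxplus>\<^bsub>C\<^esub> d)}"

definition quot_class :: "('o, 'm, 'z) cat_scheme \<Rightarrow> 'o set \<Rightarrow> 'm \<Rightarrow> 'm set" where
  "quot_class C X f = cong_mod C X `` {f}"

definition quot_cat :: "('o, 'm, 'z) cat_scheme \<Rightarrow> 'o set \<Rightarrow> ('o, 'm set) cat" where
  "quot_cat C X = \<lparr>Ob = Ob C,
     Hom = (\<lambda>A B. Hom C A B // cong_mod C X),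
     Ide = (\<lambda>A. quot_class C X (Ide C A)),
     Comp = (\<lambda>G F. \<Union>g\<in>G. \<Union>f\<in>F. quot_class C X (g \<cdot>\<^bsub>C\<^esub> f)),
     Add = (\<lambda>F G. \<Union>f\<in>F. \<Union>g\<in>G. quot_class C X (f \<boxplus>\<^bsub>C\<^esub> g)),
     Zer = (\<lambda>A B. quot_class C X (Zer C A B))\<rparr>"

definition quot_functor :: "('o, 'm, 'z) cat_scheme \<Rightarrow> 'o set \<Rightarrow> ('o, 'm, 'o, 'm set) func" where
  "quot_functor C X = \<lparr>fob = (\<lambda>A. A), fmap = quot_class C X\<rparr>"

definition subfactor :: "('o, 'm, 'z) cat_scheme \<Rightarrow> 'o set \<Rightarrow> 'o set \<Rightarrow> ('o, 'm set) cat" where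
  "subfactor C X U = (quot_cat C X)\<lparr>Ob := U\<rparr>"

text \<open>\<open>\<Sigma>\<close> and \<open>\<Omega>\<close> on classes of arrows: extend a representative \<open>f\<close> to a morphism between the chosen
  triangles. The class of the resulting arrow does not depend on the choices, so the unions below
  are unions of a single class.\<close>

definition Sigma_functor ::
  "('o, 'm, 'z) tcat_scheme \<Rightarrow> 'o set \<Rightarrow> ('o \<Rightarrow> ('o, 'm) tri) \<Rightarrow> ('o, 'm set, 'o, 'm set) func" where
  "Sigma_functor T X L = \<lparr>fob = Sigma_ob L,
     fmap = (\<lambda>F. \<Union>{quot_class T X s | s. \<exists>A\<in>Ob T. \<exists>B\<in>Ob T. \<exists>f\<in>F \<inter> Hom T A B. \<exists>x.
        tri_mor T (Shift T) (L A) (L B) f x s})\<rparr>"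

definition Omega_functor ::
  "('o, 'm, 'z) tcat_scheme \<Rightarrow> 'o set \<Rightarrow> ('o \<Rightarrow> ('o, 'm) tri) \<Rightarrow> ('o, 'm set, 'o, 'm set) func" where
  "Omega_functor T X R = \<lparr>fob = Omega_ob R,
     fmap = (\<lambda>F. \<Union>{quot_class T X w | w. \<exists>A\<in>Ob T. \<exists>B\<in>Ob T. \<exists>f\<in>F \<inter> Hom T A B. \<exists>x.
        tri_mor T (Shift T) (R A) (R B) w x f})\<rparr>"

text \<open>The right triangle built on \<open>f : A \<rightarrow> B\<close> comes from the distinguished triangle
  \<open>\<Sigma>A[-1] \<rightarrow> B \<rightarrow> C \<rightarrow> \<Sigma>A\<close> on the composite \<open>\<Sigma>A[-1] \<rightarrow> A \<rightarrow> B\<close>. Its rotation, which avoids \<open>[-1]\<close>, is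
  \<open>B \<rightarrow> C \<rightarrow> \<Sigma>A \<rightarrow> B[1]\<close> with last arrow the composite of \<open>\<Sigma>A \<rightarrow> A[1]\<close> and \<open>f[1]\<close>; the signs of the two
  rotations agree.\<close>

definition right_triangles :: "('o, 'm, 'z) tcat_scheme \<Rightarrow> 'o set \<Rightarrow> ('o \<Rightarrow> ('o, 'm) tri) \<Rightarrow> 'o set \<Rightarrow>
     ('o, 'm set) tri set" where
  "right_triangles T X L U = {t. \<exists>A\<in>U. \<exists>B\<in>U. \<exists>f\<in>Hom T A B. \<exists>C g k.
     Tri B C (Sigma_ob L A) g k (shift_map T f \<cdot>\<^bsub>T\<^esub> arr3 (L A)) \<in> Dist T \<and>
     tri_isomorphic (subfactor T X U) (Sigma_functor T X L)
       (Tri A B C (quot_class T X f) (quot_class T X g) (quot_class T X k)) t}"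

text \<open>A left triangle \<open>\<Omega>C \<rightarrow> A \<rightarrow> B \<rightarrow> C\<close> with arrows \<open>k\<close>, \<open>g\<close>, \<open>f\<close> is written backwards as
  \<open>Tri C B A f g k\<close>, that is, as a diagram \<open>C \<rightarrow> B \<rightarrow> A \<rightarrow> \<Omega>C\<close> in the opposite category.\<close>

definition left_triangles :: "('o, 'm, 'z) tcat_scheme \<Rightarrow> 'o set \<Rightarrow> ('o \<Rightarrow> ('o, 'm) tri) \<Rightarrow> 'o set \<Rightarrow>
     ('o, 'm set) tri set" where
  "left_triangles T X R U = {t. \<exists>B\<in>U. \<exists>C\<in>U. \<exists>f\<in>Hom T B C. \<exists>A g k.
     Tri (Omega_ob R C) A B k g (arr3 (R C) \<cdot>\<^bsub>T\<^esub> f) \<in> Dist T \<and>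
     tri_isomorphic (op_cat (subfactor T X U)) (Omega_functor T X R)
       (Tri C B A (quot_class T X f) (quot_class T X g) (quot_class T X k)) t}"

definition right_structure :: "('o, 'm, 'z) tcat_scheme \<Rightarrow> 'o set \<Rightarrow> ('o \<Rightarrow> ('o, 'm) tri) \<Rightarrow> 'o set \<Rightarrow>
     ('o, 'm set) tcat" where
  "right_structure T X L U =
     add_triangles (subfactor T X U) (Sigma_functor T X L) (right_triangles T X L U)"

definition left_structure :: "('o, 'm, 'z) tcat_scheme \<Rightarrow> 'o set \<Rightarrow> ('o \<Rightarrow> ('o, 'm) tri) \<Rightarrow> 'o set \<Rightarrow>
     ('o, 'm set) tcat" where
  "left_structure T X R U =
     add_triangles (op_cat (subfactor T X U)) (Omega_functor T X R) (left_triangles T X R U)"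

text \<open>The axioms for left triangles are the axioms of a triangulated category read in the opposite
  category, with \<open>\<Omega>\<close> as shift.\<close>

definition subfactor_triangulated :: "('o, 'm, 'z) tcat_scheme \<Rightarrow> 'o set \<Rightarrow>
     ('o \<Rightarrow> ('o, 'm) tri) \<Rightarrow> ('o \<Rightarrow> ('o, 'm) tri) \<Rightarrow> 'o set \<Rightarrow> bool" where
  "subfactor_triangulated T X L R U \<longleftrightarrow>
     triangulated (right_structure T X L U) \<and> triangulated (left_structure T X R U)"

definition triangulated_subcategory :: "('o, 'm, 'z) tcat_scheme \<Rightarrow> 'o set \<Rightarrow>
     ('o \<Rightarrow> ('o, 'm) tri) \<Rightarrow> ('o \<Rightarrow> ('o, 'm) tri) \<Rightarrow> 'o set \<Rightarrow> bool" where
  "triangulated_subcategory T X L R S \<longleftrightarrow> additive_subcategory (quot_cat T X) S \<and>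
     (\<forall>A\<in>S. Sigma_ob L A \<in> S \<and> Omega_ob R A \<in> S) \<and>
     (\<forall>t\<in>right_triangles T X L (Ob T). ob1 t \<in> S \<and> ob2 t \<in> S \<longrightarrow> ob3 t \<in> S) \<and>
     (\<forall>t\<in>left_triangles T X R (Ob T). ob1 t \<in> S \<and> ob2 t \<in> S \<longrightarrow> ob3 t \<in> S) \<and>
     triangulated (restrict_tcat (right_structure T X L (Ob T)) S) \<and>
     triangulated (restrict_tcat (left_structure T X R (Ob T)) S)"

definition thick_subcategory :: "('o, 'm, 'z) tcat_scheme \<Rightarrow> 'o set \<Rightarrow>
     ('o \<Rightarrow> ('o, 'm) tri) \<Rightarrow> ('o \<Rightarrow> ('o, 'm) tri) \<Rightarrow> 'o set \<Rightarrow> bool" where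
  "thick_subcategory T X L R S \<longleftrightarrow>
     triangulated_subcategory T X L R S \<and> closed_under_summands (quot_cat T X) S"

text \<open>\<open>U/X\<close> as a full subcategory of \<open>T/X\<close>, and the inverse image under the projection functor.\<close>

definition quot_image :: "('o, 'm, 'z) cat_scheme \<Rightarrow> 'o set \<Rightarrow> 'o set \<Rightarrow> 'o set" where
  "quot_image C X U = fob (quot_functor C X) ` U"

definition quot_preimage :: "('o, 'm, 'z) cat_scheme \<Rightarrow> 'o set \<Rightarrow> 'o set \<Rightarrow> 'o set" where
  "quot_preimage C X S = {A \<in> Ob C. fob (quot_functor C X) A \<in> S}"

end

theory Submission
  imports Defs
begin

text \<open>The class of \<open>f : A \<rightarrow> B\<close> in \<open>U/X\<close> is determined by \<open>f[1] \<circ> h : \<Sigma>A \<rightarrow> B[1]\<close>, where \<open>h : \<Sigma>A \<rightarrow> A[1]\<close> is the last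
  arrow of the chosen triangle of \<open>A\<close>; and since coghosts \<open>Y[-1] \<rightarrow> B\<close> vanish, \<open>h : \<Sigma>B \<rightarrow> B[1]\<close> kills all arrows
  from \<open>X\<close>, so that the class of \<open>s : D \<rightarrow> \<Sigma>B\<close> is determined by \<open>h \<circ> s\<close>. Hence \<open>\<Sigma>[f] = [s]\<close> means
  \<open>h \<circ> s = f[1] \<circ> h\<close>, \<open>\<Sigma>\<close> is fully faithful, and it is dense because \<open>\<Omega>A \<rightarrow> X\<^sub>A\<close> is a left approximation (ghosts
  \<open>A \<rightarrow> Y[1]\<close> vanish). The right triangles are, up to isomorphism and rotation, the triangles \<open>B \<rightarrow> C \<rightarrow> D \<rightarrow> B[1]\<close> in \<open>U\<close>
  whose last arrow factors through \<open>h\<close>, and the axioms descend from the ambient category. The left triangles are the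
  right triangles of the opposite triangulated category.

  Conversely, if \<open>\<Sigma>\<close> is dense on a thick \<open>S\<close>, a ghost \<open>\<Sigma>B \<rightarrow> Y[1]\<close> has the form \<open>w[1] \<circ> h\<close>, and \<open>w : B \<rightarrow> Y\<close> extends
  along \<open>B \<rightarrow> X\<^sup>B\<close>, so the ghost is zero.\<close>

section \<open>Preadditive categories\<close>

text \<open>Two obstacles shape the argument: equality in \<open>U/X\<close> holds only modulo
  \<open>X\<close>, and the right triangles are given by homotopy push-outs, whose third object is
  not a cone in the ambient category of the arrow they are built on. The arrows \<open>h\<close>
  remove the first: composing with them turns congruences into equations between honest arrows, to
  which the ambient axioms apply. Against the second, extensions
  \<open>A \<rightarrow> Y \<rightarrow> D\<close> along which every arrow from \<open>A\<close> to
  \<open>X\<close> extends are used. They are classified by the arrows that factor through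
  \<open>h\<close>, they give right triangles with unchanged third object, and every arrow of
  \<open>U/X\<close> is up to isomorphism the first arrow of one. This change of representative is
  what makes the ambient octahedral axiom applicable.

  Each side uses both vanishing conditions: on the right, coghosts control arrows into
  \<open>\<Sigma> B\<close> and ghosts give density. Passing to the opposite exchanges the two, so
  the one-sided argument serves twice. The shift being only an autoequivalence, the opposite is
  built with a quasi-inverse, and last arrows have to be transposed.\<close>

locale preadd =
  fixes C :: "('o, 'm, 'z) cat_scheme" (structure)
  assumes preadditive_C: "preadditive C"
begin

text \<open>Sources and targets make typing a matter of rewriting: every equation below is a conditional
  rewrite rule whose conditions the simplifier discharges.\<close>

definition arr :: "'m \<Rightarrow> bool" where
  "arr f \<longleftrightarrow> (\<exists>A\<in>Ob C. \<exists>B\<in>Ob C. f \<in> Hom C A B)"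

definition dm :: "'m \<Rightarrow> 'o" where
  "dm f = (THE A. A \<in> Ob C \<and> (\<exists>B\<in>Ob C. f \<in> Hom C A B))"

definition cd :: "'m \<Rightarrow> 'o" where
  "cd f = (THE B. B \<in> Ob C \<and> (\<exists>A\<in>Ob C. f \<in> Hom C A B))"

definition ng :: "'m \<Rightarrow> 'm" where
  "ng f = neg C (dm f) (cd f) f"

lemma category_C: "category C"
  using preadditive_C by (simp add: preadditive_def)

lemma Hom_disjoint:
  assumes "A \<in> Ob C" "B \<in> Ob C" "A' \<in> Ob C" "B' \<in> Ob C" "f \<in> Hom C A B" "f \<in> Hom C A' B'"
  shows "A = A' \<and> B = B'"
proof -
  have "\<forall>A\<in>Ob C. \<forall>B\<in>Ob C. \<forall>A'\<in>Ob C. \<forall>B'\<in>Ob C. Hom C A B \<inter> Hom C A' B' \<noteq> {} \<longrightarrow> A = A' \<and> B = B'"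
    using category_C unfolding category_def by (elim conjE)
  then show ?thesis using assms by blast
qed

lemma dm_eq: "A \<in> Ob C \<Longrightarrow> B \<in> Ob C \<Longrightarrow> f \<in> Hom C A B \<Longrightarrow> dm f = A"
  unfolding dm_def by (rule the_equality) (auto dest: Hom_disjoint)

lemma cd_eq: "A \<in> Ob C \<Longrightarrow> B \<in> Ob C \<Longrightarrow> f \<in> Hom C A B \<Longrightarrow> cd f = B"
  unfolding cd_def by (rule the_equality) (auto dest: Hom_disjoint)

lemma arrE:
  assumes "arr f"
  shows "dm f \<in> Ob C" "cd f \<in> Ob C" "f \<in> Hom C (dm f) (cd f)"
  using assms dm_eq cd_eq unfolding arr_def by auto

lemma arr_Ob [simp]: "arr f \<Longrightarrow> dm f \<in> Ob C" "arr f \<Longrightarrow> cd f \<in> Ob C"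
  using arrE by auto

lemma Hom_iff [simp]:
  "A \<in> Ob C \<Longrightarrow> B \<in> Ob C \<Longrightarrow> f \<in> Hom C A B \<longleftrightarrow> arr f \<and> dm f = A \<and> cd f = B"
  using arrE dm_eq cd_eq unfolding arr_def by metis

lemma Ide_arr [simp]: "A \<in> Ob C \<Longrightarrow> arr (Ide C A)" "A \<in> Ob C \<Longrightarrow> dm (Ide C A) = A"
  "A \<in> Ob C \<Longrightarrow> cd (Ide C A) = A"
proof -
  have "Ide C A \<in> Hom C A A" if "A \<in> Ob C"
    using category_C that unfolding category_def by simp
  then show "A \<in> Ob C \<Longrightarrow> arr (Ide C A)" "A \<in> Ob C \<Longrightarrow> dm (Ide C A) = A"
    "A \<in> Ob C \<Longrightarrow> cd (Ide C A) = A" by auto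
qed

lemma comp_arr [simp]:
  assumes "arr f" "arr g" "dm g = cd f"
  shows "arr (g \<cdot> f)" "dm (g \<cdot> f) = dm f" "cd (g \<cdot> f) = cd g"
proof -
  have "\<forall>A\<in>Ob C. \<forall>B\<in>Ob C. \<forall>D\<in>Ob C. \<forall>f\<in>Hom C A B. \<forall>g\<in>Hom C B D. g \<cdot> f \<in> Hom C A D"
    using category_C unfolding category_def by (elim conjE)
  from this[rule_format, of "dm f" "cd f" "cd g" f g] have "g \<cdot> f \<in> Hom C (dm f) (cd g)"
    using assms by simp
  then show "arr (g \<cdot> f)" "dm (g \<cdot> f) = dm f" "cd (g \<cdot> f) = cd g" using assms by auto
qed

lemma comp_Ide [simp]:
  assumes "arr f"
  shows "B = cd f \<Longrightarrow> Ide C B \<cdot> f = f" "A = dm f \<Longrightarrow> f \<cdot> Ide C A = f"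
proof -
  have "\<forall>A\<in>Ob C. \<forall>B\<in>Ob C. \<forall>f\<in>Hom C A B. Ide C B \<cdot> f = f \<and> f \<cdot> Ide C A = f"
    using category_C unfolding category_def by (elim conjE)
  from this[rule_format, of "dm f" "cd f" f]
  show "B = cd f \<Longrightarrow> Ide C B \<cdot> f = f" "A = dm f \<Longrightarrow> f \<cdot> Ide C A = f"
    using assms by simp_all
qed

lemma assoc [simp]:
  assumes "arr f" "arr g" "arr h" "dm g = cd f" "dm h = cd g"
  shows "(h \<cdot> g) \<cdot> f = h \<cdot> (g \<cdot> f)"
proof -
  have "\<forall>A\<in>Ob C. \<forall>B\<in>Ob C. \<forall>D\<in>Ob C. \<forall>E\<in>Ob C. \<forall>f\<in>Hom C A B. \<forall>g\<in>Hom C B D. \<forall>h\<in>Hom C D E.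
        h \<cdot> (g \<cdot> f) = (h \<cdot> g) \<cdot> f"
    using category_C unfolding category_def by (elim conjE)
  from this[rule_format, of "dm f" "cd f" "cd g" "cd h" f g h] show ?thesis
    using arrE[OF assms(1)] arrE[OF assms(2)] arrE[OF assms(3)] assms by simp
qed

text \<open>The simplifier brackets composites to the right, so an equation for
  \<open>g \<cdot> f\<close> no longer matches inside a longer composite. With the tail
  \<open>x\<close> it does.\<close>

lemma comp_rewrite:
  "g \<cdot> f = w \<Longrightarrow> arr g \<Longrightarrow> arr f \<Longrightarrow> dm g = cd f \<Longrightarrow> arr x \<Longrightarrow> cd x = dm f \<Longrightarrow> g \<cdot> (f \<cdot> x) = w \<cdot> x"
  using assoc by metis

section \<open>Abelian group structure on arrows\<close>

lemma hom_comm_group: "A \<in> Ob C \<Longrightarrow> B \<in> Ob C \<Longrightarrow> comm_group (hom_group C A B)"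
  using preadditive_C by (simp add: preadditive_def)

lemma hom_group_simps [simp]:
  "carrier (hom_group C A B) = Hom C A B" "mult (hom_group C A B) = Add C"
  "one (hom_group C A B) = Zer C A B"
  by (simp_all add: hom_group_def)

lemma hom_group_facts:
  assumes "A \<in> Ob C" "B \<in> Ob C"
  shows "Zer C A B \<in> Hom C A B"
    "f \<in> Hom C A B \<Longrightarrow> g \<in> Hom C A B \<Longrightarrow> f \<boxplus> g \<in> Hom C A B"
    "f \<in> Hom C A B \<Longrightarrow> g \<in> Hom C A B \<Longrightarrow> h \<in> Hom C A B \<Longrightarrow> (f \<boxplus> g) \<boxplus> h = f \<boxplus> (g \<boxplus> h)"
    "f \<in> Hom C A B \<Longrightarrow> g \<in> Hom C A B \<Longrightarrow> f \<boxplus> g = g \<boxplus> f"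
    "f \<in> Hom C A B \<Longrightarrow> Zer C A B \<boxplus> f = f"
    "f \<in> Hom C A B \<Longrightarrow> neg C A B f \<in> Hom C A B"
    "f \<in> Hom C A B \<Longrightarrow> f \<boxplus> neg C A B f = Zer C A B"
proof -
  interpret G: comm_group "hom_group C A B" by (rule hom_comm_group[OF assms])
  note c = hom_group_simps
  show "Zer C A B \<in> Hom C A B" using G.one_closed unfolding c .
  show "f \<in> Hom C A B \<Longrightarrow> g \<in> Hom C A B \<Longrightarrow> f \<boxplus> g \<in> Hom C A B"
    using G.m_closed[of f g] unfolding c .
  show "f \<in> Hom C A B \<Longrightarrow> g \<in> Hom C A B \<Longrightarrow> h \<in> Hom C A B \<Longrightarrow> (f \<boxplus> g) \<boxplus> h = f \<boxplus> (g \<boxplus> h)"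
    using G.m_assoc[of f g h] unfolding c .
  show "f \<in> Hom C A B \<Longrightarrow> g \<in> Hom C A B \<Longrightarrow> f \<boxplus> g = g \<boxplus> f"
    using G.m_comm[of f g] unfolding c .
  show "f \<in> Hom C A B \<Longrightarrow> Zer C A B \<boxplus> f = f"
    using G.l_one[of f] unfolding c .
  show "f \<in> Hom C A B \<Longrightarrow> neg C A B f \<in> Hom C A B"
    using G.inv_closed[of f] unfolding c neg_def .
  show "f \<in> Hom C A B \<Longrightarrow> f \<boxplus> neg C A B f = Zer C A B"
    using G.r_inv[of f] unfolding c neg_def .
qed

lemma Zer_arr [simp]:
  assumes "A \<in> Ob C" "B \<in> Ob C"
  shows "arr (Zer C A B)" "dm (Zer C A B) = A" "cd (Zer C A B) = B"
  using hom_group_facts(1)[OF assms] assms by auto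

lemma add_arr [simp]:
  assumes "arr f" "arr g" "dm f = dm g" "cd f = cd g"
  shows "arr (f \<boxplus> g)" "dm (f \<boxplus> g) = dm g" "cd (f \<boxplus> g) = cd g"
  using hom_group_facts(2)[of "dm g" "cd g" f g] assms by auto

lemma neg_eq_ng: "A \<in> Ob C \<Longrightarrow> B \<in> Ob C \<Longrightarrow> arr f \<Longrightarrow> dm f = A \<Longrightarrow> cd f = B \<Longrightarrow> neg C A B f = ng f"
  by (simp add: ng_def)

lemma ng_arr [simp]:
  assumes "arr f"
  shows "arr (ng f)" "dm (ng f) = dm f" "cd (ng f) = cd f"
  using hom_group_facts(6)[of "dm f" "cd f" f] assms unfolding ng_def by auto

lemma add_assoc:
  assumes "arr f" "arr g" "arr h" "dm f = dm g" "cd f = cd g" "dm g = dm h" "cd g = cd h"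
  shows "(f \<boxplus> g) \<boxplus> h = f \<boxplus> (g \<boxplus> h)"
  using hom_group_facts(3)[of "dm h" "cd h" f g h] assms by auto

lemma add_comm:
  assumes "arr f" "arr g" "dm f = dm g" "cd f = cd g"
  shows "f \<boxplus> g = g \<boxplus> f"
  using hom_group_facts(4)[of "dm g" "cd g" f g] assms by auto

lemma add_left_comm:
  assumes "arr f" "arr g" "arr h" "dm f = dm g" "cd f = cd g" "dm g = dm h" "cd g = cd h"
  shows "f \<boxplus> (g \<boxplus> h) = g \<boxplus> (f \<boxplus> h)"
  using assms add_assoc[of f g h] add_assoc[of g f h] add_comm[of f g] by simp

lemma add_Zer [simp]:
  assumes "arr f" "A = dm f" "B = cd f"
  shows "Zer C A B \<boxplus> f = f" "f \<boxplus> Zer C A B = f"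
proof -
  show *: "Zer C A B \<boxplus> f = f"
    unfolding assms(2,3) by (rule hom_group_facts(5)) (use arrE[OF assms(1)] in auto)
  have "f \<boxplus> Zer C A B = Zer C A B \<boxplus> f" by (rule add_comm) (use assms in auto)
  then show "f \<boxplus> Zer C A B = f" using * by simp
qed

lemma add_ng [simp]:
  assumes "arr f"
  shows "f \<boxplus> ng f = Zer C (dm f) (cd f)" "ng f \<boxplus> f = Zer C (dm f) (cd f)"
proof -
  show *: "f \<boxplus> ng f = Zer C (dm f) (cd f)"
    unfolding ng_def by (rule hom_group_facts(7)) (use arrE[OF assms(1)] in auto)
  have "ng f \<boxplus> f = f \<boxplus> ng f" by (rule add_comm) (use assms in auto)
  then show "ng f \<boxplus> f = Zer C (dm f) (cd f)" using * by simp
qed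

lemma add_ng_cancel [simp]:
  assumes "arr f" "arr g" "dm f = dm g" "cd f = cd g"
  shows "f \<boxplus> (ng f \<boxplus> g) = g" "ng f \<boxplus> (f \<boxplus> g) = g"
proof -
  have "(f \<boxplus> ng f) \<boxplus> g = f \<boxplus> (ng f \<boxplus> g)" by (rule add_assoc) (use assms in auto)
  then show "f \<boxplus> (ng f \<boxplus> g) = g" using assms by simp
  have "(ng f \<boxplus> f) \<boxplus> g = ng f \<boxplus> (f \<boxplus> g)" by (rule add_assoc) (use assms in auto)
  then show "ng f \<boxplus> (f \<boxplus> g) = g" using assms by simp
qed

lemma add_left_cancel:
  assumes "arr f" "arr g" "arr h" "dm f = dm g" "cd f = cd g" "dm g = dm h" "cd g = cd h"
  shows "f \<boxplus> g = f \<boxplus> h \<longleftrightarrow> g = h"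
proof
  assume "f \<boxplus> g = f \<boxplus> h"
  then have "ng f \<boxplus> (f \<boxplus> g) = ng f \<boxplus> (f \<boxplus> h)" by simp
  then show "g = h" using assms by simp
qed simp

lemma add_eq_Zer:
  assumes "arr f" "arr g" "dm f = dm g" "cd f = cd g"
  shows "f \<boxplus> g = Zer C (dm g) (cd g) \<longleftrightarrow> g = ng f"
proof -
  have "f \<boxplus> g = f \<boxplus> ng f \<longleftrightarrow> g = ng f" by (rule add_left_cancel) (use assms in auto)
  then show ?thesis using assms by simp
qed

lemma ng_ng [simp]: "arr f \<Longrightarrow> ng (ng f) = f"
  using add_eq_Zer[of "ng f" f] by simp

lemma ng_Zer [simp]: "A \<in> Ob C \<Longrightarrow> B \<in> Ob C \<Longrightarrow> ng (Zer C A B) = Zer C A B"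
  using add_eq_Zer[of "Zer C A B" "Zer C A B"] by simp

lemma ng_inject: "arr f \<Longrightarrow> arr g \<Longrightarrow> ng f = ng g \<longleftrightarrow> f = g"
  using ng_ng by metis

lemma ng_eq_Zer_iff: "arr f \<Longrightarrow> ng f = Zer C (dm f) (cd f) \<longleftrightarrow> f = Zer C (dm f) (cd f)"
  by (metis ng_Zer ng_ng arr_Ob)

lemma diff_eq_Zer_iff:
  assumes "arr f" "arr g" "dm f = dm g" "cd f = cd g" "A = dm g" "B = cd g"
  shows "f \<boxplus> ng g = Zer C A B \<longleftrightarrow> f = g"
proof -
  have "f \<boxplus> ng g = Zer C (dm (ng g)) (cd (ng g)) \<longleftrightarrow> ng g = ng f"
    by (rule add_eq_Zer) (use assms in auto)
  then show ?thesis using assms by (auto simp: ng_inject)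
qed

lemma distrib [simp]:
  assumes "arr f" "arr f'" "dm f = dm f'" "cd f = cd f'" "arr g" "dm g = cd f'"
  shows "g \<cdot> (f \<boxplus> f') = g \<cdot> f \<boxplus> g \<cdot> f'"
proof -
  have "\<forall>A\<in>Ob C. \<forall>B\<in>Ob C. \<forall>D\<in>Ob C. \<forall>f\<in>Hom C A B. \<forall>f'\<in>Hom C A B. \<forall>g\<in>Hom C B D. \<forall>g'\<in>Hom C B D.
        g \<cdot> (f \<boxplus> f') = g \<cdot> f \<boxplus> g \<cdot> f' \<and> (g \<boxplus> g') \<cdot> f = g \<cdot> f \<boxplus> g' \<cdot> f"
    using preadditive_C unfolding preadditive_def by (elim conjE)
  from this[rule_format, of "dm f'" "cd f'" "cd g" f f' g g] show ?thesis using assms by simp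
qed

lemma distrib2 [simp]:
  assumes "arr g" "arr g'" "dm g = dm g'" "cd g = cd g'" "arr f" "dm g' = cd f"
  shows "(g \<boxplus> g') \<cdot> f = g \<cdot> f \<boxplus> g' \<cdot> f"
proof -
  have "\<forall>A\<in>Ob C. \<forall>B\<in>Ob C. \<forall>D\<in>Ob C. \<forall>f\<in>Hom C A B. \<forall>f'\<in>Hom C A B. \<forall>g\<in>Hom C B D. \<forall>g'\<in>Hom C B D.
        g \<cdot> (f \<boxplus> f') = g \<cdot> f \<boxplus> g \<cdot> f' \<and> (g \<boxplus> g') \<cdot> f = g \<cdot> f \<boxplus> g' \<cdot> f"
    using preadditive_C unfolding preadditive_def by (elim conjE)
  from this[rule_format, of "dm f" "cd f" "cd g'" f f g g'] show ?thesis using assms by simp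
qed

lemma comp_Zer [simp]:
  assumes "arr g" "A \<in> Ob C" "B = dm g"
  shows "g \<cdot> Zer C A B = Zer C A (cd g)"
proof -
  have "g \<cdot> (Zer C A B \<boxplus> Zer C A B) = g \<cdot> Zer C A B \<boxplus> g \<cdot> Zer C A B"
    by (rule distrib) (use assms in auto)
  moreover have "g \<cdot> Zer C A B \<boxplus> g \<cdot> Zer C A B = g \<cdot> Zer C A B \<boxplus> Zer C A (cd g) \<longleftrightarrow>
      g \<cdot> Zer C A B = Zer C A (cd g)"
    by (rule add_left_cancel) (use assms in auto)
  ultimately show ?thesis using assms by simp
qed

lemma Zer_comp [simp]:
  assumes "arr g" "A \<in> Ob C" "B = cd g"
  shows "Zer C B A \<cdot> g = Zer C (dm g) A"
proof -
  have "(Zer C B A \<boxplus> Zer C B A) \<cdot> g = Zer C B A \<cdot> g \<boxplus> Zer C B A \<cdot> g"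
    by (rule distrib2) (use assms in auto)
  moreover have "Zer C B A \<cdot> g \<boxplus> Zer C B A \<cdot> g = Zer C B A \<cdot> g \<boxplus> Zer C (dm g) A \<longleftrightarrow>
      Zer C B A \<cdot> g = Zer C (dm g) A"
    by (rule add_left_cancel) (use assms in auto)
  ultimately show ?thesis using assms by simp
qed

lemma comp_ng [simp]:
  assumes "arr f" "arr g" "dm g = cd f"
  shows "g \<cdot> ng f = ng (g \<cdot> f)"
proof -
  have "g \<cdot> (f \<boxplus> ng f) = g \<cdot> f \<boxplus> g \<cdot> ng f" by (rule distrib) (use assms in auto)
  moreover have "g \<cdot> f \<boxplus> g \<cdot> ng f = Zer C (dm (g \<cdot> ng f)) (cd (g \<cdot> ng f)) \<longleftrightarrow> g \<cdot> ng f = ng (g \<cdot> f)"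
    by (rule add_eq_Zer) (use assms in auto)
  ultimately show ?thesis using assms by simp
qed

lemma ng_comp [simp]:
  assumes "arr f" "arr g" "dm g = cd f"
  shows "ng g \<cdot> f = ng (g \<cdot> f)"
proof -
  have "(g \<boxplus> ng g) \<cdot> f = g \<cdot> f \<boxplus> ng g \<cdot> f" by (rule distrib2) (use assms in auto)
  moreover have "g \<cdot> f \<boxplus> ng g \<cdot> f = Zer C (dm (ng g \<cdot> f)) (cd (ng g \<cdot> f)) \<longleftrightarrow> ng g \<cdot> f = ng (g \<cdot> f)"
    by (rule add_eq_Zer) (use assms in auto)
  ultimately show ?thesis using assms by simp
qed

lemma ng_add:
  assumes "arr f" "arr g" "dm f = dm g" "cd f = cd g"
  shows "ng (f \<boxplus> g) = ng f \<boxplus> ng g"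
proof -
  have "(f \<boxplus> g) \<boxplus> (ng f \<boxplus> ng g) = (f \<boxplus> ng f) \<boxplus> (g \<boxplus> ng g)"
    using assms by (simp add: add_assoc add_left_comm)
  also have "\<dots> = Zer C (dm g) (cd g)" using assms by simp
  finally have *: "(f \<boxplus> g) \<boxplus> (ng f \<boxplus> ng g) = Zer C (dm g) (cd g)" .
  have "(f \<boxplus> g) \<boxplus> (ng f \<boxplus> ng g) = Zer C (dm (ng f \<boxplus> ng g)) (cd (ng f \<boxplus> ng g)) \<longleftrightarrow>
      ng f \<boxplus> ng g = ng (f \<boxplus> g)"
    by (rule add_eq_Zer) (use assms in auto)
  then show ?thesis using * assms by simp
qed

section \<open>Isomorphisms, zero objects and biproducts\<close>

definition isom :: "'m \<Rightarrow> bool" where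
  "isom f \<longleftrightarrow> arr f \<and> (\<exists>g. arr g \<and> dm g = cd f \<and> cd g = dm f \<and> g \<cdot> f = Ide C (dm f) \<and> f \<cdot> g = Ide C (cd f))"

lemma iso_arrow_iff:
  "A \<in> Ob C \<Longrightarrow> B \<in> Ob C \<Longrightarrow> iso_arrow C A B f \<longleftrightarrow> isom f \<and> dm f = A \<and> cd f = B"
  unfolding iso_arrow_def isom_def by (auto simp: Bex_def)

lemma isomorphic_iff: "isomorphic C A B \<longleftrightarrow> (\<exists>f. isom f \<and> dm f = A \<and> cd f = B)"
  unfolding isomorphic_def using iso_arrow_iff[of A B] by (metis arr_Ob isom_def)

lemma isomE:
  assumes "isom f"
  obtains g where "arr f" "isom g" "arr g" "dm g = cd f" "cd g = dm f"
    "g \<cdot> f = Ide C (dm f)" "f \<cdot> g = Ide C (cd f)"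
proof -
  from assms obtain g where "arr f" "arr g" "dm g = cd f" "cd g = dm f"
    "g \<cdot> f = Ide C (dm f)" "f \<cdot> g = Ide C (cd f)" by (auto simp: isom_def)
  moreover from this have "isom g" by (auto simp: isom_def)
  ultimately show ?thesis using that by blast
qed

lemma isom_inverse: "isom f \<Longrightarrow> \<exists>g. isom g \<and> arr g \<and> dm g = cd f \<and> cd g = dm f \<and>
    g \<cdot> f = Ide C (dm f) \<and> f \<cdot> g = Ide C (cd f)"
  by (auto elim: isomE)

lemma isomI: "arr f \<Longrightarrow> arr g \<Longrightarrow> dm g = cd f \<Longrightarrow> cd g = dm f \<Longrightarrow> g \<cdot> f = Ide C (dm f) \<Longrightarrow>
   f \<cdot> g = Ide C (cd f) \<Longrightarrow> isom f"
  by (auto simp: isom_def)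

lemma isom_arr [simp]: "isom f \<Longrightarrow> arr f"
  by (simp add: isom_def)

lemma isom_Ide [simp]: "A \<in> Ob C \<Longrightarrow> isom (Ide C A)"
  by (rule isomI[of _ "Ide C A"]) auto

lemma isom_comp:
  assumes "isom f" "isom g" "dm g = cd f"
  shows "isom (g \<cdot> f)"
proof -
  from assms(1) obtain f' where f: "arr f" "arr f'" "dm f' = cd f" "cd f' = dm f"
    "f' \<cdot> f = Ide C (dm f)" "f \<cdot> f' = Ide C (cd f)" by (rule isomE)
  from assms(2) obtain g' where g: "arr g" "arr g'" "dm g' = cd g" "cd g' = dm g"
    "g' \<cdot> g = Ide C (dm g)" "g \<cdot> g' = Ide C (cd g)" by (rule isomE)
  show ?thesis using f g assms(3)
    by (intro isomI[of _ "f' \<cdot> g'"]) (auto simp: comp_rewrite[OF f(6)] comp_rewrite[OF g(5)])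
qed

lemma isom_ng: "isom f \<Longrightarrow> isom (ng f)"
proof -
  assume "isom f"
  then obtain g where "arr f" "arr g" "dm g = cd f" "cd g = dm f"
    "g \<cdot> f = Ide C (dm f)" "f \<cdot> g = Ide C (cd f)" by (rule isomE)
  then show "isom (ng f)" by (intro isomI[of _ "ng g"]) auto
qed

lemma isom_cancel:
  assumes "isom f" "arr x" "arr y" "cd x = dm f" "cd y = dm f" "f \<cdot> x = f \<cdot> y"
  shows "x = y"
proof -
  from assms(1) obtain g where g: "arr f" "arr g" "dm g = cd f" "cd g = dm f"
    "g \<cdot> f = Ide C (dm f)" by (rule isomE)
  have c: "g \<cdot> (f \<cdot> z) = z" if "arr z" "cd z = dm f" for z
    using g that by (simp add: comp_rewrite[OF g(5)])
  have "g \<cdot> (f \<cdot> x) = g \<cdot> (f \<cdot> y)" using assms by simp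
  then show ?thesis unfolding c[OF assms(2,4)] c[OF assms(3,5)] .
qed

text \<open>Among objects of a preadditive category this characterises zero objects
  (\<open>zob_iff\<close>). Being an equation between two arrows, it passes directly to the shift,
  the opposite and the quotient.\<close>

definition zob :: "'o \<Rightarrow> bool" where
  "zob Z \<longleftrightarrow> Z \<in> Ob C \<and> Ide C Z = Zer C Z Z"

lemma zobD:
  assumes "zob Z"
  shows "Z \<in> Ob C" "arr f \<Longrightarrow> dm f = Z \<Longrightarrow> f = Zer C Z (cd f)" "arr f \<Longrightarrow> cd f = Z \<Longrightarrow> f = Zer C (dm f) Z"
proof -
  show "Z \<in> Ob C" using assms by (simp add: zob_def)
  have i: "Ide C Z = Zer C Z Z" using assms by (simp add: zob_def)
  show "f = Zer C Z (cd f)" if "arr f" "dm f = Z"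
    using comp_Ide(2)[OF that(1) that(2)[symmetric]] that i by auto
  show "f = Zer C (dm f) Z" if "arr f" "cd f = Z"
    using comp_Ide(1)[OF that(1) that(2)[symmetric]] that i by auto
qed

lemma zob_iff: "zero_object C Z \<longleftrightarrow> zob Z"
proof
  assume z: "zero_object C Z"
  then have Z: "Z \<in> Ob C" and "\<exists>!f. f \<in> Hom C Z Z" unfolding zero_object_def by blast+
  moreover have "Ide C Z \<in> Hom C Z Z" "Zer C Z Z \<in> Hom C Z Z" using Z by auto
  ultimately show "zob Z" unfolding zob_def by blast
next
  assume z: "zob Z"
  have "\<exists>!f. f \<in> Hom C Z A" "\<exists>!f. f \<in> Hom C A Z" if "A \<in> Ob C" for A
  proof -
    show "\<exists>!f. f \<in> Hom C Z A"
      using zobD[OF z] that by (intro ex1I[of _ "Zer C Z A"]) auto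
    show "\<exists>!f. f \<in> Hom C A Z"
      using zobD[OF z] that by (intro ex1I[of _ "Zer C A Z"]) auto
  qed
  then show "zero_object C Z" using zobD(1)[OF z] by (simp add: zero_object_def)
qed

definition biprod :: "'m \<Rightarrow> 'm \<Rightarrow> 'm \<Rightarrow> 'm \<Rightarrow> bool" where
  "biprod i j p q \<longleftrightarrow> arr i \<and> arr j \<and> arr p \<and> arr q \<and> cd j = cd i \<and> dm p = cd i \<and> dm q = cd i \<and>
     cd p = dm i \<and> cd q = dm j \<and> p \<cdot> i = Ide C (dm i) \<and> q \<cdot> j = Ide C (dm j) \<and>
     p \<cdot> j = Zer C (dm j) (dm i) \<and> q \<cdot> i = Zer C (dm i) (dm j) \<and> i \<cdot> p \<boxplus> j \<cdot> q = Ide C (cd i)"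

lemma biproduct_iff:
  "biproduct C A B P \<longleftrightarrow> (\<exists>i j p q. biprod i j p q \<and> dm i = A \<and> dm j = B \<and> cd i = P)"
  (is "?l \<longleftrightarrow> ?r")
proof
  assume ?l
  then have "A \<in> Ob C" "B \<in> Ob C" "P \<in> Ob C" by (auto simp: biproduct_def)
  with \<open>?l\<close> show ?r unfolding biproduct_def biprod_def by (auto simp: Bex_def)
next
  assume ?r
  then obtain i j p q where h: "biprod i j p q" "dm i = A" "dm j = B" "cd i = P" by auto
  then have o: "A \<in> Ob C" "B \<in> Ob C" "P \<in> Ob C" by (auto simp: biprod_def)
  from h have "i \<in> Hom C A P" "j \<in> Hom C B P" "p \<in> Hom C P A" "q \<in> Hom C P B"
    "p \<cdot> i = Ide C A \<and> q \<cdot> j = Ide C B \<and> p \<cdot> j = Zer C B A \<and> q \<cdot> i = Zer C A B \<and>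
     i \<cdot> p \<boxplus> j \<cdot> q = Ide C P"
    using o by (simp_all add: biprod_def)
  then show ?l using o unfolding biproduct_def by blast
qed

end

lemma additive_preadd: "additive C \<Longrightarrow> preadd C"
  by unfold_locales (simp add: additive_def)

section \<open>Pretriangulated structures\<close>

context preadd
begin

lemma functor_iff:
  "is_functor C C F \<longleftrightarrow>
     (\<forall>A\<in>Ob C. fob F A \<in> Ob C \<and> fmap F (Ide C A) = Ide C (fob F A)) \<and>
     (\<forall>f. arr f \<longrightarrow> arr (fmap F f) \<and> dm (fmap F f) = fob F (dm f) \<and> cd (fmap F f) = fob F (cd f)) \<and>
     (\<forall>f g. arr f \<longrightarrow> arr g \<longrightarrow> dm g = cd f \<longrightarrow> fmap F (g \<cdot> f) = fmap F g \<cdot> fmap F f)"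
  (is "_ \<longleftrightarrow> ?o \<and> ?a \<and> ?c")
proof
  assume F: "is_functor C C F"
  then have o: ?o by (simp add: is_functor_def)
  have m: "fmap F f \<in> Hom C (fob F A) (fob F B)" if "A \<in> Ob C" "B \<in> Ob C" "f \<in> Hom C A B" for A B f
    using F that unfolding is_functor_def by blast
  have c: "fmap F (g \<cdot> f) = fmap F g \<cdot> fmap F f"
    if "A \<in> Ob C" "B \<in> Ob C" "E \<in> Ob C" "f \<in> Hom C A B" "g \<in> Hom C B E" for A B E f g
    using F that unfolding is_functor_def by blast
  have ?a using m[of "dm f" "cd f" f for f] o by simp
  moreover have ?c using c[of "dm f" "cd f" "cd g" f g for f g] by simp
  ultimately show "?o \<and> ?a \<and> ?c" using o by blast
next
  assume "?o \<and> ?a \<and> ?c"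
  then show "is_functor C C F" by (simp add: is_functor_def)
qed

lemma naturally_isomorphic_iff:
  assumes "is_functor C C F" "is_functor C C G"
  shows "naturally_isomorphic C C F G \<longleftrightarrow> (\<exists>\<eta>.
     (\<forall>A\<in>Ob C. isom (\<eta> A) \<and> dm (\<eta> A) = fob F A \<and> cd (\<eta> A) = fob G A) \<and>
     (\<forall>f. arr f \<longrightarrow> fmap G f \<cdot> \<eta> (dm f) = \<eta> (cd f) \<cdot> fmap F f))"
proof -
  have o: "A \<in> Ob C \<Longrightarrow> fob F A \<in> Ob C \<and> fob G A \<in> Ob C" for A
    using assms by (simp add: functor_iff)
  have "(\<forall>A\<in>Ob C. \<forall>B\<in>Ob C. \<forall>f\<in>Hom C A B. fmap G f \<cdot> \<eta> A = \<eta> B \<cdot> fmap F f) \<longleftrightarrow>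
     (\<forall>f. arr f \<longrightarrow> fmap G f \<cdot> \<eta> (dm f) = \<eta> (cd f) \<cdot> fmap F f)" for \<eta>
    by (auto simp: arrE)
  then show ?thesis unfolding naturally_isomorphic_def using o by (simp add: iso_arrow_iff)
qed

end

section \<open>Additive shifts and candidate triangles\<close>

locale shifted = preadd C for C :: "('o, 'm, 'z) tcat_scheme" (structure) +
  assumes shift_additive: "additive_functor C C (Shift C)"
    and Dist_candidate: "\<forall>t\<in>Dist C. candidate C (Shift C) t"
begin

abbreviation So :: "'o \<Rightarrow> 'o" where "So \<equiv> shift_ob C"

abbreviation S :: "'m \<Rightarrow> 'm" where "S \<equiv> shift_map C"

lemma shift_functor: "is_functor C C (Shift C)"
  using shift_additive by (simp add: additive_functor_def)

lemma shift_simps [simp]: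
  "A \<in> Ob C \<Longrightarrow> So A \<in> Ob C"
  "A \<in> Ob C \<Longrightarrow> S (Ide C A) = Ide C (So A)"
  "arr f \<Longrightarrow> arr (S f)" "arr f \<Longrightarrow> dm (S f) = So (dm f)" "arr f \<Longrightarrow> cd (S f) = So (cd f)"
  "arr f \<Longrightarrow> arr g \<Longrightarrow> dm g = cd f \<Longrightarrow> S (g \<cdot> f) = S g \<cdot> S f"
  using shift_functor by (simp_all add: functor_iff)

lemma shift_add [simp]:
  assumes "arr f" "arr g" "dm f = dm g" "cd f = cd g"
  shows "S (f \<boxplus> g) = S f \<boxplus> S g"
proof -
  have "\<forall>A\<in>Ob C. \<forall>B\<in>Ob C. \<forall>f\<in>Hom C A B. \<forall>g\<in>Hom C A B. S (f \<boxplus> g) = S f \<boxplus> S g"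
    using shift_additive unfolding additive_functor_def by (elim conjE)
  from this[rule_format, of "dm g" "cd g" f g] show ?thesis using assms by simp
qed

lemma shift_Zer [simp]:
  assumes "A \<in> Ob C" "B \<in> Ob C"
  shows "S (Zer C A B) = Zer C (So A) (So B)"
proof -
  have "S (Zer C A B \<boxplus> Zer C A B) = S (Zer C A B) \<boxplus> S (Zer C A B)"
    by (rule shift_add) (use assms in auto)
  moreover have "S (Zer C A B) \<boxplus> S (Zer C A B) = S (Zer C A B) \<boxplus> Zer C (So A) (So B) \<longleftrightarrow>
    S (Zer C A B) = Zer C (So A) (So B)"
    by (rule add_left_cancel) (use assms in auto)
  ultimately show ?thesis using assms by simp
qed

lemma shift_ng [simp]:
  assumes "arr f"
  shows "S (ng f) = ng (S f)"
proof -
  have "S (f \<boxplus> ng f) = S f \<boxplus> S (ng f)" by (rule shift_add) (use assms in auto)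
  moreover have "S f \<boxplus> S (ng f) = Zer C (dm (S (ng f))) (cd (S (ng f))) \<longleftrightarrow> S (ng f) = ng (S f)"
    by (rule add_eq_Zer) (use assms in auto)
  ultimately show ?thesis using assms by simp
qed

lemma shift_comp:
  "g \<cdot> f = w \<Longrightarrow> arr f \<Longrightarrow> arr g \<Longrightarrow> dm g = cd f \<Longrightarrow> S g \<cdot> S f = S w"
  using shift_simps(6)[of f g] by simp

lemma shift_square:
  "g \<cdot> f = g' \<cdot> f' \<Longrightarrow> arr f \<Longrightarrow> arr g \<Longrightarrow> dm g = cd f \<Longrightarrow> arr f' \<Longrightarrow> arr g' \<Longrightarrow> dm g' = cd f' \<Longrightarrow>
    S g \<cdot> S f = S g' \<cdot> S f'"
  using shift_simps(6)[of f g] shift_simps(6)[of f' g'] by simp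

lemma shift_isom: "isom f \<Longrightarrow> isom (S f)"
proof -
  assume "isom f"
  then obtain g where g: "arr f" "arr g" "dm g = cd f" "cd g = dm f"
    "g \<cdot> f = Ide C (dm f)" "f \<cdot> g = Ide C (cd f)" by (rule isomE)
  then have "S g \<cdot> S f = S (Ide C (dm f))" "S f \<cdot> S g = S (Ide C (cd f))"
    by (simp_all add: shift_comp)
  then show ?thesis using g by (intro isomI[of _ "S g"]) auto
qed

text \<open>Naturality expresses \<open>f\<close> through \<open>G (S f)\<close> and invertible
  arrows, which gives faithfulness; the other natural isomorphism makes \<open>G\<close> faithful
  too, and fullness of the shift rests on that.\<close>

lemma equivalence_full_faithful:
  assumes "equivalence C C (Shift C)"
  shows "\<lbrakk>arr f; arr g; dm f = dm g; cd f = cd g; S f = S g\<rbrakk> \<Longrightarrow> f = g"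
    and "\<lbrakk>A \<in> Ob C; B \<in> Ob C; arr h; dm h = So A; cd h = So B\<rbrakk> \<Longrightarrow> \<exists>f. arr f \<and> dm f = A \<and> cd f = B \<and> S f = h"
    and "A \<in> Ob C \<Longrightarrow> \<exists>B e. B \<in> Ob C \<and> isom e \<and> dm e = So B \<and> cd e = A"
proof -
  obtain G where G: "is_functor C C G"
    and 1: "naturally_isomorphic C C (comp_func G (Shift C)) id_func"
    and 2: "naturally_isomorphic C C (comp_func (Shift C) G) id_func"
    using assms unfolding equivalence_def by blast
  note g = G[unfolded functor_iff]
  have i: "is_functor C C id_func" by (simp add: functor_iff id_func_def)
  have c1: "is_functor C C (comp_func G (Shift C))" and c2: "is_functor C C (comp_func (Shift C) G)"
    using g by (simp_all add: functor_iff comp_func_def)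
  obtain \<eta> where \<eta>: "\<forall>A\<in>Ob C. isom (\<eta> A) \<and> dm (\<eta> A) = fob G (So A) \<and> cd (\<eta> A) = A"
    and n\<eta>: "\<forall>f. arr f \<longrightarrow> f \<cdot> \<eta> (dm f) = \<eta> (cd f) \<cdot> fmap G (S f)"
    using 1 unfolding naturally_isomorphic_iff[OF c1 i] by (auto simp: id_func_def comp_func_def)
  obtain \<epsilon> where \<epsilon>: "\<forall>A\<in>Ob C. isom (\<epsilon> A) \<and> dm (\<epsilon> A) = So (fob G A) \<and> cd (\<epsilon> A) = A"
    and n\<epsilon>: "\<forall>f. arr f \<longrightarrow> f \<cdot> \<epsilon> (dm f) = \<epsilon> (cd f) \<cdot> S (fmap G f)"
    using 2 unfolding naturally_isomorphic_iff[OF c2 i] by (auto simp: id_func_def comp_func_def)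
  have ri: "f = g" if e: "isom e" "arr f" "arr g" "dm f = cd e" "dm g = cd e" "f \<cdot> e = g \<cdot> e" for e f g
  proof -
    from e(1) obtain e' where e': "arr e" "arr e'" "dm e' = cd e" "cd e' = dm e" "e \<cdot> e' = Ide C (cd e)"
      by (rule isomE)
    have c: "(z \<cdot> e) \<cdot> e' = z" if "arr z" "dm z = cd e" for z
      using e' that by simp
    have "(f \<cdot> e) \<cdot> e' = (g \<cdot> e) \<cdot> e'" using e(6) by simp
    then show ?thesis unfolding c[OF e(2,4)] c[OF e(3,5)] .
  qed
  have fa: "f = g" if h: "arr f" "arr g" "dm f = dm g" "cd f = cd g" "S f = S g" for f g
  proof (rule ri)
    show "isom (\<eta> (dm g))" using \<eta> h(2) by simp
    show "f \<cdot> \<eta> (dm g) = g \<cdot> \<eta> (dm g)" using n\<eta>[rule_format, of f] n\<eta>[rule_format, of g] h by metis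
  qed (use \<eta> h in auto)
  have fa': "f = g" if h: "arr f" "arr g" "dm f = dm g" "cd f = cd g" "fmap G f = fmap G g" for f g
  proof (rule ri)
    show "isom (\<epsilon> (dm g))" using \<epsilon> h(2) by simp
    show "f \<cdot> \<epsilon> (dm g) = g \<cdot> \<epsilon> (dm g)" using n\<epsilon>[rule_format, of f] n\<epsilon>[rule_format, of g] h by metis
  qed (use \<epsilon> h in auto)
  show "\<lbrakk>arr f; arr g; dm f = dm g; cd f = cd g; S f = S g\<rbrakk> \<Longrightarrow> f = g" by (rule fa)
  show "A \<in> Ob C \<Longrightarrow> \<exists>B e. B \<in> Ob C \<and> isom e \<and> dm e = So B \<and> cd e = A"
    using \<epsilon> g by blast
  show "\<exists>f. arr f \<and> dm f = A \<and> cd f = B \<and> S f = h"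
    if h: "A \<in> Ob C" "B \<in> Ob C" "arr h" "dm h = So A" "cd h = So B"
  proof -
    have A: "isom (\<eta> A)" "dm (\<eta> A) = fob G (So A)" "cd (\<eta> A) = A" using \<eta> h by auto
    have B: "isom (\<eta> B)" "dm (\<eta> B) = fob G (So B)" "cd (\<eta> B) = B" using \<eta> h by auto
    from A(1) obtain a where a: "arr (\<eta> A)" "arr a" "dm a = cd (\<eta> A)" "cd a = dm (\<eta> A)"
      "a \<cdot> \<eta> A = Ide C (dm (\<eta> A))" by (rule isomE)
    have gh: "arr (fmap G h)" "dm (fmap G h) = fob G (So A)" "cd (fmap G h) = fob G (So B)"
      using g h by auto
    \<comment> \<open>Naturality of \<open>\<eta>\<close> leaves no other candidate for a preimage
      of \<open>h\<close>. It satisfies \<open>G (S f) = G h\<close>, and \<open>G\<close> is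
      faithful.\<close>
    define f where "f = \<eta> B \<cdot> fmap G h \<cdot> a"
    have f: "arr f" "dm f = A" "cd f = B" using A B gh a by (auto simp: f_def)
    have "\<eta> B \<cdot> fmap G h = f \<cdot> \<eta> A" using A B gh a by (simp add: f_def)
    also have "\<dots> = \<eta> B \<cdot> fmap G (S f)" using n\<eta>[rule_format, of f] f by simp
    finally have "\<eta> B \<cdot> fmap G h = \<eta> B \<cdot> fmap G (S f)" .
    then have "fmap G h = fmap G (S f)"
      by (rule isom_cancel[rotated -1]) (use B gh f g in auto)
    then have "h = S f" by (rule fa'[rotated -1]) (use h f in auto)
    then show ?thesis using f by blast
  qed
qed

text \<open>The quasi-inverse picks a preimage \<open>G A\<close> and an isomorphism
  \<open>e A\<close> for every object. On arrows it is forced: \<open>Gm f\<close> is the unique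
  preimage of \<open>f\<close> conjugated by these isomorphisms, so functoriality follows from
  faithfulness.\<close>

lemma equivalence_shiftI:
  assumes faithful: "\<And>f g. \<lbrakk>arr f; arr g; dm f = dm g; cd f = cd g; S f = S g\<rbrakk> \<Longrightarrow> f = g"
    and full: "\<And>A B h. \<lbrakk>A \<in> Ob C; B \<in> Ob C; arr h; dm h = So A; cd h = So B\<rbrakk> \<Longrightarrow>
      \<exists>f. arr f \<and> dm f = A \<and> cd f = B \<and> S f = h"
    and dense: "\<And>A. A \<in> Ob C \<Longrightarrow> \<exists>B e. B \<in> Ob C \<and> isom e \<and> dm e = So B \<and> cd e = A"
  shows "equivalence C C (Shift C)"
proof -
  have "\<forall>A. \<exists>B e e'. A \<in> Ob C \<longrightarrow> B \<in> Ob C \<and> isom e \<and> dm e = So B \<and> cd e = A \<and> isom e' \<and> dm e' = A \<and> cd e' = So B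
    \<and> e' \<cdot> e = Ide C (So B) \<and> e \<cdot> e' = Ide C A"
    using dense by (metis isomE)
  then obtain G e e' where "\<forall>A. A \<in> Ob C \<longrightarrow> G A \<in> Ob C \<and> isom (e A) \<and> dm (e A) = So (G A) \<and> cd (e A) = A
    \<and> isom (e' A) \<and> dm (e' A) = A \<and> cd (e' A) = So (G A)
    \<and> e' A \<cdot> e A = Ide C (So (G A)) \<and> e A \<cdot> e' A = Ide C A" by metis
  then have e [simp]: "\<And>A. A \<in> Ob C \<Longrightarrow> G A \<in> Ob C" "\<And>A. A \<in> Ob C \<Longrightarrow> isom (e A)"
    "\<And>A. A \<in> Ob C \<Longrightarrow> dm (e A) = So (G A)" "\<And>A. A \<in> Ob C \<Longrightarrow> cd (e A) = A" "\<And>A. A \<in> Ob C \<Longrightarrow> isom (e' A)"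
    "\<And>A. A \<in> Ob C \<Longrightarrow> dm (e' A) = A" "\<And>A. A \<in> Ob C \<Longrightarrow> cd (e' A) = So (G A)"
    "\<And>A. A \<in> Ob C \<Longrightarrow> e' A \<cdot> e A = Ide C (So (G A))" "\<And>A. A \<in> Ob C \<Longrightarrow> e A \<cdot> e' A = Ide C A" by auto
  have e2: "A \<in> Ob C \<Longrightarrow> arr x \<Longrightarrow> cd x = A \<Longrightarrow> e A \<cdot> (e' A \<cdot> x) = x"
    "A \<in> Ob C \<Longrightarrow> arr x \<Longrightarrow> cd x = So (G A) \<Longrightarrow> e' A \<cdot> (e A \<cdot> x) = x" for A x
    by (simp_all add: comp_rewrite[OF e(8)] comp_rewrite[OF e(9)])
  have "\<forall>f. \<exists>f'. arr f \<longrightarrow> arr f' \<and> dm f' = G (dm f) \<and> cd f' = G (cd f) \<and> S f' = e' (cd f) \<cdot> f \<cdot> e (dm f)"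
  proof (intro allI)
    fix f
    show "\<exists>f'. arr f \<longrightarrow> arr f' \<and> dm f' = G (dm f) \<and> cd f' = G (cd f) \<and> S f' = e' (cd f) \<cdot> f \<cdot> e (dm f)"
      using full[of "G (dm f)" "G (cd f)" "e' (cd f) \<cdot> f \<cdot> e (dm f)"] by (cases "arr f") auto
  qed
  then obtain Gm where "\<forall>f. arr f \<longrightarrow> arr (Gm f) \<and> dm (Gm f) = G (dm f) \<and> cd (Gm f) = G (cd f) \<and>
    S (Gm f) = e' (cd f) \<cdot> f \<cdot> e (dm f)" by metis
  then have Gm [simp]: "\<And>f. arr f \<Longrightarrow> arr (Gm f)" "\<And>f. arr f \<Longrightarrow> dm (Gm f) = G (dm f)"
    "\<And>f. arr f \<Longrightarrow> cd (Gm f) = G (cd f)" "\<And>f. arr f \<Longrightarrow> S (Gm f) = e' (cd f) \<cdot> f \<cdot> e (dm f)" by auto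
  define GG where "GG = \<lparr>fob = G, fmap = Gm\<rparr>"
  have GG: "is_functor C C GG"
    unfolding functor_iff GG_def
  proof (simp, intro conjI ballI allI impI)
    show "Gm (Ide C A) = Ide C (G A)" if "A \<in> Ob C" for A
      by (rule faithful) (use that in auto)
    show "Gm (g \<cdot> f) = Gm g \<cdot> Gm f" if "arr f" "arr g" "dm g = cd f" for f g
      by (rule faithful) (use that in \<open>auto simp: e2\<close>)
  qed
  have i: "is_functor C C id_func" by (simp add: functor_iff id_func_def)
  have c1: "is_functor C C (comp_func GG (Shift C))" and c2: "is_functor C C (comp_func (Shift C) GG)"
    using GG by (simp_all add: functor_iff comp_func_def)
  have nat: "f \<cdot> e (dm f) = e (cd f) \<cdot> S (Gm f)" if "arr f" for f
    using that by (simp add: e2)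
  have 2: "naturally_isomorphic C C (comp_func (Shift C) GG) id_func"
    unfolding naturally_isomorphic_iff[OF c2 i]
    by (rule exI[of _ e]) (auto simp: comp_func_def id_func_def GG_def nat simp del: Gm(4))
  \<comment> \<open>The second natural isomorphism must live before shifting:
    \<open>e (So A)\<close> is itself a shift by fullness, and its preimage is inverted by the
    preimage of \<open>e' (So A)\<close>.\<close>
  have "\<forall>A. \<exists>u. A \<in> Ob C \<longrightarrow> isom u \<and> dm u = G (So A) \<and> cd u = A \<and> S u = e (So A)"
  proof (intro allI)
    fix A
    show "\<exists>u. A \<in> Ob C \<longrightarrow> isom u \<and> dm u = G (So A) \<and> cd u = A \<and> S u = e (So A)"
    proof (cases "A \<in> Ob C")
      case True
      obtain u where u: "arr u" "dm u = G (So A)" "cd u = A" "S u = e (So A)"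
        using full[of "G (So A)" A "e (So A)"] True by auto
      obtain v where v: "arr v" "cd v = G (So A)" "dm v = A" "S v = e' (So A)"
        using full[of A "G (So A)" "e' (So A)"] True by auto
      have "v \<cdot> u = Ide C (G (So A))" by (rule faithful) (use u v True in auto)
      moreover have "u \<cdot> v = Ide C A" by (rule faithful) (use u v True in auto)
      ultimately
      have "isom u" using u v by (intro isomI[of _ v]) auto
      then show ?thesis using u by blast
    qed auto
  qed
  then obtain u where "\<forall>A. A \<in> Ob C \<longrightarrow> isom (u A) \<and> dm (u A) = G (So A) \<and> cd (u A) = A \<and> S (u A) = e (So A)"
    by metis
  then have u [simp]: "\<And>A. A \<in> Ob C \<Longrightarrow> isom (u A)" "\<And>A. A \<in> Ob C \<Longrightarrow> dm (u A) = G (So A)"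
    "\<And>A. A \<in> Ob C \<Longrightarrow> cd (u A) = A" "\<And>A. A \<in> Ob C \<Longrightarrow> S (u A) = e (So A)" by auto
  have "f \<cdot> u (dm f) = u (cd f) \<cdot> Gm (S f)" if "arr f" for f
    by (rule faithful) (use that in \<open>auto simp: e2\<close>)
  then have "naturally_isomorphic C C (comp_func GG (Shift C)) id_func"
    unfolding naturally_isomorphic_iff[OF c1 i]
    by (intro exI[of _ u]) (auto simp: comp_func_def id_func_def GG_def simp del: Gm(4))
  then show ?thesis unfolding equivalence_def using shift_functor GG 2 by blast
qed

text \<open>As arrows determine their sources and targets, a triangle is represented by its three
  arrows alone. \<open>candidate_iff\<close> and \<open>Dist_iff\<close> translate back to
  \<open>Tri\<close>.\<close>

definition cnd :: "'m \<Rightarrow> 'm \<Rightarrow> 'm \<Rightarrow> bool" where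
  "cnd f g h \<longleftrightarrow> arr f \<and> arr g \<and> arr h \<and> dm g = cd f \<and> dm h = cd g \<and> cd h = So (dm f)"

definition dt :: "'m \<Rightarrow> 'm \<Rightarrow> 'm \<Rightarrow> bool" where
  "dt f g h \<longleftrightarrow> Tri (dm f) (cd f) (cd g) f g h \<in> Dist C"

lemma candidate_iff:
  "candidate C (Shift C) (Tri A B D f g h) \<longleftrightarrow> cnd f g h \<and> A = dm f \<and> B = cd f \<and> D = cd g"
  unfolding candidate_def cnd_def
  by (cases "A \<in> Ob C \<and> B \<in> Ob C \<and> D \<in> Ob C") auto

lemma Dist_iff: "Tri A B D f g h \<in> Dist C \<longleftrightarrow> dt f g h \<and> A = dm f \<and> B = cd f \<and> D = cd g"
  using Dist_candidate candidate_iff[of A B D f g h] unfolding dt_def by blast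

lemma dt_cnd: "dt f g h \<Longrightarrow> cnd f g h"
  unfolding dt_def using Dist_candidate candidate_iff by blast

lemma dt_arr:
  assumes "dt f g h"
  shows "arr f" "arr g" "arr h" "dm g = cd f" "dm h = cd g" "cd h = So (dm f)"
  using dt_cnd[OF assms] by (auto simp: cnd_def)

definition tmor :: "'m \<Rightarrow> 'm \<Rightarrow> 'm \<Rightarrow> 'm \<Rightarrow> 'm \<Rightarrow> 'm \<Rightarrow> 'm \<Rightarrow> 'm \<Rightarrow> 'm \<Rightarrow> bool" where
  "tmor f g h f' g' h' a b c \<longleftrightarrow> arr a \<and> arr b \<and> arr c \<and> dm a = dm f \<and> cd a = dm f' \<and>
     dm b = cd f \<and> cd b = cd f' \<and> dm c = cd g \<and> cd c = cd g' \<and>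
     b \<cdot> f = f' \<cdot> a \<and> c \<cdot> g = g' \<cdot> b \<and> S a \<cdot> h = h' \<cdot> c"

lemma tmor_arr:
  assumes "tmor f g h f' g' h' a b c"
  shows "arr a" "arr b" "arr c" "dm a = dm f" "cd a = dm f'" "dm b = cd f" "cd b = cd f'"
    "dm c = cd g" "cd c = cd g'"
  using assms by (simp_all add: tmor_def)

lemma tri_mor_iff:
  assumes "cnd f g h" "cnd f' g' h'" "A = dm f" "B = cd f" "D = cd g" "A' = dm f'" "B' = cd f'" "D' = cd g'"
  shows "tri_mor C (Shift C) (Tri A B D f g h) (Tri A' B' D' f' g' h') a b c \<longleftrightarrow> tmor f g h f' g' h' a b c"
proof -
  have "A \<in> Ob C" "B \<in> Ob C" "D \<in> Ob C" "A' \<in> Ob C" "B' \<in> Ob C" "D' \<in> Ob C"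
    using assms by (auto simp: cnd_def)
  moreover have "cnd f g h" "cnd f' g' h'" by fact+
  ultimately show ?thesis using assms(3-) unfolding tri_mor_def tmor_def by auto
qed

lemma tri_isomorphic_iff:
  "tri_isomorphic C (Shift C) (Tri A B D f g h) (Tri A' B' D' f' g' h') \<longleftrightarrow>
     cnd f g h \<and> cnd f' g' h' \<and> A = dm f \<and> B = cd f \<and> D = cd g \<and> A' = dm f' \<and> B' = cd f' \<and> D' = cd g' \<and>
     (\<exists>a b c. tmor f g h f' g' h' a b c \<and> isom a \<and> isom b \<and> isom c)" (is "?l \<longleftrightarrow> ?r")
proof -
  have "?l \<longleftrightarrow> ?r" if h: "cnd f g h" "cnd f' g' h'" "A = dm f" "B = cd f" "D = cd g" "A' = dm f'" "B' = cd f'" "D' = cd g'"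
  proof -
    have o: "A \<in> Ob C" "B \<in> Ob C" "D \<in> Ob C" "A' \<in> Ob C" "B' \<in> Ob C" "D' \<in> Ob C"
      using h by (auto simp: cnd_def)
    show ?thesis
      unfolding tri_isomorphic_def candidate_iff tri_mor_iff[OF h] using h o
      by (simp add: iso_arrow_iff) (auto simp: tmor_def)
  qed
  moreover have "cnd f g h \<and> cnd f' g' h' \<and> A = dm f \<and> B = cd f \<and> D = cd g \<and> A' = dm f' \<and> B' = cd f' \<and> D' = cd g'"
    if ?l using that unfolding tri_isomorphic_def candidate_iff by blast
  ultimately show ?thesis by blast
qed

lemma tmor_comp:
  assumes "tmor f g h f' g' h' a b c" "tmor f' g' h' f'' g'' h'' a' b' c'" "cnd f g h" "cnd f' g' h'" "cnd f'' g'' h''"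
  shows "tmor f g h f'' g'' h'' (a' \<cdot> a) (b' \<cdot> b) (c' \<cdot> c)"
proof -
  note m1 = assms(1)[unfolded tmor_def] and m2 = assms(2)[unfolded tmor_def]
  note t = assms(3-5)[unfolded cnd_def]
  have "b \<cdot> f = f' \<cdot> a" "c \<cdot> g = g' \<cdot> b" "S a \<cdot> h = h' \<cdot> c" using m1 by auto
  note 1 = this
  have "b' \<cdot> f' = f'' \<cdot> a'" "c' \<cdot> g' = g'' \<cdot> b'" "S a' \<cdot> h' = h'' \<cdot> c'" using m2 by auto
  note 2 = this[THEN comp_rewrite]
  show ?thesis unfolding tmor_def using m1 m2 t 1 by (simp add: 2)
qed

lemma tmor_Ide: "cnd f g h \<Longrightarrow> tmor f g h f g h (Ide C (dm f)) (Ide C (cd f)) (Ide C (cd g))"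
  unfolding cnd_def tmor_def by simp

lemma tmor_inverse:
  assumes "tmor f g h f' g' h' a b c" "isom a" "isom b" "isom c" "cnd f g h" "cnd f' g' h'"
  obtains a' b' c' where "tmor f' g' h' f g h a' b' c'" "isom a'" "isom b'" "isom c'"
    "a' \<cdot> a = Ide C (dm f)" "a \<cdot> a' = Ide C (dm f')" "b' \<cdot> b = Ide C (cd f)" "b \<cdot> b' = Ide C (cd f')"
    "c' \<cdot> c = Ide C (cd g)" "c \<cdot> c' = Ide C (cd g')"
proof -
  note m = assms(1)[unfolded tmor_def] and t = assms(5,6)[unfolded cnd_def]
  from assms(2) obtain a' where a: "arr a" "isom a'" "arr a'" "dm a' = cd a" "cd a' = dm a" "a' \<cdot> a = Ide C (dm a)" "a \<cdot> a' = Ide C (cd a)"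
    by (rule isomE)
  from assms(3) obtain b' where b: "arr b" "isom b'" "arr b'" "dm b' = cd b" "cd b' = dm b" "b' \<cdot> b = Ide C (dm b)" "b \<cdot> b' = Ide C (cd b)"
    by (rule isomE)
  from assms(4) obtain c' where c: "arr c" "isom c'" "arr c'" "dm c' = cd c" "cd c' = dm c" "c' \<cdot> c = Ide C (dm c)" "c \<cdot> c' = Ide C (cd c)"
    by (rule isomE)
  \<comment> \<open>One commutative square with invertible vertical arrows, reversed. The three
    squares of a morphism of triangles are instances, the last one with \<open>S a\<close> in place
    of \<open>a\<close>.\<close>
  have sq: "y' \<cdot> v = u \<cdot> x'"
    if "y \<cdot> u = v \<cdot> x" "arr x" "arr y" "arr u" "arr v" "dm u = dm x" "dm v = cd x" "cd u = dm y" "cd v = cd y"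
      "arr x'" "dm x' = cd x" "cd x' = dm x" "x \<cdot> x' = Ide C (cd x)"
      "arr y'" "dm y' = cd y" "cd y' = dm y" "y' \<cdot> y = Ide C (dm y)" for x y u v x' y'
  proof -
    have "y' \<cdot> v = y' \<cdot> ((v \<cdot> x) \<cdot> x')" using that by simp
    also have "\<dots> = y' \<cdot> ((y \<cdot> u) \<cdot> x')" using that(1) by simp
    also have "\<dots> = u \<cdot> x'" using that(2-) by (simp add: comp_rewrite[OF that(17)])
    finally show ?thesis .
  qed
  have sa: "S a' \<cdot> S a = Ide C (So (dm a))" using a by (simp add: shift_comp[OF a(6)])
  have "b' \<cdot> f' = f \<cdot> a'" by (rule sq[of b f f' a]) (use m t a b in auto)
  moreover have "c' \<cdot> g' = g \<cdot> b'" by (rule sq[of c g g' b]) (use m t c b in auto)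
  moreover have "S a' \<cdot> h' = h \<cdot> c'" by (rule sq[of "S a" h h' c]) (use m t c a sa in auto)
  ultimately have "tmor f' g' h' f g h a' b' c'" unfolding tmor_def using m t a b c by simp
  then show ?thesis using that a b c m t by auto
qed

lemma tmor_rot:
  assumes "tmor f g h f' g' h' a b c" "cnd f g h" "cnd f' g' h'"
  shows "tmor g h (ng (S f)) g' h' (ng (S f')) b c (S a)"
proof -
  note t = assms(2,3)[unfolded cnd_def] and m = assms(1)[unfolded tmor_def]
  have "S b \<cdot> S f = S f' \<cdot> S a" by (rule shift_square) (use m t in auto)
  then show ?thesis unfolding tmor_def using m t by simp
qed

end

text \<open>This is the form of TR1 to TR3 that can be checked directly for \<open>U/X\<close>:
  rotation in one direction and a fully faithful shift. The inverse rotation is derived in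
  \<open>dt_rotD\<close>; density and the octahedral axiom are added in
  \<open>triangulatedI\<close>.\<close>

locale pretri = shifted +
  assumes has_zob: "\<exists>Z. zob Z"
    and faithful: "\<lbrakk>arr f; arr g; dm f = dm g; cd f = cd g; S f = S g\<rbrakk> \<Longrightarrow> f = g"
    and full: "\<lbrakk>A \<in> Ob C; B \<in> Ob C; arr h; dm h = So A; cd h = So B\<rbrakk> \<Longrightarrow> \<exists>f. arr f \<and> dm f = A \<and> cd f = B \<and> S f = h"
    and dt_iso: "\<lbrakk>dt f g h; cnd f' g' h'; tmor f g h f' g' h' a b c; isom a; isom b; isom c\<rbrakk> \<Longrightarrow> dt f' g' h'"
    and dt_Ide: "\<lbrakk>A \<in> Ob C; zob Z\<rbrakk> \<Longrightarrow> dt (Ide C A) (Zer C A Z) (Zer C Z (So A))"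
    and dt_ex: "arr f \<Longrightarrow> \<exists>g h. dt f g h"
    and dt_rot: "dt f g h \<Longrightarrow> dt g h (ng (S f))"
    and dt_fill: "\<lbrakk>dt f g h; dt f' g' h'; arr a; arr b; dm a = dm f; cd a = dm f'; dm b = cd f; cd b = cd f';
      b \<cdot> f = f' \<cdot> a\<rbrakk> \<Longrightarrow> \<exists>c. tmor f g h f' g' h' a b c"
begin

text \<open>After one rotation the missing component comes last and TR3 supplies it as an arrow
  between shifts. Fullness desuspends the arrow and faithfulness the square.\<close>

lemma dt_fill_fst:
  assumes "dt f g h" "dt f' g' h'" "arr b" "arr c" "dm b = cd f" "cd b = cd f'" "dm c = cd g" "cd c = cd g'"
    "c \<cdot> g = g' \<cdot> b"
  shows "\<exists>a. tmor f g h f' g' h' a b c"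
proof -
  note t = dt_arr[OF assms(1)] dt_arr[OF assms(2)]
  obtain s where s: "tmor g h (ng (S f)) g' h' (ng (S f')) b c s"
    using dt_fill[OF dt_rot[OF assms(1)] dt_rot[OF assms(2)], of b c] assms t by auto
  then obtain a where a: "arr a" "dm a = dm f" "cd a = dm f'" "s = S a"
    using full[of "dm f" "dm f'" s] t by (auto simp: tmor_def)
  have s1: "S a \<cdot> h = h' \<cdot> c" and s2: "S b \<cdot> ng (S f) = ng (S f') \<cdot> S a"
    using s a by (auto simp: tmor_def)
  have "S (b \<cdot> f) = S (f' \<cdot> a)"
    using s2 a assms t by (simp add: ng_inject)
  then have "b \<cdot> f = f' \<cdot> a" by (rule faithful[rotated -1]) (use a assms t in auto)
  then show ?thesis using a s1 assms t unfolding tmor_def by auto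
qed

lemma dt_fill_snd:
  assumes "dt f g h" "dt f' g' h'" "arr a" "arr c" "dm a = dm f" "cd a = dm f'" "dm c = cd g" "cd c = cd g'"
    "S a \<cdot> h = h' \<cdot> c"
  shows "\<exists>b. tmor f g h f' g' h' a b c"
proof -
  note t = dt_arr[OF assms(1)] dt_arr[OF assms(2)]
  obtain b where "tmor g h (ng (S f)) g' h' (ng (S f')) b c (S a)"
    using dt_fill_fst[OF dt_rot[OF assms(1)] dt_rot[OF assms(2)], of c "S a"] assms t by auto
  then have b: "arr b" "dm b = cd f" "cd b = cd f'" "c \<cdot> g = g' \<cdot> b" "S b \<cdot> ng (S f) = ng (S f') \<cdot> S a"
    using t by (auto simp: tmor_def)
  have "S (b \<cdot> f) = S (f' \<cdot> a)"
    using b assms t by (simp add: ng_inject)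
  then have "b \<cdot> f = f' \<cdot> a" by (rule faithful[rotated -1]) (use b assms t in auto)
  then show ?thesis using b assms t unfolding tmor_def by auto
qed

text \<open>The triangle on the identity of \<open>dm f\<close> maps to the given one by the
  identity and \<open>f\<close>, so \<open>g \<cdot> f\<close> passes through a zero object. The
  other two equations are rotations of this one.\<close>

lemma dt_zero:
  assumes "dt f g h"
  shows "g \<cdot> f = Zer C (dm f) (cd g)" "h \<cdot> g = Zer C (dm g) (cd h)" "S f \<cdot> h = Zer C (dm h) (So (cd f))"
proof -
  have z: "g \<cdot> f = Zer C (dm f) (cd g)" if d: "dt f g h" for f g h
  proof -
    note t = dt_arr[OF d]
    obtain Z where Z: "zob Z" using has_zob by blast
    note ZO = zobD(1)[OF Z]
    have "\<exists>c. tmor (Ide C (dm f)) (Zer C (dm f) Z) (Zer C Z (So (dm f))) f g h (Ide C (dm f)) f c"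
      by (rule dt_fill[OF dt_Ide[OF _ Z] d]) (use t in auto)
    then show ?thesis using t ZO by (auto simp: tmor_def)
  qed
  note r = dt_rot[OF assms]
  show "g \<cdot> f = Zer C (dm f) (cd g)" by (rule z[OF assms])
  show "h \<cdot> g = Zer C (dm g) (cd h)" by (rule z[OF r])
  have "ng (S f) \<cdot> h = Zer C (dm h) (cd (ng (S f)))" by (rule z[OF dt_rot[OF r]])
  then show "S f \<cdot> h = Zer C (dm h) (So (cd f))"
    using dt_arr[OF assms] ng_eq_Zer_iff[of "S f \<cdot> h"] by simp
qed

text \<open>Exactness of the covariant Hom functors at three consecutive places. An arrow
  \<open>y\<close> killed by \<open>g\<close> is the middle of a morphism from the triangle on the
  identity of \<open>dm y\<close>, and the first component of that morphism is the lift; the other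
  two cases are rotations.\<close>

lemma dt_lift:
  assumes "dt f g h"
  shows "\<lbrakk>arr y; cd y = cd f; g \<cdot> y = Zer C (dm y) (cd g)\<rbrakk> \<Longrightarrow> \<exists>x. arr x \<and> dm x = dm y \<and> cd x = dm f \<and> f \<cdot> x = y"
    and "\<lbrakk>arr y; cd y = cd g; h \<cdot> y = Zer C (dm y) (cd h)\<rbrakk> \<Longrightarrow> \<exists>x. arr x \<and> dm x = dm y \<and> cd x = cd f \<and> g \<cdot> x = y"
    and "\<lbrakk>arr y; cd y = So (dm f); S f \<cdot> y = Zer C (dm y) (So (cd f))\<rbrakk> \<Longrightarrow> \<exists>x. arr x \<and> dm x = dm y \<and> cd x = cd g \<and> h \<cdot> x = y"
proof -
  have l: "\<exists>x. arr x \<and> dm x = dm y \<and> cd x = dm f \<and> f \<cdot> x = y"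
    if d: "dt f g h" "arr y" "cd y = cd f" "g \<cdot> y = Zer C (dm y) (cd g)" for f g h y
  proof -
    note t = dt_arr[OF d(1)]
    obtain Z where Z: "zob Z" using has_zob by blast
    note ZO = zobD(1)[OF Z]
    let ?Y = "dm y"
    obtain x where "tmor (Ide C ?Y) (Zer C ?Y Z) (Zer C Z (So ?Y)) f g h x y (Zer C Z (cd g))"
      using dt_fill_fst[OF dt_Ide[OF _ Z] d(1), of ?Y y "Zer C Z (cd g)"] d t ZO by fastforce
    then have x: "arr x" "dm x = dm (Ide C ?Y)" "cd x = dm f" and sq: "y \<cdot> Ide C ?Y = f \<cdot> x"
      unfolding tmor_def by blast+
    have "f \<cdot> x = y" by (rule sq[symmetric, unfolded comp_Ide(2)[OF d(2) refl]])
    moreover have "dm x = dm y" unfolding x(2) by (rule Ide_arr) (use d in simp)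
    ultimately show ?thesis using x by blast
  qed
  note t = dt_arr[OF assms]
  note r = dt_rot[OF assms]
  show "\<lbrakk>arr y; cd y = cd f; g \<cdot> y = Zer C (dm y) (cd g)\<rbrakk> \<Longrightarrow> \<exists>x. arr x \<and> dm x = dm y \<and> cd x = dm f \<and> f \<cdot> x = y"
    using l[OF assms] .
  show "\<lbrakk>arr y; cd y = cd g; h \<cdot> y = Zer C (dm y) (cd h)\<rbrakk> \<Longrightarrow> \<exists>x. arr x \<and> dm x = dm y \<and> cd x = cd f \<and> g \<cdot> x = y"
    using l[OF r, of y] t by simp
  show "\<lbrakk>arr y; cd y = So (dm f); S f \<cdot> y = Zer C (dm y) (So (cd f))\<rbrakk> \<Longrightarrow> \<exists>x. arr x \<and> dm x = dm y \<and> cd x = cd g \<and> h \<cdot> x = y"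
    using l[OF dt_rot[OF r], of y] t by simp
qed

text \<open>The five lemma as a diagram chase with arrows: \<open>mono\<close> is the injective
  half, a right inverse \<open>r\<close> the surjective half. Since \<open>c\<close> kills
  \<open>r \<cdot> c\<close> minus the identity, \<open>r\<close> is also a left inverse.\<close>

lemma tmor_isom_thd:
  assumes d: "dt f g h" and d': "dt f' g' h'" and m: "tmor f g h f' g' h' a b c" and a: "isom a" and b: "isom b"
  shows "isom c"
proof -
  note t = dt_arr[OF d] dt_arr[OF d'] and mm = m[unfolded tmor_def]
  have e: "b \<cdot> f = f' \<cdot> a" "c \<cdot> g = g' \<cdot> b" "S a \<cdot> h = h' \<cdot> c" using mm by auto
  from a obtain a1 where a1: "arr a" "arr a1" "dm a1 = cd a" "cd a1 = dm a" "a1 \<cdot> a = Ide C (dm a)" "a \<cdot> a1 = Ide C (cd a)"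
    by (rule isomE)
  from b obtain b1 where b1: "arr b" "arr b1" "dm b1 = cd b" "cd b1 = dm b" "b1 \<cdot> b = Ide C (dm b)" "b \<cdot> b1 = Ide C (cd b)"
    by (rule isomE)
  have mono: "y = Zer C (dm y) (cd g)" if y: "arr y" "cd y = cd g" "c \<cdot> y = Zer C (dm y) (cd g')" for y
  proof -
    have "S a \<cdot> (h \<cdot> y) = (h' \<cdot> c) \<cdot> y" using y t mm by (simp add: comp_rewrite[OF e(3)])
    also have "\<dots> = S a \<cdot> Zer C (dm y) (So (dm f))" using y t mm by simp
    finally have "h \<cdot> y = Zer C (dm y) (So (dm f))"
      by (rule isom_cancel[OF shift_isom[OF a], rotated -1]) (use y t mm in auto)
    then obtain x where x: "arr x" "dm x = dm y" "cd x = cd f" "g \<cdot> x = y"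
      using dt_lift(2)[OF d, of y] y t by auto
    have "g' \<cdot> (b \<cdot> x) = c \<cdot> (g \<cdot> x)" using x(1-3) t mm by (simp add: comp_rewrite[OF e(2)])
    also have "\<dots> = Zer C (dm y) (cd g')" unfolding x(4) by (rule y(3))
    finally obtain w where w: "arr w" "dm w = dm y" "cd w = dm f'" "f' \<cdot> w = b \<cdot> x"
      using dt_lift(1)[OF d', of "b \<cdot> x"] x t mm by auto
    have "b \<cdot> (f \<cdot> (a1 \<cdot> w)) = f' \<cdot> (a \<cdot> (a1 \<cdot> w))" using w t mm a1 by (simp add: comp_rewrite[OF e(1)])
    also have "\<dots> = b \<cdot> x" using w t mm a1 by (simp add: comp_rewrite[OF a1(6)])
    finally have "f \<cdot> (a1 \<cdot> w) = x"
      by (rule isom_cancel[OF b, rotated -1]) (use x w t mm a1 in auto)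
    then have "y = g \<cdot> f \<cdot> a1 \<cdot> w" using x(4) by simp
    also have "\<dots> = Zer C (dm y) (cd g)" using w x t mm a1 by (simp add: comp_rewrite[OF dt_zero(1)[OF d]])
    finally show ?thesis .
  qed
  \<comment> \<open>The first approximation \<open>c1\<close> satisfies
    \<open>h' \<cdot> (c \<cdot> c1) = h'\<close>. The error, the identity minus
    \<open>c \<cdot> c1\<close>, therefore lifts through \<open>g'\<close>, and the lift pulled back
    along \<open>b\<close> corrects \<open>c1\<close>.\<close>
  have "\<exists>r. arr r \<and> dm r = cd c \<and> cd r = dm c \<and> c \<cdot> r = Ide C (cd c)"
  proof -
    have sq: "S b \<cdot> S f = S f' \<cdot> S a" by (rule shift_square) (use mm t in auto)
    have aa: "S a \<cdot> S a1 = Ide C (So (cd a))" using a1 by (simp add: shift_comp[OF a1(6)])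
    have "S f \<cdot> (S a1 \<cdot> h') = Zer C (cd c) (So (cd f))"
    proof (rule isom_cancel[OF shift_isom[OF b]])
      have "S b \<cdot> (S f \<cdot> (S a1 \<cdot> h')) = S f' \<cdot> h'"
        using t mm a1 by (simp add: comp_rewrite[OF sq] comp_rewrite[OF aa])
      also have "\<dots> = Zer C (cd c) (So (cd f'))" using t mm a1 by (simp add: dt_zero(3)[OF d'])
      finally show "S b \<cdot> (S f \<cdot> (S a1 \<cdot> h')) = S b \<cdot> Zer C (cd c) (So (cd f))" using t mm a1 by simp
    qed (use t mm a1 in auto)
    then obtain c1 where c1: "arr c1" "dm c1 = cd g'" "cd c1 = cd g" "h \<cdot> c1 = S a1 \<cdot> h'"
      using dt_lift(3)[OF d, of "S a1 \<cdot> h'"] t mm a1 by auto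
    have "h' \<cdot> (c \<cdot> c1) = (h' \<cdot> c) \<cdot> c1" by (rule assoc[symmetric]) (use t mm c1 in auto)
    also have "\<dots> = S a \<cdot> (h \<cdot> c1)" unfolding e(3)[symmetric] by (rule assoc) (use t mm c1 in auto)
    also have "\<dots> = S a \<cdot> (S a1 \<cdot> h')" unfolding c1(4) ..
    also have "\<dots> = h'" using t mm a1 by (simp add: comp_rewrite[OF aa])
    finally have "h' \<cdot> (Ide C (cd g') \<boxplus> ng (c \<cdot> c1)) = Zer C (cd g') (cd h')" using t mm c1 by simp
    then obtain b' where b': "arr b'" "dm b' = cd g'" "cd b' = cd f'" "g' \<cdot> b' = Ide C (cd g') \<boxplus> ng (c \<cdot> c1)"
      using dt_lift(2)[OF d', of "Ide C (cd g') \<boxplus> ng (c \<cdot> c1)"] t mm c1 by auto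
    have "c \<cdot> (g \<cdot> (b1 \<cdot> b')) = g' \<cdot> (b \<cdot> (b1 \<cdot> b'))" using t mm b1 b' by (simp add: comp_rewrite[OF e(2)])
    also have "\<dots> = g' \<cdot> b'" using t mm b1 b' by (simp add: comp_rewrite[OF b1(6)])
    finally have "c \<cdot> (c1 \<boxplus> g \<cdot> b1 \<cdot> b') = c \<cdot> c1 \<boxplus> (Ide C (cd g') \<boxplus> ng (c \<cdot> c1))"
      using t mm b1 b' c1 by simp
    also have "\<dots> = Ide C (cd g')" using t mm c1 by (simp add: add_comm[of "Ide C (cd g')"])
    finally show ?thesis using t mm b1 b' c1 by (intro exI[of _ "c1 \<boxplus> g \<cdot> b1 \<cdot> b'"]) simp
  qed
  then obtain r where r: "arr r" "dm r = cd c" "cd r = dm c" "c \<cdot> r = Ide C (cd c)" by blast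
  have "r \<cdot> c \<boxplus> ng (Ide C (dm c)) = Zer C (dm (r \<cdot> c \<boxplus> ng (Ide C (dm c)))) (cd g)"
    by (rule mono) (use r t mm in \<open>auto simp: comp_rewrite[OF r(4)]\<close>)
  then have "r \<cdot> c \<boxplus> ng (Ide C (dm c)) = Zer C (dm c) (dm c)" using r t mm by simp
  moreover have "r \<cdot> c \<boxplus> ng (Ide C (dm c)) = Zer C (dm c) (dm c) \<longleftrightarrow> r \<cdot> c = Ide C (dm c)"
    by (rule diff_eq_Zer_iff) (use r t mm in auto)
  ultimately have "r \<cdot> c = Ide C (dm c)" by blast
  then show ?thesis using r mm by (intro isomI[of _ r]) auto
qed

section \<open>Inverse rotation, signs and uniqueness of cones\<close>

lemma isom_shiftD:
  assumes "arr f" "isom (S f)"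
  shows "isom f"
proof -
  obtain s where s: "arr s" "dm s = So (cd f)" "cd s = So (dm f)" "s \<cdot> S f = Ide C (So (dm f))" "S f \<cdot> s = Ide C (So (cd f))"
    using isom_inverse[OF assms(2)] assms(1) by auto
  then obtain g where g: "arr g" "dm g = cd f" "cd g = dm f" "S g = s"
    using full[of "cd f" "dm f" s] assms by auto
  have "g \<cdot> f = Ide C (dm f)" by (rule faithful) (use g s assms in auto)
  moreover have "f \<cdot> g = Ide C (cd f)" by (rule faithful) (use g s assms in auto)
  ultimately
  show ?thesis using g assms by (intro isomI[of _ g]) auto
qed

lemma dt_rot3: "dt f g h \<Longrightarrow> dt (ng (S f)) (ng (S g)) (ng (S h))"
  by (intro dt_rot)

text \<open>Two rotations move \<open>b\<close>, shifted once, to the third place.\<close>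

lemma tmor_isom_snd:
  assumes d: "dt f g h" and d': "dt f' g' h'" and m: "tmor f g h f' g' h' a b c" and a: "isom a" and c: "isom c"
  shows "isom b"
proof -
  note r = dt_rot[OF d] and r' = dt_rot[OF d']
  have 1: "tmor h (ng (S f)) (ng (S g)) h' (ng (S f')) (ng (S g')) c (S a) (S b)"
    by (rule tmor_rot[OF tmor_rot[OF m dt_cnd[OF d] dt_cnd[OF d']] dt_cnd[OF r] dt_cnd[OF r']])
  have "isom (S b)" by (rule tmor_isom_thd[OF dt_rot[OF r] dt_rot[OF r'] 1 c shift_isom[OF a]])
  then show ?thesis using m unfolding tmor_def by (blast intro: isom_shiftD)
qed

text \<open>Completing \<open>f\<close> to a triangle and rotating it three times gives a triangle
  that starts with the same arrow as the twice rotated hypothesis. The two are isomorphic, the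
  isomorphism of third objects desuspends, and \<open>dt_iso\<close> applies.\<close>

lemma dt_rotD:
  assumes "cnd f g h" "dt g h (ng (S f))"
  shows "dt f g h"
proof -
  note t = assms(1)[unfolded cnd_def]
  obtain g' h' where d: "dt f g' h'" using dt_ex t by blast
  note t' = dt_arr[OF d]
  have r: "dt (ng (S f)) (ng (S g)) (ng (S h))" by (intro dt_rot assms(2))
  note r' = dt_rot3[OF d]
  have "\<exists>s. tmor (ng (S f)) (ng (S g)) (ng (S h)) (ng (S f)) (ng (S g')) (ng (S h')) (Ide C (So (dm f))) (Ide C (So (cd f))) s"
    by (rule dt_fill[OF r r']) (use t in auto)
  then obtain s where s: "tmor (ng (S f)) (ng (S g)) (ng (S h)) (ng (S f)) (ng (S g')) (ng (S h')) (Ide C (So (dm f))) (Ide C (So (cd f))) s"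
    by blast
  have "isom s" by (rule tmor_isom_thd[OF r r' s]) (use t in auto)
  obtain c where c: "arr c" "dm c = cd g" "cd c = cd g'" "s = S c"
    using full[of "cd g" "cd g'" s] s t t' by (auto simp: tmor_def)
  have "isom c" by (rule isom_shiftD) (use c \<open>isom s\<close> in auto)
  have s1: "s \<cdot> ng (S g) = ng (S g')" and s2: "ng (S h) = ng (S h') \<cdot> s"
    using s t t' by (auto simp: tmor_def)
  have "S (c \<cdot> g) = S g'" using c t t' s1 by (simp add: ng_inject)
  then have 1: "c \<cdot> g = g'" by (rule faithful[rotated -1]) (use c t t' in auto)
  have "S h = S (h' \<cdot> c)" using c t t' s2 by (simp add: ng_inject)
  then have 2: "h = h' \<cdot> c" by (rule faithful[rotated -1]) (use c t t' in auto)
  have "tmor f g h f g' h' (Ide C (dm f)) (Ide C (cd f)) c"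
    unfolding tmor_def using 1 2[symmetric] c t t' by simp
  then obtain a' b' c' where "tmor f g' h' f g h a' b' c'" "isom a'" "isom b'" "isom c'"
    by (rule tmor_inverse) (use \<open>isom c\<close> assms dt_cnd[OF d] t in auto)
  then show ?thesis using dt_iso[OF d assms(1)] by blast
qed

text \<open>An isomorphism that is minus the identity at one vertex and the identity at the others
  changes two of the three signs.\<close>

lemma dt_sign:
  assumes "dt f g h"
  shows "dt (ng f) (ng g) h" "dt (ng f) g (ng h)" "dt f (ng g) (ng h)"
proof -
  note t = dt_arr[OF assms]
  show "dt (ng f) (ng g) h"
    by (rule dt_iso[OF assms, where a="Ide C (dm f)" and b="ng (Ide C (cd f))" and c="Ide C (cd g)"])
      (use t in \<open>auto simp: cnd_def tmor_def isom_ng\<close>)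
  show "dt (ng f) g (ng h)"
    by (rule dt_iso[OF assms, where a="ng (Ide C (dm f))" and b="Ide C (cd f)" and c="Ide C (cd g)"])
      (use t in \<open>auto simp: cnd_def tmor_def isom_ng\<close>)
  show "dt f (ng g) (ng h)"
    by (rule dt_iso[OF assms, where a="Ide C (dm f)" and b="Ide C (cd f)" and c="ng (Ide C (cd g))"])
      (use t in \<open>auto simp: cnd_def tmor_def isom_ng\<close>)
qed

text \<open>Three rotations shift a triangle and negate all its arrows; \<open>dt_sign\<close>
  removes two of the signs. The direction from right to left desuspends triangles that the
  octahedral axiom produces.\<close>

lemma dt_shift_iff:
  assumes "cnd f g h"
  shows "dt f g h \<longleftrightarrow> dt (S f) (S g) (ng (S h))"
proof
  note t = assms[unfolded cnd_def]
  assume "dt f g h"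
  from dt_sign(1)[OF dt_rot3[OF this]] show "dt (S f) (S g) (ng (S h))" using t by simp
next
  note t = assms[unfolded cnd_def]
  assume "dt (S f) (S g) (ng (S h))"
  from dt_sign(1)[OF this] have "dt (ng (S f)) (ng (S g)) (ng (S h))" by simp
  then have "dt h (ng (S f)) (ng (S g))" by (rule dt_rotD[rotated]) (use t in \<open>auto simp: cnd_def\<close>)
  then have "dt g h (ng (S f))" by (rule dt_rotD[rotated]) (use t in \<open>auto simp: cnd_def\<close>)
  then show "dt f g h" by (rule dt_rotD[rotated]) (rule assms)
qed

lemma cone_unique:
  assumes "dt f g h" "dt f g' h'"
  obtains c where "tmor f g h f g' h' (Ide C (dm f)) (Ide C (cd f)) c" "isom c"
    "arr c" "dm c = cd g" "cd c = cd g'" "c \<cdot> g = g'" "h' \<cdot> c = h"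
proof -
  note t = dt_arr[OF assms(1)] dt_arr[OF assms(2)]
  obtain c where c: "tmor f g h f g' h' (Ide C (dm f)) (Ide C (cd f)) c"
    using dt_fill[OF assms, of "Ide C (dm f)" "Ide C (cd f)"] t by auto
  moreover have "isom c" by (rule tmor_isom_thd[OF assms c]) (use t in auto)
  ultimately show ?thesis using that t by (auto simp: tmor_def)
qed

text \<open>One octahedron for each composable pair is enough, because any other choice of the three
  cones differs from it by isomorphisms compatible with the triangles. Density completes the
  equivalence, full faithfulness being part of the locale.\<close>

lemma triangulatedI:
  assumes additive: "additive C"
    and dense: "\<And>A. A \<in> Ob C \<Longrightarrow> \<exists>B e. B \<in> Ob C \<and> isom e \<and> dm e = So B \<and> cd e = A"
    and octahedron: "\<And>f g. \<lbrakk>arr f; arr g; dm g = cd f\<rbrakk> \<Longrightarrow> \<exists>i i' j j' k k' u v.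
      dt f i i' \<and> dt g j j' \<and> dt (g \<cdot> f) k k' \<and> dt u v (S i \<cdot> j') \<and> dm u = cd i \<and> cd u = cd k \<and> cd v = cd j \<and>
      u \<cdot> i = k \<cdot> g \<and> k' \<cdot> u = i' \<and> v \<cdot> k = j \<and> j' \<cdot> v = S f \<cdot> k'"
  shows "triangulated C"
proof -
  have TR1: "TR1 C"
    unfolding TR1_def
  proof (intro conjI ballI allI impI)
    show "t \<in> Dist C" if "s \<in> Dist C" "tri_isomorphic C (Shift C) s t" for s t
      using that dt_iso by (cases s; cases t) (auto simp: Dist_iff tri_isomorphic_iff)
    show "Tri A A Z (Ide C A) (Zer C A Z) (Zer C Z (So A)) \<in> Dist C" if "A \<in> Ob C" "zero_object C Z" for A Z
      using that dt_Ide zobD(1) by (auto simp: Dist_iff zob_iff)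
    show "\<exists>D g h. Tri A B D f g h \<in> Dist C" if "A \<in> Ob C" "B \<in> Ob C" "f \<in> Hom C A B" for A B f
      using that dt_ex[of f] by (auto simp: Dist_iff)
  qed
  have TR2: "TR2 C"
    unfolding TR2_def
  proof (intro allI impI)
    fix A B D f g h
    assume c: "candidate C (Shift C) (Tri A B D f g h)"
    then have t: "cnd f g h" "A = dm f" "B = cd f" "D = cd g" by (auto simp: candidate_iff)
    note t' = t(1)[unfolded cnd_def]
    have "neg C (So A) (So B) (S f) = ng (S f)"
      by (rule neg_eq_ng) (use t t' in auto)
    then show "Tri A B D f g h \<in> Dist C \<longleftrightarrow> Tri B D (So A) g h (neg C (So A) (So B) (S f)) \<in> Dist C"
      using t t' dt_rot[of f g h] dt_rotD[of f g h] by (auto simp: Dist_iff)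
  qed
  have TR3: "TR3 C"
    unfolding TR3_def
  proof (intro ballI impI)
    fix s t a b
    assume h: "s \<in> Dist C" "t \<in> Dist C" "a \<in> Hom C (ob1 s) (ob1 t)" "b \<in> Hom C (ob2 s) (ob2 t)"
      "b \<cdot> arr1 s = arr1 t \<cdot> a"
    obtain A B D f g h where s: "s = Tri A B D f g h" by (cases s)
    obtain A' B' D' f' g' h' where t: "t = Tri A' B' D' f' g' h'" by (cases t)
    have d: "dt f g h" "A = dm f" "B = cd f" "D = cd g" "dt f' g' h'" "A' = dm f'" "B' = cd f'" "D' = cd g'"
      using h(1,2) s t by (auto simp: Dist_iff)
    note tt = dt_arr[OF d(1)] dt_arr[OF d(5)]
    have "\<exists>c. tmor f g h f' g' h' a b c"
      by (rule dt_fill[OF d(1,5)]) (use d h s t tt in auto)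
    then show "\<exists>c. tri_mor C (Shift C) s t a b c"
      unfolding s t using tri_mor_iff[OF dt_cnd[OF d(1)] dt_cnd[OF d(5)]] d by blast
  qed
  have TR4: "TR4 C"
    unfolding TR4_def
  proof (intro allI impI)
    fix A B D C' A' B' f g i1 i1' j1 j1' k1 k1'
    assume "Tri A B C' f i1 i1' \<in> Dist C" "Tri B D A' g j1 j1' \<in> Dist C" "Tri A D B' (g \<cdot> f) k1 k1' \<in> Dist C"
    then have d: "dt f i1 i1'" "dt g j1 j1'" "dt (g \<cdot> f) k1 k1'" and o: "A = dm f" "B = cd f" "C' = cd i1" "B = dm g" "D = cd g"
      "A' = cd j1" "B' = cd k1" by (auto simp: Dist_iff)
    note t = dt_arr[OF d(1)] dt_arr[OF d(2)] dt_arr[OF d(3)]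
    have "\<exists>i i' j j' k k' u v. dt f i i' \<and> dt g j j' \<and> dt (g \<cdot> f) k k' \<and> dt u v (S i \<cdot> j') \<and> dm u = cd i \<and> cd u = cd k \<and> cd v = cd j \<and>
      u \<cdot> i = k \<cdot> g \<and> k' \<cdot> u = i' \<and> v \<cdot> k = j \<and> j' \<cdot> v = S f \<cdot> k'"
      by (rule octahedron) (use t o in auto)
    then obtain i i' j j' k k' u v where e: "dt f i i'" "dt g j j'" "dt (g \<cdot> f) k k'" "dt u v (S i \<cdot> j')"
      "dm u = cd i" "cd u = cd k" "cd v = cd j" "u \<cdot> i = k \<cdot> g" "k' \<cdot> u = i'" "v \<cdot> k = j" "j' \<cdot> v = S f \<cdot> k'"
      by blast
    note te = dt_arr[OF e(1)] dt_arr[OF e(2)] dt_arr[OF e(3)] dt_arr[OF e(4)]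
    \<comment> \<open>Comparison isomorphisms from the prescribed cones to those of the given
      octahedron; the required \<open>u\<close> and \<open>v\<close> are conjugates by them.\<close>
    from cone_unique[OF d(1) e(1)] obtain \<alpha> where \<alpha>: "isom \<alpha>" "arr \<alpha>" "dm \<alpha> = cd i1" "cd \<alpha> = cd i" "\<alpha> \<cdot> i1 = i" "i' \<cdot> \<alpha> = i1'" by metis
    from cone_unique[OF d(2) e(2)] obtain \<beta> where \<beta>: "isom \<beta>" "arr \<beta>" "dm \<beta> = cd j1" "cd \<beta> = cd j" "\<beta> \<cdot> j1 = j" "j' \<cdot> \<beta> = j1'" by metis
    from cone_unique[OF d(3) e(3)] obtain \<gamma> where \<gamma>: "isom \<gamma>" "arr \<gamma>" "dm \<gamma> = cd k1" "cd \<gamma> = cd k" "\<gamma> \<cdot> k1 = k" "k' \<cdot> \<gamma> = k1'" by metis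
    obtain a where a: "isom a" "arr a" "dm a = cd i" "cd a = cd i1" "a \<cdot> \<alpha> = Ide C (cd i1)" "\<alpha> \<cdot> a = Ide C (cd i)"
      using isom_inverse[OF \<alpha>(1)] \<alpha> by auto
    obtain b where b: "isom b" "arr b" "dm b = cd j" "cd b = cd j1" "b \<cdot> \<beta> = Ide C (cd j1)" "\<beta> \<cdot> b = Ide C (cd j)"
      using isom_inverse[OF \<beta>(1)] \<beta> by auto
    obtain c where c: "isom c" "arr c" "dm c = cd k" "cd c = cd k1" "c \<cdot> \<gamma> = Ide C (cd k1)" "\<gamma> \<cdot> c = Ide C (cd k)"
      using isom_inverse[OF \<gamma>(1)] \<gamma> by auto
    have ai: "a \<cdot> i = i1"
    proof -
      have "a \<cdot> (\<alpha> \<cdot> i1) = i1" using \<alpha>(1-4) a t by (simp add: comp_rewrite[OF a(5)])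
      then show ?thesis unfolding \<alpha>(5) .
    qed
    have bj: "b \<cdot> j = j1"
    proof -
      have "b \<cdot> (\<beta> \<cdot> j1) = j1" using \<beta>(1-4) b t by (simp add: comp_rewrite[OF b(5)])
      then show ?thesis unfolding \<beta>(5) .
    qed
    have ck: "c \<cdot> k = k1"
    proof -
      have "c \<cdot> (\<gamma> \<cdot> k1) = k1" using \<gamma>(1-4) c t by (simp add: comp_rewrite[OF c(5)])
      then show ?thesis unfolding \<gamma>(5) .
    qed
    have ci: "k1' \<cdot> c = k'"
    proof -
      have "(k' \<cdot> \<gamma>) \<cdot> c = k'" using \<gamma>(1-4) c t te by simp
      then show ?thesis unfolding \<gamma>(6) .
    qed
    have bi: "j1' \<cdot> b = j'"
    proof -
      have "(j' \<cdot> \<beta>) \<cdot> b = j'" using \<beta>(1-4) b t te by simp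
      then show ?thesis unfolding \<beta>(6) .
    qed
    have Sai: "S a \<cdot> S i = S i1"
      using a te by (simp add: shift_comp[OF ai])
    have gf: "dm g = cd f" using o by simp
    note ty = gf a(2-4) b(2-4) c(2-4) \<alpha>(2-4) \<beta>(2-4) \<gamma>(2-4) t te e(5-7)
    let ?u = "c \<cdot> u \<cdot> \<alpha>" and ?v = "b \<cdot> v \<cdot> \<gamma>"
    have "tmor u v (S i \<cdot> j') ?u ?v (S i1 \<cdot> j1') a c b"
      unfolding tmor_def using ty by (simp add: a(6) c(6) bi comp_rewrite[OF Sai])
    moreover have "cnd ?u ?v (S i1 \<cdot> j1')"
      unfolding cnd_def using ty by simp
    ultimately have 1: "dt ?u ?v (S i1 \<cdot> j1')"
      using dt_iso[OF e(4)] a(1) b(1) c(1) by blast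
    have 2: "?u \<cdot> i1 = k1 \<cdot> g" 
      using ty by (simp add: \<alpha>(5) e(8) comp_rewrite[OF ck])
    have 3: "k1' \<cdot> ?u = i1'"
      using ty by (simp add: \<alpha>(6) comp_rewrite[OF ci] comp_rewrite[OF e(9)])
    have 4: "?v \<cdot> k1 = j1"
      using ty by (simp add: \<gamma>(5) e(10) bj)
    have 5: "j1' \<cdot> ?v = S f \<cdot> k1'"
      using ty by (simp add: \<gamma>(6) comp_rewrite[OF bi] comp_rewrite[OF e(11)])
    show "\<exists>u\<in>Hom C C' B'. \<exists>v\<in>Hom C B' A'. Tri C' B' A' u v (S i1 \<cdot> j1') \<in> Dist C \<and>
        u \<cdot> i1 = k1 \<cdot> g \<and> k1' \<cdot> u = i1' \<and> v \<cdot> k1 = j1 \<and> j1' \<cdot> v = S f \<cdot> k1'"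
      by (rule bexI[of _ ?u], rule bexI[of _ ?v])
        (use o a(2-4) b(2-4) c(2-4) \<alpha>(2-4) \<beta>(2-4) \<gamma>(2-4) t te e(5-7) in \<open>simp_all add: Dist_iff 1 2 3 4 5 del: assoc\<close>)
  qed
  have "equivalence C C (Shift C)"
    by (rule equivalence_shiftI) (use faithful full dense in blast)+
  then show ?thesis
    unfolding triangulated_def using additive shift_additive Dist_candidate TR1 TR2 TR3 TR4 by blast
qed

end

section \<open>Triangulated categories and their opposites\<close>

context preadd
begin

lemma isom_cancel_right:
  assumes "isom e" "arr x" "arr y" "dm x = cd e" "dm y = cd e" "x \<cdot> e = y \<cdot> e"
  shows "x = y"
proof -
  obtain g where g: "arr g" "dm g = cd e" "cd g = dm e" "e \<cdot> g = Ide C (cd e)"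
    using isom_inverse[OF assms(1)] by blast
  have c: "(z \<cdot> e) \<cdot> g = z" if "arr z" "dm z = cd e" for z
    using g assms(1) that by simp
  have "(x \<cdot> e) \<cdot> g = (y \<cdot> e) \<cdot> g" using assms(6) by simp
  then show ?thesis unfolding c[OF assms(2,4)] c[OF assms(3,5)] .
qed

end

context pretri
begin

lemma zob_shift: "zob Z \<Longrightarrow> zob (So Z)"
  unfolding zob_def using shift_simps(2)[of Z] shift_Zer[of Z Z] by simp

lemma dt_Ide_snd:
  assumes "A \<in> Ob C" "zob Z"
  shows "dt (Zer C Z A) (Ide C A) (Zer C A (So Z))"
proof (rule dt_rotD)
  note Z = zobD(1)[OF assms(2)]
  show "cnd (Zer C Z A) (Ide C A) (Zer C A (So Z))" using assms(1) Z by (simp add: cnd_def)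
  show "dt (Ide C A) (Zer C A (So Z)) (ng (S (Zer C Z A)))"
    using dt_Ide[OF assms(1) zob_shift[OF assms(2)]] assms(1) Z by simp
qed

text \<open>Exactness of the contravariant Hom functors, by mapping the triangle to the one with the
  identity of \<open>cd y\<close> in second place.\<close>

lemma dt_colift:
  assumes "dt f g h"
  shows "\<lbrakk>arr y; dm y = cd f; y \<cdot> f = Zer C (dm f) (cd y)\<rbrakk> \<Longrightarrow> \<exists>x. arr x \<and> dm x = cd g \<and> cd x = cd y \<and> x \<cdot> g = y"
    and "\<lbrakk>arr y; dm y = cd g; y \<cdot> g = Zer C (dm g) (cd y)\<rbrakk> \<Longrightarrow> \<exists>x. arr x \<and> dm x = cd h \<and> cd x = cd y \<and> x \<cdot> h = y"
proof -
  have l: "\<exists>x. arr x \<and> dm x = cd g \<and> cd x = cd y \<and> x \<cdot> g = y"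
    if d: "dt f g h" "arr y" "dm y = cd f" "y \<cdot> f = Zer C (dm f) (cd y)" for f g h y
  proof -
    note t = dt_arr[OF d(1)]
    obtain Z where Z: "zob Z" using has_zob by blast
    note ZO = zobD(1)[OF Z]
    let ?Y = "cd y"
    have "\<exists>c. tmor f g h (Zer C Z ?Y) (Ide C ?Y) (Zer C ?Y (So Z)) (Zer C (dm f) Z) y c"
      by (rule dt_fill[OF d(1) dt_Ide_snd[OF _ Z]]) (use d t ZO in auto)
    then obtain x where "tmor f g h (Zer C Z ?Y) (Ide C ?Y) (Zer C ?Y (So Z)) (Zer C (dm f) Z) y x" by blast
    then have x: "arr x" "dm x = cd g" "cd x = cd (Ide C ?Y)" and sq: "x \<cdot> g = Ide C ?Y \<cdot> y"
      unfolding tmor_def by blast+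
    have "x \<cdot> g = y" by (rule sq[unfolded comp_Ide(1)[OF d(2) refl]])
    moreover have "cd x = cd y" unfolding x(3) by (rule Ide_arr) (use d in simp)
    ultimately show ?thesis using x by blast
  qed
  note t = dt_arr[OF assms]
  show "\<lbrakk>arr y; dm y = cd f; y \<cdot> f = Zer C (dm f) (cd y)\<rbrakk> \<Longrightarrow> \<exists>x. arr x \<and> dm x = cd g \<and> cd x = cd y \<and> x \<cdot> g = y"
    by (rule l[OF assms])
  show "\<lbrakk>arr y; dm y = cd g; y \<cdot> g = Zer C (dm g) (cd y)\<rbrakk> \<Longrightarrow> \<exists>x. arr x \<and> dm x = cd h \<and> cd x = cd y \<and> x \<cdot> h = y"
    by (rule l[OF dt_rot[OF assms]])
qed

end

locale tri = pretri C for C :: "('o, 'm, 'z) tcat_scheme" (structure) +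
  assumes triangulated_C: "triangulated C"

lemma triangulated_tri:
  assumes "triangulated C"
  shows "tri C"
proof -
  have a: "additive C" "additive_functor C C (Shift C)" "equivalence C C (Shift C)"
    "\<forall>t\<in>Dist C. candidate C (Shift C) t" "TR1 C" "TR2 C" "TR3 C"
    using assms by (simp_all add: triangulated_def)
  interpret preadd C by (rule additive_preadd[OF a(1)])
  interpret shifted C using a(2,4) by unfold_locales auto
  have "pretri C"
  proof
    show "\<exists>Z. zob Z" using a(1) by (auto simp: additive_def zob_iff)
    show "f = g" if "arr f" "arr g" "dm f = dm g" "cd f = cd g" "S f = S g" for f g
      by (rule equivalence_full_faithful(1)[OF a(3) that])
    show "\<exists>f. arr f \<and> dm f = A \<and> cd f = B \<and> S f = h"
      if "A \<in> Ob C" "B \<in> Ob C" "arr h" "dm h = So A" "cd h = So B" for A B h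
      by (rule equivalence_full_faithful(2)[OF a(3) that])
    show "dt f' g' h'" if "dt f g h" "cnd f' g' h'" "tmor f g h f' g' h' a b c" "isom a" "isom b" "isom c"
      for f g h f' g' h' a b c
    proof -
      have "tri_isomorphic C (Shift C) (Tri (dm f) (cd f) (cd g) f g h) (Tri (dm f') (cd f') (cd g') f' g' h')"
        unfolding tri_isomorphic_iff using that dt_cnd[OF that(1)] by blast
      then show ?thesis using a(5) that(1) unfolding TR1_def dt_def by blast
    qed
    show "dt (Ide C A) (Zer C A Z) (Zer C Z (So A))" if "A \<in> Ob C" "zob Z" for A Z
    proof -
      have "Tri A A Z (Ide C A) (Zer C A Z) (Zer C Z (So A)) \<in> Dist C"
        using a(5) that unfolding TR1_def zob_iff by blast
      then show ?thesis by (simp add: Dist_iff)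
    qed
    show "\<exists>g h. dt f g h" if "arr f" for f
    proof -
      have "\<exists>D g h. Tri (dm f) (cd f) D f g h \<in> Dist C"
        using a(5) arrE[OF that] unfolding TR1_def by blast
      then show ?thesis by (auto simp: Dist_iff)
    qed
    show "dt g h (ng (S f))" if "dt f g h" for f g h
    proof -
      note t = dt_arr[OF that]
      have c: "candidate C (Shift C) (Tri (dm f) (cd f) (cd g) f g h)"
        using dt_cnd[OF that] by (simp add: candidate_iff)
      have "neg C (So (dm f)) (So (cd f)) (S f) = ng (S f)" by (rule neg_eq_ng) (use t in auto)
      then have "Tri (cd f) (cd g) (So (dm f)) g h (ng (S f)) \<in> Dist C"
        using a(6) that c unfolding TR2_def dt_def by metis
      then show ?thesis by (simp add: Dist_iff)
    qed
    show "\<exists>c. tmor f g h f' g' h' a b c"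
      if h: "dt f g h" "dt f' g' h'" "arr a" "arr b" "dm a = dm f" "cd a = dm f'" "dm b = cd f" "cd b = cd f'"
        "b \<cdot>\<^bsub>C\<^esub> f = f' \<cdot>\<^bsub>C\<^esub> a" for f g h f' g' h' a b
    proof -
      note t = dt_arr[OF h(1)] dt_arr[OF h(2)]
      have d: "Tri (dm f) (cd f) (cd g) f g h \<in> Dist C" "Tri (dm f') (cd f') (cd g') f' g' h' \<in> Dist C"
        using h by (auto simp: dt_def)
      have "\<exists>c. tri_mor C (Shift C) (Tri (dm f) (cd f) (cd g) f g h) (Tri (dm f') (cd f') (cd g') f' g' h') a b c"
        using a(7)[unfolded TR3_def, rule_format, OF d, of a b] h t by simp
      then show ?thesis by (simp add: tri_mor_iff[OF dt_cnd[OF h(1)] dt_cnd[OF h(2)]])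
    qed
  qed
  then show ?thesis using assms by (simp add: tri_def tri_axioms_def)
qed

section \<open>Octahedra and triangles with a prescribed arrow\<close>

context tri
begin

lemma additive_C: "additive C"
  using triangulated_C by (simp add: triangulated_def)

lemma dense: "A \<in> Ob C \<Longrightarrow> \<exists>B e. B \<in> Ob C \<and> isom e \<and> dm e = So B \<and> cd e = A"
  using equivalence_full_faithful(3) triangulated_C by (simp add: triangulated_def)

lemma octahedron:
  assumes "dt f i i'" "dt g j j'" "dt (g \<cdot> f) k k'" "dm g = cd f"
  obtains u v where "dt u v (S i \<cdot> j')" "arr u" "arr v" "dm u = cd i" "cd u = cd k" "dm v = cd k" "cd v = cd j"
    "u \<cdot> i = k \<cdot> g" "k' \<cdot> u = i'" "v \<cdot> k = j" "j' \<cdot> v = S f \<cdot> k'"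
proof -
  have "TR4 C" using triangulated_C by (simp add: triangulated_def)
  moreover note t = dt_arr[OF assms(1)] dt_arr[OF assms(2)] dt_arr[OF assms(3)]
  have "Tri (dm f) (cd f) (cd i) f i i' \<in> Dist C" "Tri (cd f) (cd g) (cd j) g j j' \<in> Dist C"
    "Tri (dm f) (cd g) (cd k) (g \<cdot> f) k k' \<in> Dist C"
    using assms t by (auto simp: Dist_iff)
  ultimately have "\<exists>u\<in>Hom C (cd i) (cd k). \<exists>v\<in>Hom C (cd k) (cd j).
        Tri (cd i) (cd k) (cd j) u v (S i \<cdot> j') \<in> Dist C \<and>
        u \<cdot> i = k \<cdot> g \<and> k' \<cdot> u = i' \<and> v \<cdot> k = j \<and> j' \<cdot> v = S f \<cdot> k'"
    unfolding TR4_def by blast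
  then obtain u v where uv: "u \<in> Hom C (cd i) (cd k)" "v \<in> Hom C (cd k) (cd j)"
    "Tri (cd i) (cd k) (cd j) u v (S i \<cdot> j') \<in> Dist C"
    "u \<cdot> i = k \<cdot> g" "k' \<cdot> u = i'" "v \<cdot> k = j" "j' \<cdot> v = S f \<cdot> k'" by blast
  then have "dt u v (S i \<cdot> j')" "arr u" "arr v" "dm u = cd i" "cd u = cd k" "dm v = cd k" "cd v = cd j"
    using t by (simp_all add: Dist_iff)
  then show ?thesis using that uv(4-) by blast
qed

text \<open>Density replaces the cone of \<open>f\<close> by an isomorphic shift, so that the
  triangle on \<open>f\<close> can be rotated backwards.\<close>

lemma dt_ex_snd:
  assumes "arr f"
  shows "\<exists>g h. dt g f h"
proof -
  obtain p q where d: "dt f p q" using dt_ex[OF assms] by blast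
  note t = dt_arr[OF d]
  obtain D e where e: "D \<in> Ob C" "isom e" "dm e = So D" "cd e = cd p" using dense[of "cd p"] t by auto
  obtain e' where e': "isom e'" "arr e'" "dm e' = cd p" "cd e' = So D" "e' \<cdot> e = Ide C (So D)" "e \<cdot> e' = Ide C (cd p)"
    using isom_inverse[OF e(2)] e by auto
  obtain g where g: "arr g" "dm g = D" "cd g = dm f" "ng (q \<cdot> e) = S g"
    using full[of D "dm f" "ng (q \<cdot> e)"] e t by auto
  have qe: "q \<cdot> e = ng (S g)" unfolding g(4)[symmetric] using e t by simp
  have "dt f (e' \<cdot> p) (ng (S g))"
    by (rule dt_iso[OF d, where a="Ide C (dm f)" and b="Ide C (cd f)" and c=e'])
      (use e e' t g(1-3) in \<open>auto simp: cnd_def tmor_def qe[symmetric]\<close>)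
  then have "dt g f (e' \<cdot> p)" by (rule dt_rotD[rotated]) (use e' t g(1-3) in \<open>auto simp: cnd_def\<close>)
  then show ?thesis by blast
qed

text \<open>The source \<open>A\<close> has to be prescribed: \<open>h\<close> only determines the
  shift of \<open>A\<close>, and the shift need not be injective on objects.\<close>

lemma dt_ex_thd:
  assumes "arr h" "A \<in> Ob C" "cd h = So A"
  shows "\<exists>f g. dt f g h \<and> dm f = A"
proof -
  obtain g q where d: "dt g h q" using dt_ex_snd[OF assms(1)] by blast
  note t = dt_arr[OF d]
  obtain f where f: "arr f" "dm f = A" "cd f = dm g" "ng q = S f"
    using full[of A "dm g" "ng q"] assms t by auto
  have "q = ng (S f)" unfolding f(4)[symmetric] using t by simp
  then have "dt g h (ng (S f))" using d by simp
  then have "dt f g h" by (rule dt_rotD[rotated]) (use assms t f(1-3) in \<open>auto simp: cnd_def\<close>)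
  then show ?thesis using f(2) by blast
qed

end

text \<open>The opposite category, with a quasi-inverse \<open>G\<close> of the shift as its shift. An arrow
  \<open>h : B \<rightarrow> A[1]\<close> corresponds to the arrow \<open>phi A h : G B \<rightarrow> A\<close>; the argument \<open>A\<close> is needed because
  the shift need not be injective on objects.\<close>

locale opp = tri C for C :: "('o, 'm, 'z) tcat_scheme" (structure) +
  fixes G :: "('o, 'm, 'o, 'm) func" and \<eta> :: "'o \<Rightarrow> 'm"
  assumes G_functor: "is_functor C C G"
    and \<eta>: "A \<in> Ob C \<Longrightarrow> isom (\<eta> A)" "A \<in> Ob C \<Longrightarrow> dm (\<eta> A) = shift_ob C (fob G A)" "A \<in> Ob C \<Longrightarrow> cd (\<eta> A) = A"
    and \<eta>_nat: "arr f \<Longrightarrow> f \<cdot> \<eta> (dm f) = \<eta> (cd f) \<cdot> shift_map C (fmap G f)"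

lemma (in tri) opp_ex: "\<exists>G \<eta>. opp C G \<eta>"
proof -
  have "equivalence C C (Shift C)" using triangulated_C by (simp add: triangulated_def)
  then obtain G where G: "is_functor C C G"
    and 2: "naturally_isomorphic C C (comp_func (Shift C) G) id_func"
    unfolding equivalence_def by blast
  have i: "is_functor C C id_func" by (simp add: functor_iff id_func_def)
  have c2: "is_functor C C (comp_func (Shift C) G)"
    using G by (simp add: functor_iff comp_func_def)
  obtain \<epsilon> where \<epsilon>: "\<forall>A\<in>Ob C. isom (\<epsilon> A) \<and> dm (\<epsilon> A) = So (fob G A) \<and> cd (\<epsilon> A) = A"
    and n\<epsilon>: "\<forall>f. arr f \<longrightarrow> f \<cdot> \<epsilon> (dm f) = \<epsilon> (cd f) \<cdot> S (fmap G f)"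
    using 2 unfolding naturally_isomorphic_iff[OF c2 i] by (auto simp: id_func_def comp_func_def)
  have "opp C G \<epsilon>" by unfold_locales (use G \<epsilon> n\<epsilon> in auto)
  then show ?thesis by blast
qed

section \<open>The quasi-inverse \<open>G\<close> and the transposition \<open>phi\<close>\<close>

context opp
begin

abbreviation Go :: "'o \<Rightarrow> 'o" where "Go \<equiv> fob G"

abbreviation Gm :: "'m \<Rightarrow> 'm" where "Gm \<equiv> fmap G"

lemma G_simps [simp]:
  "A \<in> Ob C \<Longrightarrow> Go A \<in> Ob C"
  "A \<in> Ob C \<Longrightarrow> Gm (Ide C A) = Ide C (Go A)"
  "arr f \<Longrightarrow> arr (Gm f)" "arr f \<Longrightarrow> dm (Gm f) = Go (dm f)" "arr f \<Longrightarrow> cd (Gm f) = Go (cd f)"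
  "arr f \<Longrightarrow> arr g \<Longrightarrow> dm g = cd f \<Longrightarrow> Gm (g \<cdot> f) = Gm g \<cdot> Gm f"
  using G_functor by (simp_all add: functor_iff)

lemma \<eta>_simps [simp]: "A \<in> Ob C \<Longrightarrow> isom (\<eta> A)" "A \<in> Ob C \<Longrightarrow> dm (\<eta> A) = So (Go A)" "A \<in> Ob C \<Longrightarrow> cd (\<eta> A) = A"
  using \<eta> by auto

text \<open>The shift is faithful, so the naturality equation of \<open>\<eta>\<close> characterises
  \<open>Gm f\<close>. Identities for \<open>G\<close> are proved by testing a candidate in
  it.\<close>

lemma Gm_unique:
  assumes "arr f" "arr k" "dm k = Go (dm f)" "cd k = Go (cd f)" "\<eta> (cd f) \<cdot> S k = f \<cdot> \<eta> (dm f)"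
  shows "Gm f = k"
proof -
  have "S (Gm f) = S k"
    by (rule isom_cancel[of "\<eta> (cd f)"]) (use assms \<eta>_nat[OF assms(1)] in auto)
  then show ?thesis by (rule faithful[rotated -1]) (use assms in auto)
qed

lemma G_faithful:
  assumes "arr f" "arr g" "dm f = dm g" "cd f = cd g" "Gm f = Gm g"
  shows "f = g"
proof (rule isom_cancel_right)
  show "isom (\<eta> (dm g))" using assms(2) by simp
  show "f \<cdot> \<eta> (dm g) = g \<cdot> \<eta> (dm g)"
    using \<eta>_nat[OF assms(1)] \<eta>_nat[OF assms(2)] assms(3-5) by metis
qed (use assms in auto)

lemma G_full:
  assumes "A \<in> Ob C" "B \<in> Ob C" "arr k" "dm k = Go A" "cd k = Go B"
  shows "\<exists>f. arr f \<and> dm f = A \<and> cd f = B \<and> Gm f = k"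
proof -
  obtain e where e: "arr e" "dm e = A" "cd e = So (Go A)" "e \<cdot> \<eta> A = Ide C (So (Go A))"
    using isom_inverse[OF \<eta>_simps(1)[OF assms(1)]] assms by auto
  let ?f = "\<eta> B \<cdot> S k \<cdot> e"
  have "Gm ?f = k" by (rule Gm_unique) (use assms e in auto)
  then show ?thesis using assms e by (intro exI[of _ ?f]) simp
qed

lemma G_add:
  assumes "arr f" "arr g" "dm f = dm g" "cd f = cd g"
  shows "Gm (f \<boxplus> g) = Gm f \<boxplus> Gm g"
proof (rule Gm_unique)
  show "\<eta> (cd (f \<boxplus> g)) \<cdot> S (Gm f \<boxplus> Gm g) = (f \<boxplus> g) \<cdot> \<eta> (dm (f \<boxplus> g))"
    using assms \<eta>_nat[OF assms(1)] \<eta>_nat[OF assms(2)] by simp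
qed (use assms in auto)

text \<open>The arrow \<open>\<eta> (So A)\<close> ends in a shift, so it desuspends to an arrow
  from \<open>Go (So A)\<close> to \<open>A\<close>; its inverse exhibits \<open>A\<close> as a
  value of \<open>G\<close> up to isomorphism.\<close>

lemma G_dense:
  assumes "A \<in> Ob C"
  shows "\<exists>B e. B \<in> Ob C \<and> isom e \<and> dm e = A \<and> cd e = Go B"
proof -
  obtain u where u: "arr u" "dm u = Go (So A)" "cd u = A" "S u = \<eta> (So A)"
    using full[of "Go (So A)" A "\<eta> (So A)"] assms by auto
  have "isom u" by (rule isom_shiftD) (use u assms in auto)
  then show ?thesis using isom_inverse[of u] u assms by (intro exI[of _ "So A"]) auto
qed

definition phi :: "'o \<Rightarrow> 'm \<Rightarrow> 'm" where
  "phi A h = (THE k. arr k \<and> dm k = Go (dm h) \<and> cd k = A \<and> S k = h \<cdot> \<eta> (dm h))"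

lemma phi_eqI:
  assumes "arr h" "cd h = So A" "arr k" "dm k = Go (dm h)" "cd k = A" "S k = h \<cdot> \<eta> (dm h)"
  shows "phi A h = k"
  unfolding phi_def
proof (rule the_equality)
  show "arr k \<and> dm k = Go (dm h) \<and> cd k = A \<and> S k = h \<cdot> \<eta> (dm h)" using assms by blast
  show "l = k" if "arr l \<and> dm l = Go (dm h) \<and> cd l = A \<and> S l = h \<cdot> \<eta> (dm h)" for l
    by (rule faithful) (use that assms in auto)
qed

lemma phi_simps [simp]:
  assumes "arr h" "A \<in> Ob C" "cd h = So A"
  shows "arr (phi A h)" "dm (phi A h) = Go (dm h)" "cd (phi A h) = A" "S (phi A h) = h \<cdot> \<eta> (dm h)"
proof -
  obtain k where k: "arr k" "dm k = Go (dm h)" "cd k = A" "S k = h \<cdot> \<eta> (dm h)"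
    using full[of "Go (dm h)" A "h \<cdot> \<eta> (dm h)"] assms by auto
  have "phi A h = k" by (rule phi_eqI[OF assms(1,3) k])
  then show "arr (phi A h)" "dm (phi A h) = Go (dm h)" "cd (phi A h) = A" "S (phi A h) = h \<cdot> \<eta> (dm h)"
    using k by auto
qed

lemma phi_surj:
  assumes "arr k" "B \<in> Ob C" "dm k = Go B"
  shows "\<exists>h. arr h \<and> dm h = B \<and> cd h = So (cd k) \<and> phi (cd k) h = k"
proof -
  obtain e where e: "arr e" "dm e = B" "cd e = So (Go B)" "e \<cdot> \<eta> B = Ide C (So (Go B))"
    using isom_inverse[OF \<eta>_simps(1)[OF assms(2)]] assms by auto
  have "phi (cd k) (S k \<cdot> e) = k" by (rule phi_eqI) (use assms e in auto)
  then show ?thesis using assms e by (intro exI[of _ "S k \<cdot> e"]) simp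
qed

lemma phi_inject:
  assumes "arr h" "arr h'" "A \<in> Ob C" "cd h = So A" "cd h' = So A" "dm h = dm h'" "phi A h = phi A h'"
  shows "h = h'"
proof (rule isom_cancel_right)
  show "isom (\<eta> (dm h'))" using assms by simp
  show "h \<cdot> \<eta> (dm h') = h' \<cdot> \<eta> (dm h')"
    using phi_simps(4)[OF assms(1,3,4)] phi_simps(4)[OF assms(2,3,5)] assms(6,7) by metis
qed (use assms in auto)

text \<open>Naturality of the transposition in both variables at once; an identity for
  \<open>a\<close> or \<open>c\<close> gives the one-sided forms.\<close>

lemma phi_nat:
  assumes "arr h" "A \<in> Ob C" "cd h = So A" "arr a" "dm a = A" "arr c" "cd c = dm h"
  shows "phi (cd a) (S a \<cdot> h \<cdot> c) = a \<cdot> phi A h \<cdot> Gm c"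
proof (rule phi_eqI)
  have "S (a \<cdot> phi A h \<cdot> Gm c) = S a \<cdot> h \<cdot> \<eta> (cd c) \<cdot> S (Gm c)" using assms by simp
  also have "\<dots> = S a \<cdot> h \<cdot> c \<cdot> \<eta> (dm c)" by (simp only: \<eta>_nat[OF assms(6)])
  finally show "S (a \<cdot> phi A h \<cdot> Gm c) = (S a \<cdot> h \<cdot> c) \<cdot> \<eta> (dm (S a \<cdot> h \<cdot> c))" using assms by simp
qed (use assms in auto)

text \<open>Unlike \<open>op_cat\<close> it carries a shift and triangles, so that the theory of
  \<open>tri\<close> applies to it again. \<open>O_subfactor\<close> reconciles the two on
  subfactors.\<close>

definition opc :: "('o, 'm) tcat" where
  "opc = \<lparr>Ob = Ob C, Hom = (\<lambda>A B. Hom C B A), Ide = Ide C, Comp = (\<lambda>g f. f \<cdot> g),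
     Add = Add C, Zer = (\<lambda>A B. Zer C B A), Shift = G,
     Dist = {Tri (cd g) (cd f) (dm f) g f (phi (dm f) h) | f g h. dt f g h}\<rparr>"

lemma opc_simps [simp]:
  "Ob opc = Ob C" "Hom opc A B = Hom C B A" "Ide opc = Ide C" "g \<cdot>\<^bsub>opc\<^esub> f = f \<cdot> g"
  "f \<boxplus>\<^bsub>opc\<^esub> g = f \<boxplus> g" "Zer opc A B = Zer C B A" "Shift opc = G"
  by (simp_all add: opc_def)

lemma preadd_opc: "preadd opc"
proof
  have "hom_group opc A B = hom_group C B A" for A B by (simp add: hom_group_def opc_def)
  moreover have "category opc" unfolding category_def by auto
  ultimately show "preadditive opc"
    unfolding preadditive_def using hom_comm_group by simp
qed

section \<open>The opposite triangulated category\<close>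

sublocale O: preadd opc by (rule preadd_opc)

lemma O_arr [simp]: "O.arr f \<longleftrightarrow> arr f" "arr f \<Longrightarrow> O.dm f = cd f" "arr f \<Longrightarrow> O.cd f = dm f"
proof -
  show a: "O.arr f \<longleftrightarrow> arr f" unfolding O.arr_def arr_def by auto
  show "arr f \<Longrightarrow> O.dm f = cd f" "arr f \<Longrightarrow> O.cd f = dm f"
    using O.dm_eq[of "cd f" "dm f" f] O.cd_eq[of "cd f" "dm f" f] by auto
qed

lemma O_ng [simp]: "arr f \<Longrightarrow> O.ng f = ng f"
  using O.add_eq_Zer[of f "ng f"] by simp

lemma O_isom [simp]: "O.isom f \<longleftrightarrow> isom f"
proof
  assume "O.isom f"
  then obtain g where "O.arr f" "O.arr g" "O.dm g = O.cd f" "O.cd g = O.dm f" "g \<cdot>\<^bsub>opc\<^esub> f = Ide opc (O.dm f)"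
    "f \<cdot>\<^bsub>opc\<^esub> g = Ide opc (O.cd f)" by (rule O.isomE)
  then show "isom f" by (intro isomI[of f g]) auto
next
  assume "isom f"
  then obtain g where "arr f" "arr g" "dm g = cd f" "cd g = dm f" "g \<cdot> f = Ide C (dm f)"
    "f \<cdot> g = Ide C (cd f)" by (rule isomE)
  then show "O.isom f" by (intro O.isomI[of f g]) auto
qed

lemma O_zob [simp]: "O.zob Z \<longleftrightarrow> zob Z"
  by (simp add: zob_def O.zob_def)

lemma O_zero_object: "zero_object opc Z \<longleftrightarrow> zero_object C Z"
  by (simp add: zob_iff O.zob_iff)

lemma O_isomorphic: "isomorphic opc A B \<longleftrightarrow> isomorphic C B A"
  unfolding isomorphic_iff O.isomorphic_iff by auto

lemma O_biprod: "O.biprod i j p q \<longleftrightarrow> biprod p q i j"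
  unfolding biprod_def O.biprod_def by (auto simp: conj_commute)

lemma O_biproduct: "biproduct opc A B P \<longleftrightarrow> biproduct C A B P"
proof -
  have "O.biprod i j p q \<and> O.dm i = A \<and> O.dm j = B \<and> O.cd i = P \<longleftrightarrow>
    biprod p q i j \<and> dm p = A \<and> dm q = B \<and> cd p = P" for i j p q
    unfolding O_biprod by (auto simp: biprod_def)
  then show ?thesis unfolding biproduct_iff O.biproduct_iff by blast
qed

sublocale O: shifted opc
proof
  show "additive_functor opc opc (Shift opc)"
    unfolding additive_functor_def O.functor_iff using G_add by auto
  show "\<forall>t\<in>Dist opc. candidate opc (Shift opc) t"
  proof
    fix t assume "t \<in> Dist opc"
    then obtain f g h where t: "t = Tri (cd g) (cd f) (dm f) g f (phi (dm f) h)" "dt f g h"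
      by (auto simp: opc_def)
    then show "candidate opc (Shift opc) t" using dt_arr[OF t(2)] by (simp add: candidate_def)
  qed
qed

lemma O_dt: "O.dt g f k \<longleftrightarrow> (\<exists>h. dt f g h \<and> k = phi (dm f) h)"
proof
  assume d: "O.dt g f k"
  note t = O.dt_arr[OF d]
  have "Tri (cd g) (dm g) (dm f) g f k \<in> Dist opc" using d t by (simp add: O.dt_def)
  then show "\<exists>h. dt f g h \<and> k = phi (dm f) h" by (auto simp: opc_def)
next
  assume "\<exists>h. dt f g h \<and> k = phi (dm f) h"
  then obtain h where h: "dt f g h" "k = phi (dm f) h" by blast
  note t = dt_arr[OF h(1)]
  have "Tri (cd g) (cd f) (dm f) g f k \<in> Dist opc" using h by (auto simp: opc_def)
  then show "O.dt g f k" using t by (simp add: O.dt_def)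
qed

lemma O_cnd: "cnd f g h \<Longrightarrow> O.cnd g f (phi (dm f) h)"
  unfolding O.cnd_def cnd_def by simp

lemma O_cndE:
  assumes "O.cnd g f k"
  obtains h where "cnd f g h" "k = phi (dm f) h"
proof -
  have t: "arr f" "arr g" "arr k" "dm g = cd f" "dm k = Go (cd g)" "cd k = dm f"
    using assms by (auto simp: O.cnd_def)
  obtain h where "arr h" "dm h = cd g" "cd h = So (dm f)" "phi (dm f) h = k"
    using phi_surj[of k "cd g"] t by auto
  then show ?thesis using that[of h] t by (auto simp: cnd_def)
qed

text \<open>Two of the squares are merely read backwards. The square with the last arrows is
  transposed: both of its composites are images under \<open>phi\<close>, which is natural and
  injective.\<close>

lemma O_tmor:
  assumes "cnd f g h" "cnd f' g' h'"
  shows "O.tmor g f (phi (dm f) h) g' f' (phi (dm f') h') c b a \<longleftrightarrow> tmor f' g' h' f g h a b c"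
proof -
  note t = assms[unfolded cnd_def]
  have "phi (dm f) h \<cdot> Gm c = a \<cdot> phi (dm f') h' \<longleftrightarrow> S a \<cdot> h' = h \<cdot> c"
    if m: "arr a" "arr c" "dm a = dm f'" "cd a = dm f" "dm c = cd g'" "cd c = cd g"
  proof -
    have "S (Ide C (dm f)) \<cdot> (h \<cdot> c) = h \<cdot> c" "(S a \<cdot> h') \<cdot> Ide C (dm h') = S a \<cdot> h'" using t m by auto
    then have 1: "phi (dm f) (h \<cdot> c) = phi (dm f) h \<cdot> Gm c" "phi (dm f) (S a \<cdot> h') = a \<cdot> phi (dm f') h'"
      using phi_nat[of h "dm f" "Ide C (dm f)" c] phi_nat[of h' "dm f'" a "Ide C (dm h')"] t m by auto
    show ?thesis
      unfolding 1[symmetric] using phi_inject[of "S a \<cdot> h'" "h \<cdot> c" "dm f"] t m by auto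
  qed
  then show ?thesis unfolding tmor_def O.tmor_def using t by auto
qed

text \<open>Each axiom comes from its mirror image: completion of an arrow from
  \<open>dt_ex_snd\<close>, fill-ins from \<open>dt_fill_fst\<close>, rotation from
  \<open>dt_rotD\<close>.\<close>

sublocale O: pretri opc
proof
  show "\<exists>Z. O.zob Z" using has_zob by simp
  show "f = g" if "O.arr f" "O.arr g" "O.dm f = O.dm g" "O.cd f = O.cd g" "O.S f = O.S g" for f g
    by (rule G_faithful) (use that in auto)
  show "\<exists>f. O.arr f \<and> O.dm f = A \<and> O.cd f = B \<and> O.S f = h"
    if "A \<in> Ob opc" "B \<in> Ob opc" "O.arr h" "O.dm h = O.So A" "O.cd h = O.So B" for A B h
    using G_full[of B A h] that by auto
  show "O.dt f' g' h'" if h: "O.dt f g h" "O.cnd f' g' h'" "O.tmor f g h f' g' h' a b c"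
    "O.isom a" "O.isom b" "O.isom c" for f g h f' g' h' a b c
  proof -
    obtain k where k: "dt g f k" "h = phi (dm g) k" using h(1) O_dt by blast
    obtain k' where k': "cnd g' f' k'" "h' = phi (dm g') k'" by (rule O_cndE[OF h(2)])
    have m: "tmor g' f' k' g f k c b a" using h(3) O_tmor[OF dt_cnd[OF k(1)] k'(1)] k(2) k'(2) by simp
    obtain a' b' c' where "tmor g f k g' f' k' c' b' a'" "isom a'" "isom b'" "isom c'"
      by (rule tmor_inverse[OF m]) (use h(4-6) k'(1) dt_cnd[OF k(1)] in auto)
    then have "dt g' f' k'" using dt_iso[OF k(1) k'(1)] by blast
    then show ?thesis using k'(2) O_dt by blast
  qed
  show "O.dt (Ide opc A) (Zer opc A Z) (Zer opc Z (O.So A))" if "A \<in> Ob opc" "O.zob Z" for A Z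
  proof -
    have A: "A \<in> Ob C" "zob Z" using that by auto
    note Z = zobD(1)[OF A(2)]
    have "phi Z (Zer C A (So Z)) = Zer C (Go A) Z" by (rule phi_eqI) (use A Z in auto)
    then show ?thesis using dt_Ide_snd[OF A] A Z by (auto simp: O_dt)
  qed
  show "\<exists>g h. O.dt f g h" if "O.arr f" for f
    using dt_ex_snd[of f] that O_dt by auto
  show "O.dt g h (O.ng (O.S f))" if d: "O.dt f g h" for f g h
  proof -
    obtain k where k: "dt g f k" "h = phi (dm g) k" using d O_dt by blast
    note t = dt_arr[OF k(1)]
    \<comment> \<open>The inverse of \<open>\<eta> (cd f)\<close> replaces the third object by a
      shift. Only then does the last arrow become minus the shift of \<open>h\<close>, as the
      inverse rotation requires.\<close>
    obtain e where e: "isom e" "arr e" "dm e = cd f" "cd e = So (Go (cd f))"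
      "e \<cdot> \<eta> (cd f) = Ide C (So (Go (cd f)))" "\<eta> (cd f) \<cdot> e = Ide C (cd f)"
      using isom_inverse[OF \<eta>_simps(1), of "cd f"] t by auto
    have h: "arr h" "dm h = Go (cd f)" "cd h = dm g" "S h = k \<cdot> \<eta> (cd f)" using t k(2) by auto
    have "dt g (ng (e \<cdot> f)) (ng (S h))"
      by (rule dt_iso[OF k(1), where a="Ide C (dm g)" and b="Ide C (cd g)" and c="ng e"])
        (use t e h in \<open>auto simp: cnd_def tmor_def isom_ng\<close>)
    then have "dt h g (ng (e \<cdot> f))" by (rule dt_rotD[rotated]) (use t e h in \<open>auto simp: cnd_def\<close>)
    moreover have "phi (dm h) (ng (e \<cdot> f)) = ng (Gm f)"
    proof (rule phi_eqI)
      have "e \<cdot> (f \<cdot> \<eta> (dm f)) = S (Gm f)"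
        unfolding \<eta>_nat[OF t(2)] using t e by (simp add: comp_rewrite[OF e(5)])
      then show "S (ng (Gm f)) = ng (e \<cdot> f) \<cdot> \<eta> (dm (ng (e \<cdot> f)))" using t e by simp
    qed (use t e h in auto)
    ultimately show ?thesis using O_dt t by auto
  qed
  show "\<exists>c. O.tmor f g h f' g' h' a b c"
    if h: "O.dt f g h" "O.dt f' g' h'" "O.arr a" "O.arr b" "O.dm a = O.dm f" "O.cd a = O.dm f'" "O.dm b = O.cd f"
      "O.cd b = O.cd f'" "b \<cdot>\<^bsub>opc\<^esub> f = f' \<cdot>\<^bsub>opc\<^esub> a" for f g h f' g' h' a b
  proof -
    obtain k where k: "dt g f k" "h = phi (dm g) k" using h(1) O_dt by blast
    obtain k' where k': "dt g' f' k'" "h' = phi (dm g') k'" using h(2) O_dt by blast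
    note t = dt_arr[OF k(1)] dt_arr[OF k'(1)]
    have "\<exists>c. tmor g' f' k' g f k c b a"
      by (rule dt_fill_fst[OF k'(1) k(1)]) (use h(3-) t in auto)
    then show ?thesis unfolding k(2) k'(2) using O_tmor[OF dt_cnd[OF k(1)] dt_cnd[OF k'(1)]] by blast
  qed
qed

text \<open>The octahedral axiom for fibres instead of cones: apply it to the rotated triangles and
  desuspend the two arrows it yields.\<close>

lemma octahedron_op:
  assumes "dt i f a" "dt j g b" "dt k (f \<cdot> g) c" "dm f = cd g"
  obtains u v where "dt v u (b \<cdot> i)" "dm u = dm k" "cd u = dm i" "dm v = dm j"
    "i \<cdot> u = g \<cdot> k" "S u \<cdot> c = a" "k \<cdot> v = j" "S v \<cdot> b = c \<cdot> f"
proof -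
  note t = dt_arr[OF assms(1)] dt_arr[OF assms(2)] dt_arr[OF assms(3)]
  from octahedron[OF dt_rot[OF assms(2)] dt_rot[OF assms(1)] dt_rot[OF assms(3)] assms(4)]
  obtain u' v' where d: "dt u' v' (S b \<cdot> ng (S i))" and ty: "arr u'" "arr v'" "dm u' = cd b" "cd u' = cd c" "dm v' = cd c" "cd v' = cd a"
    and e: "u' \<cdot> b = c \<cdot> f" "ng (S k) \<cdot> u' = ng (S j)" "v' \<cdot> c = a" "ng (S i) \<cdot> v' = S g \<cdot> ng (S k)" by blast
  obtain v where v: "arr v" "dm v = dm j" "cd v = dm k" "u' = S v" using full[of "dm j" "dm k" u'] ty t by auto
  obtain u where u: "arr u" "dm u = dm k" "cd u = dm i" "v' = S u" using full[of "dm k" "dm i" v'] ty t by auto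
  have bi: "S b \<cdot> ng (S i) = ng (S (b \<cdot> i))" using t assms(4) by simp
  have "dt v u (b \<cdot> i)"
    by (rule dt_shift_iff[THEN iffD2])
      (use d t assms(4) u(1-3) v(1-3) in \<open>auto simp: cnd_def u(4) v(4) bi\<close>)
  moreover have "i \<cdot> u = g \<cdot> k"
  proof (rule faithful)
    show "S (i \<cdot> u) = S (g \<cdot> k)" using e(4) u t assms(4) by (simp add: ng_inject)
  qed (use u(1-3) t assms(4) in auto)
  moreover have "k \<cdot> v = j"
  proof (rule faithful)
    show "S (k \<cdot> v) = S j" using e(2) v t by (simp add: ng_inject)
  qed (use v(1-3) t assms(4) in auto)
  ultimately show ?thesis using that u v e by blast
qed

lemma triangulated_opc: "triangulated opc"
proof (rule O.triangulatedI)
  have "preadditive opc" using preadd_opc by (simp add: preadd_def)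
  then show "additive opc"
    using additive_C unfolding additive_def O_zero_object O_biproduct by simp
  show "\<exists>B e. B \<in> Ob opc \<and> O.isom e \<and> O.dm e = O.So B \<and> O.cd e = A" if A: "A \<in> Ob opc" for A
  proof -
    obtain B e where "B \<in> Ob C" "isom e" "dm e = A" "cd e = Go B" using G_dense[of A] A by auto
    then show ?thesis by (intro exI[of _ B] exI[of _ e]) simp
  qed
  show "\<exists>i i' j j' k k' u v. O.dt f i i' \<and> O.dt g j j' \<and> O.dt (g \<cdot>\<^bsub>opc\<^esub> f) k k' \<and>
      O.dt u v (O.S i \<cdot>\<^bsub>opc\<^esub> j') \<and> O.dm u = O.cd i \<and> O.cd u = O.cd k \<and> O.cd v = O.cd j \<and>
      u \<cdot>\<^bsub>opc\<^esub> i = k \<cdot>\<^bsub>opc\<^esub> g \<and> k' \<cdot>\<^bsub>opc\<^esub> u = i' \<and> v \<cdot>\<^bsub>opc\<^esub> k = j \<and> j' \<cdot>\<^bsub>opc\<^esub> v = O.S f \<cdot>\<^bsub>opc\<^esub> k'"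
    if "O.arr f" "O.arr g" "O.dm g = O.cd f" for f g
  proof -
    have fg: "arr f" "arr g" "dm f = cd g" using that by auto
    obtain i a where 1: "dt i f a" using dt_ex_snd[OF fg(1)] by blast
    obtain j b where 2: "dt j g b" using dt_ex_snd[OF fg(2)] by blast
    obtain k c where 3: "dt k (f \<cdot> g) c" using dt_ex_snd[of "f \<cdot> g"] fg by auto
    note t = dt_arr[OF 1] dt_arr[OF 2] dt_arr[OF 3]
    obtain u v where d: "dt v u (b \<cdot> i)" and ty: "dm u = dm k" "cd u = dm i" "dm v = dm j"
      and e: "i \<cdot> u = g \<cdot> k" "S u \<cdot> c = a" "k \<cdot> v = j" "S v \<cdot> b = c \<cdot> f"
      by (rule octahedron_op[OF 1 2 3 fg(3)])
    note tt = dt_arr[OF d]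
    have p1: "phi (dm j) (b \<cdot> i) = phi (dm j) b \<cdot> Gm i"
      using phi_nat[of b "dm j" "Ide C (dm j)" i] t fg by simp
    have p2: "u \<cdot> phi (dm k) c = phi (dm i) a"
      using phi_nat[of c "dm k" u "Ide C (dm c)"] t tt ty e(2) fg by simp
    have "phi (dm k) (S v \<cdot> b) = v \<cdot> phi (dm j) b"
      using phi_nat[of b "dm j" v "Ide C (dm b)"] t tt ty fg by simp
    moreover have "phi (dm k) (c \<cdot> f) = phi (dm k) c \<cdot> Gm f"
      using phi_nat[of c "dm k" "Ide C (dm k)" f] t tt ty fg by simp
    ultimately have p3: "v \<cdot> phi (dm j) b = phi (dm k) c \<cdot> Gm f" using e(4) by simp
    have "O.dt f i (phi (dm i) a)" "O.dt g j (phi (dm j) b)" "O.dt (f \<cdot> g) k (phi (dm k) c)"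
      using 1 2 3 O_dt by blast+
    moreover have "O.dt u v (phi (dm j) b \<cdot> Gm i)" using d O_dt ty p1[symmetric] by auto
    moreover have "O.dm u = O.cd i" "O.cd u = O.cd k" "O.cd v = O.cd j" using ty t tt by simp_all
    ultimately show ?thesis unfolding opc_simps using p2 p3 e(1,3) by blast
  qed
qed

sublocale O: tri opc by (rule triangulated_tri[OF triangulated_opc])

end

section \<open>Subfactor categories\<close>

text \<open>\<open>U\<close> only selects objects, whereas arrows and congruence are those of
  \<open>C\<close>. Hence \<open>U = Ob C\<close> gives the whole quotient, and a smaller
  \<open>U\<close> a full subcategory of it.\<close>

locale subfactor_cat = preadd C for C :: "('o, 'm, 'z) cat_scheme" (structure) +
  fixes X U :: "'o set"
  assumes additive_X: "additive_subcategory C X"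
    and additive_U: "additive_subcategory C U"
    and biproducts: "\<lbrakk>A \<in> Ob C; B \<in> Ob C\<rbrakk> \<Longrightarrow> \<exists>P. biproduct C A B P"
begin

lemma X_Ob [simp]: "A \<in> X \<Longrightarrow> A \<in> Ob C"
  using additive_X unfolding additive_subcategory_def by blast

lemma U_Ob [simp]: "A \<in> U \<Longrightarrow> A \<in> Ob C"
  using additive_U unfolding additive_subcategory_def by blast

text \<open>The predicate behind \<open>factoring\<close>, with the endpoints read off from
  \<open>d\<close>.\<close>

definition fac :: "'m \<Rightarrow> bool" where
  "fac d \<longleftrightarrow> (\<exists>a b. arr a \<and> arr b \<and> dm b = cd a \<and> cd a \<in> X \<and> b \<cdot> a = d)"

lemma facI: "arr a \<Longrightarrow> arr b \<Longrightarrow> dm b = cd a \<Longrightarrow> cd a \<in> X \<Longrightarrow> fac (b \<cdot> a)"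
  by (auto simp: fac_def)

lemma facE:
  assumes "fac d"
  obtains a b where "arr a" "arr b" "dm b = cd a" "cd a \<in> X" "d = b \<cdot> a"
  using assms by (auto simp: fac_def)

lemma fac_comp_left:
  assumes "fac d" "arr x" "dm x = cd d"
  shows "fac (x \<cdot> d)"
proof -
  from assms(1) obtain a b where d: "arr a" "arr b" "dm b = cd a" "cd a \<in> X" "d = b \<cdot> a" by (rule facE)
  have "fac ((x \<cdot> b) \<cdot> a)" by (rule facI) (use d assms in auto)
  then show ?thesis using d assms by simp
qed

lemma fac_comp_right:
  assumes "fac d" "arr x" "cd x = dm d"
  shows "fac (d \<cdot> x)"
proof -
  from assms(1) obtain a b where d: "arr a" "arr b" "dm b = cd a" "cd a \<in> X" "d = b \<cdot> a" by (rule facE)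
  have "fac (b \<cdot> (a \<cdot> x))" by (rule facI) (use d assms in auto)
  then show ?thesis using d assms by simp
qed

lemma fac_ng:
  assumes "fac d"
  shows "fac (ng d)"
proof -
  from assms obtain a b where d: "arr a" "arr b" "dm b = cd a" "cd a \<in> X" "d = b \<cdot> a" by (rule facE)
  have "fac (ng b \<cdot> a)" by (rule facI) (use d assms in auto)
  then show ?thesis using d assms by simp
qed

lemma fac_Zer:
  assumes "A \<in> Ob C" "B \<in> Ob C"
  shows "fac (Zer C A B)"
proof -
  obtain Z where Z: "Z \<in> X" using additive_X unfolding additive_subcategory_def by blast
  have "fac (Zer C Z B \<cdot> Zer C A Z)" by (rule facI) (use Z assms in auto)
  then show ?thesis using Z assms by simp
qed

text \<open>The two middle objects are combined into their biproduct, which stays in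
  \<open>X\<close>.\<close>

lemma fac_add:
  assumes "fac d" "fac d'" "dm d = dm d'" "cd d = cd d'"
  shows "fac (d \<boxplus> d')"
proof -
  from assms(1) obtain a b where d: "arr a" "arr b" "dm b = cd a" "cd a \<in> X" "d = b \<cdot> a" by (rule facE)
  from assms(2) obtain a' b' where d': "arr a'" "arr b'" "dm b' = cd a'" "cd a' \<in> X" "d' = b' \<cdot> a'" by (rule facE)
  have p: "dm a = dm a'" "cd b = cd b'" using assms(3,4) d d' by auto
  obtain P where P: "biproduct C (cd a) (cd a') P" using biproducts[of "cd a" "cd a'"] d d' by auto
  then have PX: "P \<in> X" using d d' additive_X unfolding additive_subcategory_def by blast
  obtain i j p q where b: "biprod i j p q" "dm i = cd a" "dm j = cd a'" "cd i = P"
    using P unfolding biproduct_iff by blast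
  note bb = b(1)[unfolded biprod_def]
  have e: "p \<cdot> i = Ide C (cd a)" "q \<cdot> j = Ide C (cd a')" "p \<cdot> j = Zer C (cd a') (cd a)" "q \<cdot> i = Zer C (cd a) (cd a')"
    using bb b(2,3) by auto
  have ty: "arr i" "arr j" "arr p" "arr q" "cd j = P" "dm p = P" "dm q = P" "cd p = cd a" "cd q = cd a'"
    using bb b(2-4) by auto
  have "(b \<cdot> p \<boxplus> b' \<cdot> q) \<cdot> (i \<cdot> a \<boxplus> j \<cdot> a') = b \<cdot> a \<boxplus> b' \<cdot> a'"
    using d(1-4) d'(1-4) p ty b(2-4) PX
    by (simp add: comp_rewrite[OF e(1)] comp_rewrite[OF e(2)] comp_rewrite[OF e(3)] comp_rewrite[OF e(4)])
  moreover have "fac ((b \<cdot> p \<boxplus> b' \<cdot> q) \<cdot> (i \<cdot> a \<boxplus> j \<cdot> a'))"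
    by (rule facI) (use d(1-4) d'(1-4) p ty b(2-4) PX in auto)
  ultimately show ?thesis using d d' by simp
qed

definition eqv :: "'m \<Rightarrow> 'm \<Rightarrow> bool" where
  "eqv f g \<longleftrightarrow> arr f \<and> arr g \<and> dm f = dm g \<and> cd f = cd g \<and> fac (f \<boxplus> ng g)"

lemma eqvD: "eqv f g \<Longrightarrow> arr f" "eqv f g \<Longrightarrow> arr g" "eqv f g \<Longrightarrow> dm f = dm g" "eqv f g \<Longrightarrow> cd f = cd g"
  by (auto simp: eqv_def)

lemma eqv_refl: "arr f \<Longrightarrow> eqv f f"
  by (simp add: eqv_def fac_Zer)

lemma eqv_sym: "eqv f g \<Longrightarrow> eqv g f"
proof -
  assume e: "eqv f g"
  then have t: "arr f" "arr g" "dm f = dm g" "cd f = cd g" "fac (f \<boxplus> ng g)" by (auto simp: eqv_def)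
  have "ng (f \<boxplus> ng g) = ng f \<boxplus> ng (ng g)" by (rule ng_add) (use t in auto)
  also have "\<dots> = g \<boxplus> ng f" using t add_comm[of "ng f" g] by simp
  finally have "fac (g \<boxplus> ng f)" using fac_ng[OF t(5)] by simp
  then show ?thesis using t by (simp add: eqv_def)
qed

lemma eqv_trans:
  assumes "eqv f g" "eqv g h"
  shows "eqv f h"
proof -
  note t = assms[unfolded eqv_def]
  have "(f \<boxplus> ng g) \<boxplus> (g \<boxplus> ng h) = f \<boxplus> ng h" using t by (simp add: add_assoc)
  moreover have "fac ((f \<boxplus> ng g) \<boxplus> (g \<boxplus> ng h))" by (rule fac_add) (use t in auto)
  ultimately show ?thesis using t by (simp add: eqv_def)
qed

lemma eqv_comp:
  assumes "eqv f f'" "eqv g g'" "dm g = cd f"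
  shows "eqv (g \<cdot> f) (g' \<cdot> f')"
proof -
  note t = assms(1,2)[unfolded eqv_def]
  have 1: "g \<cdot> (f \<boxplus> ng f') = g \<cdot> f \<boxplus> ng (g \<cdot> f')" "(g \<boxplus> ng g') \<cdot> f' = g \<cdot> f' \<boxplus> ng (g' \<cdot> f')"
    using t assms(3) by simp_all
  have "fac (g \<cdot> (f \<boxplus> ng f'))" by (rule fac_comp_left) (use t assms(3) in auto)
  then have "eqv (g \<cdot> f) (g \<cdot> f')" unfolding 1 eqv_def using t assms(3) by simp
  moreover have "fac ((g \<boxplus> ng g') \<cdot> f')" by (rule fac_comp_right) (use t assms(3) in auto)
  then have "eqv (g \<cdot> f') (g' \<cdot> f')" unfolding 1 eqv_def using t assms(3) by simp
  ultimately show ?thesis by (rule eqv_trans)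
qed

lemma eqv_add:
  assumes "eqv f f'" "eqv g g'" "dm f = dm g" "cd f = cd g"
  shows "eqv (f \<boxplus> g) (f' \<boxplus> g')"
proof -
  note t = assms(1,2)[unfolded eqv_def]
  have ty: "dm f' = dm g'" "cd f' = cd g'" using t assms(3,4) by auto
  have "(f \<boxplus> ng f') \<boxplus> (g \<boxplus> ng g') = (f \<boxplus> g) \<boxplus> (ng f' \<boxplus> ng g')"
    using t assms(3,4) ty by (simp add: add_assoc add_left_comm)
  also have "ng f' \<boxplus> ng g' = ng (f' \<boxplus> g')" by (rule ng_add[symmetric]) (use t ty in auto)
  finally have "(f \<boxplus> ng f') \<boxplus> (g \<boxplus> ng g') = (f \<boxplus> g) \<boxplus> ng (f' \<boxplus> g')" .
  moreover have "fac ((f \<boxplus> ng f') \<boxplus> (g \<boxplus> ng g'))" by (rule fac_add) (use t assms(3,4) ty in auto)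
  ultimately show ?thesis using t assms(3,4) ty by (simp add: eqv_def)
qed

abbreviation cls :: "'m \<Rightarrow> 'm set" where "cls \<equiv> quot_class C X"

lemma cong_mod_iff: "(f, g) \<in> cong_mod C X \<longleftrightarrow> eqv f g"
proof
  assume "(f, g) \<in> cong_mod C X"
  then obtain A B d where h: "A \<in> Ob C" "B \<in> Ob C" "f \<in> Hom C A B" "g \<in> Hom C A B" "d \<in> factoring C X A B" "f = g \<boxplus> d"
    by (auto simp: cong_mod_def)
  from h(5) obtain a b Y where d: "Y \<in> X" "a \<in> Hom C A Y" "b \<in> Hom C Y B" "d = b \<cdot> a" by (auto simp: factoring_def)
  have Y: "Y \<in> Ob C" using d by simp
  have "arr a" "arr b" "dm b = cd a" "cd a \<in> X" using d Y h(1,2) by auto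
  then have fd: "fac d" using facI d(4) by simp
  have ty: "arr g" "arr d" "dm g = A" "dm d = A" "cd g = B" "cd d = B" using d Y h(1-4) by auto
  then have "f \<boxplus> ng g = d" unfolding h(6) add_comm[OF ty(1,2) ty(3)[folded ty(4)] ty(5)[folded ty(6)]]
    by (simp add: add_assoc)
  then show "eqv f g" using fd ty h(6) by (simp add: eqv_def)
next
  assume "eqv f g"
  note t = this[unfolded eqv_def]
  from t obtain a b where d: "arr a" "arr b" "dm b = cd a" "cd a \<in> X" "f \<boxplus> ng g = b \<cdot> a" by (auto elim: facE)
  have e: "dm (f \<boxplus> ng g) = dm f" "cd (f \<boxplus> ng g) = cd f" using t by auto
  have "dm a = dm f" "cd b = cd f" using e unfolding d(5) using d(1-3) by auto
  then have "a \<in> Hom C (dm f) (cd a)" "b \<in> Hom C (cd a) (cd f)" using d(1-3) t by auto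
  then have "b \<cdot> a \<in> factoring C X (dm f) (cd f)"
    unfolding factoring_def using d(4) by blast
  moreover have "f = g \<boxplus> (f \<boxplus> ng g)" using t by (simp add: add_left_comm[of g f "ng g"])
  then have "f = g \<boxplus> b \<cdot> a" unfolding d(5) .
  ultimately show "(f, g) \<in> cong_mod C X"
    unfolding cong_mod_def using t by (auto intro!: bexI[of _ "dm f"] bexI[of _ "cd f"] bexI[of _ "b \<cdot> a"])
qed

lemma mem_cls: "g \<in> cls f \<longleftrightarrow> eqv f g"
  unfolding quot_class_def using cong_mod_iff by auto

lemma cls_eq_iff: "arr f \<Longrightarrow> cls f = cls g \<longleftrightarrow> eqv f g"
proof
  assume "arr f" "cls f = cls g"
  then have "f \<in> cls g" using eqv_refl mem_cls by blast
  then show "eqv f g" using mem_cls eqv_sym by blast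
next
  assume e: "eqv f g"
  have "h \<in> cls f \<longleftrightarrow> h \<in> cls g" for h
    unfolding mem_cls using eqv_trans[OF e] eqv_trans[OF eqv_sym[OF e]] by blast
  then show "cls f = cls g" by blast
qed

lemma cls_eqI: "eqv f g \<Longrightarrow> cls g = cls f"
  using cls_eq_iff[of g f] eqv_sym[of f g] eqvD by blast

lemma cls_self: "arr f \<Longrightarrow> f \<in> cls f"
  by (simp add: mem_cls eqv_refl)

lemma cls_eq_zero_iff:
  assumes "arr f" "A = dm f" "B = cd f"
  shows "cls f = cls (Zer C A B) \<longleftrightarrow> fac f"
  using assms by (simp add: cls_eq_iff eqv_def)

text \<open>Composition and addition in \<open>quot_cat\<close> are unions over representatives.
  This collapses such a union once its terms are known to depend on the class only.\<close>

lemma UN_cls: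
  assumes "arr f" "\<And>g. eqv f g \<Longrightarrow> F g = F f"
  shows "(\<Union>g\<in>cls f. F g) = F f"
proof -
  have "(\<Union>g\<in>cls f. F g) = (\<Union>g\<in>cls f. F f)" by (rule SUP_cong) (use assms(2) mem_cls in blast)+
  then show ?thesis using cls_self[OF assms(1)] by blast
qed

section \<open>The quotient category on the objects of \<open>U\<close>\<close>

abbreviation Q :: "('o, 'm set) cat" where "Q \<equiv> subfactor C X U"

lemma Q_simps [simp]:
  "Ob Q = U" "Hom Q A B = cls ` Hom C A B" "Ide Q A = cls (Ide C A)" "Zer Q A B = cls (Zer C A B)"
proof -
  show "Hom Q A B = cls ` Hom C A B"
    unfolding subfactor_def quot_cat_def by (auto simp: quotient_def quot_class_def)
qed (simp_all add: subfactor_def quot_cat_def)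

lemma Q_comp [simp]:
  assumes "arr f" "arr g" "dm g = cd f"
  shows "cls g \<cdot>\<^bsub>Q\<^esub> cls f = cls (g \<cdot> f)"
proof -
  have "cls g \<cdot>\<^bsub>Q\<^esub> cls f = (\<Union>g'\<in>cls g. \<Union>f'\<in>cls f. cls (g' \<cdot> f'))"
    by (simp add: subfactor_def quot_cat_def)
  also have "\<dots> = (\<Union>f'\<in>cls f. cls (g \<cdot> f'))"
  proof (rule UN_cls[OF assms(2)])
    fix g' assume g: "eqv g g'"
    have "cls (g' \<cdot> f') = cls (g \<cdot> f')" if "f' \<in> cls f" for f'
    proof -
      have f': "arr f'" "dm g = cd f'" using that eqvD[of f f'] assms by (auto simp: mem_cls)
      show ?thesis by (rule cls_eqI[OF eqv_comp[OF eqv_refl[OF f'(1)] g f'(2)]])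
    qed
    then show "(\<Union>f'\<in>cls f. cls (g' \<cdot> f')) = (\<Union>f'\<in>cls f. cls (g \<cdot> f'))" by simp
  qed
  also have "\<dots> = cls (g \<cdot> f)"
  proof (rule UN_cls[OF assms(1)])
    fix f' assume f: "eqv f f'"
    show "cls (g \<cdot> f') = cls (g \<cdot> f)"
      by (rule cls_eqI[OF eqv_comp[OF f eqv_refl[OF assms(2)] assms(3)]])
  qed
  finally show ?thesis .
qed

lemma Q_add [simp]:
  assumes "arr f" "arr g" "dm f = dm g" "cd f = cd g"
  shows "cls f \<boxplus>\<^bsub>Q\<^esub> cls g = cls (f \<boxplus> g)"
proof -
  have "cls f \<boxplus>\<^bsub>Q\<^esub> cls g = (\<Union>f'\<in>cls f. \<Union>g'\<in>cls g. cls (f' \<boxplus> g'))"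
    by (simp add: subfactor_def quot_cat_def)
  also have "\<dots> = (\<Union>g'\<in>cls g. cls (f \<boxplus> g'))"
  proof (rule UN_cls[OF assms(1)])
    fix f' assume f: "eqv f f'"
    have "cls (f' \<boxplus> g') = cls (f \<boxplus> g')" if "g' \<in> cls g" for g'
    proof -
      have g': "arr g'" "dm f = dm g'" "cd f = cd g'" using that eqvD[of g g'] assms by (auto simp: mem_cls)
      show ?thesis
        by (rule cls_eqI[OF eqv_add[OF f eqv_refl[OF g'(1)] g'(2,3)]])
    qed
    then show "(\<Union>g'\<in>cls g. cls (f' \<boxplus> g')) = (\<Union>g'\<in>cls g. cls (f \<boxplus> g'))" by simp
  qed
  also have "\<dots> = cls (f \<boxplus> g)"
  proof (rule UN_cls[OF assms(2)])
    fix g' assume g: "eqv g g'"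
    show "cls (f \<boxplus> g') = cls (f \<boxplus> g)"
      by (rule cls_eqI[OF eqv_add[OF eqv_refl[OF assms(1)] g assms(3,4)]])
  qed
  finally show ?thesis .
qed

lemma preadd_Q: "preadd Q"
proof
  have cat: "category Q"
    unfolding category_def
  proof (intro conjI ballI impI)
    fix A B A' B' assume o: "A \<in> Ob Q" "B \<in> Ob Q" "A' \<in> Ob Q" "B' \<in> Ob Q"
      and "Hom Q A B \<inter> Hom Q A' B' \<noteq> {}"
    then obtain f f' where f: "f \<in> Hom C A B" "f' \<in> Hom C A' B'" and "cls f = cls f'"
      unfolding Q_simps by blast
    then have "eqv f f'" using o cls_eq_iff[of f f'] by simp
    then show "A = A'" "B = B'" using eqvD(3,4) f o by auto
  qed auto
  have "comm_group (hom_group Q A B)" if "A \<in> U" "B \<in> U" for A B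
  proof (rule comm_groupI)
    have o: "A \<in> Ob C" "B \<in> Ob C" using that by auto
    fix F assume F: "F \<in> carrier (hom_group Q A B)"
    then obtain f where f: "arr f" "dm f = A" "cd f = B" "F = cls f" using o by (auto simp: hom_group_def)
    show "\<exists>H\<in>carrier (hom_group Q A B). H \<otimes>\<^bsub>hom_group Q A B\<^esub> F = \<one>\<^bsub>hom_group Q A B\<^esub>"
      using f o by (auto simp: hom_group_def intro!: bexI[of _ "ng f"])
  qed (use that in \<open>auto simp: hom_group_def add_assoc add_comm add_left_comm\<close>)
  moreover have "G \<cdot>\<^bsub>Q\<^esub> (F \<boxplus>\<^bsub>Q\<^esub> F') = G \<cdot>\<^bsub>Q\<^esub> F \<boxplus>\<^bsub>Q\<^esub> G \<cdot>\<^bsub>Q\<^esub> F' \<and>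
        (G \<boxplus>\<^bsub>Q\<^esub> G') \<cdot>\<^bsub>Q\<^esub> F = G \<cdot>\<^bsub>Q\<^esub> F \<boxplus>\<^bsub>Q\<^esub> G' \<cdot>\<^bsub>Q\<^esub> F"
    if "A \<in> U" "B \<in> U" "D \<in> U" "F \<in> Hom Q A B" "F' \<in> Hom Q A B" "G \<in> Hom Q B D" "G' \<in> Hom Q B D"
    for A B D F F' G G'
    using that by auto
  ultimately show "preadditive Q" unfolding preadditive_def using cat by simp
qed

lemma zero_object_Q:
  assumes "zero_object C Z" "Z \<in> U"
  shows "zero_object Q Z"
proof -
  interpret Q: preadd Q by (rule preadd_Q)
  show ?thesis using assms by (simp add: zob_iff Q.zob_iff zob_def Q.zob_def)
qed

lemma biproduct_Q:
  assumes "biproduct C A B P" "A \<in> U" "B \<in> U" "P \<in> U"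
  shows "biproduct Q A B P"
proof -
  have o: "A \<in> Ob C" "B \<in> Ob C" "P \<in> Ob C" using assms by auto
  obtain i j p q where h: "i\<in>Hom C A P" "j\<in>Hom C B P" "p\<in>Hom C P A" "q\<in>Hom C P B"
    "p \<cdot> i = Ide C A" "q \<cdot> j = Ide C B" "p \<cdot> j = Zer C B A" "q \<cdot> i = Zer C A B" "i \<cdot> p \<boxplus> j \<cdot> q = Ide C P"
    using assms(1) unfolding biproduct_def by blast
  then have t: "arr i" "dm i = A" "cd i = P" "arr j" "dm j = B" "cd j = P" "arr p" "dm p = P" "cd p = A"
    "arr q" "dm q = P" "cd q = B" using o by auto
  have "cls i \<in> Hom Q A P" "cls j \<in> Hom Q B P" "cls p \<in> Hom Q P A" "cls q \<in> Hom Q P B"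
    using h(1-4) by simp_all
  moreover have "cls p \<cdot>\<^bsub>Q\<^esub> cls i = Ide Q A \<and> cls q \<cdot>\<^bsub>Q\<^esub> cls j = Ide Q B \<and>
     cls p \<cdot>\<^bsub>Q\<^esub> cls j = Zer Q B A \<and> cls q \<cdot>\<^bsub>Q\<^esub> cls i = Zer Q A B \<and>
     cls i \<cdot>\<^bsub>Q\<^esub> cls p \<boxplus>\<^bsub>Q\<^esub> cls j \<cdot>\<^bsub>Q\<^esub> cls q = Ide Q P"
    using t by (simp add: h(5-9))
  moreover have "A \<in> Ob Q" "B \<in> Ob Q" "P \<in> Ob Q" using assms(2-4) by simp_all
  ultimately show ?thesis unfolding biproduct_def by blast
qed

lemma additive_Q: "additive Q"
proof -
  have "preadditive Q" using preadd_Q by (simp add: preadd_def)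
  moreover have "\<exists>Z. zero_object Q Z"
    using additive_U zero_object_Q unfolding additive_subcategory_def by blast
  moreover have "\<exists>P. biproduct Q A B P" if "A \<in> U" "B \<in> U" for A B
    using that biproducts[of A B] biproduct_Q[of A B] additive_U unfolding additive_subcategory_def
    by (metis U_Ob)
  ultimately show ?thesis by (simp add: additive_def)
qed

end

lemma add_triangles_simps:
  "Ob (add_triangles C F T) = Ob C" "Hom (add_triangles C F T) = Hom C" "Ide (add_triangles C F T) = Ide C"
  "Comp (add_triangles C F T) = Comp C" "Add (add_triangles C F T) = Add C" "Zer (add_triangles C F T) = Zer C"
  "Shift (add_triangles C F T) = F" "Dist (add_triangles C F T) = T"
  by (simp_all add: add_triangles_def)

lemma add_triangles_cong:
  "preadditive (add_triangles C F T) \<longleftrightarrow> preadditive C"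
  "additive (add_triangles C F T) \<longleftrightarrow> additive C"
  "candidate (add_triangles C F T) = candidate C"
  "tri_isomorphic (add_triangles C F T) = tri_isomorphic C"
proof -
  have c: "category (add_triangles C F T) \<longleftrightarrow> category C" by (simp add: category_def add_triangles_simps)
  have h: "hom_group (add_triangles C F T) = hom_group C" by (intro ext) (simp add: hom_group_def add_triangles_simps)
  show p: "preadditive (add_triangles C F T) \<longleftrightarrow> preadditive C" by (simp add: preadditive_def c h add_triangles_simps)
  show "additive (add_triangles C F T) \<longleftrightarrow> additive C"
    by (simp add: additive_def p zero_object_def biproduct_def add_triangles_simps)
  show d: "candidate (add_triangles C F T) = candidate C" by (intro ext) (simp add: candidate_def add_triangles_simps)
  show "tri_isomorphic (add_triangles C F T) = tri_isomorphic C"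
    by (intro ext) (simp add: tri_isomorphic_def d tri_mor_def iso_arrow_def add_triangles_simps)
qed

section \<open>The triangulated structure of a Frobenius subfactor\<close>

text \<open>The right triangles, with the functor \<open>F\<close> left open: only its values on \<open>U/X\<close> matter, and for
  the left triangles it is an \<open>Omega_functor\<close> of the opposite category.\<close>

definition right_triangles_for :: "('o, 'm, 'z) tcat_scheme \<Rightarrow> 'o set \<Rightarrow> ('o \<Rightarrow> ('o, 'm) tri) \<Rightarrow>
    ('o, 'm set, 'o, 'm set) func \<Rightarrow> 'o set \<Rightarrow> ('o, 'm set) tri set" where
  "right_triangles_for T X L F U = {t. \<exists>A\<in>U. \<exists>B\<in>U. \<exists>f\<in>Hom T A B. \<exists>C g k.
     Tri B C (Sigma_ob L A) g k (shift_map T f \<cdot>\<^bsub>T\<^esub> arr3 (L A)) \<in> Dist T \<and>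
     tri_isomorphic (subfactor T X U) F
       (Tri A B C (quot_class T X f) (quot_class T X g) (quot_class T X k)) t}"

text \<open>In terms of a triangle
  \<open>A \<rightarrow> Y \<rightarrow> D \<rightarrow> A[1]\<close> with last arrow
  \<open>d\<close>, \<open>mono_epi\<close> says: if all arrows \<open>A \<rightarrow> X\<close>
  extend to \<open>Y\<close>, then all arrows \<open>X \<rightarrow> D\<close> lift to
  \<open>Y\<close>. The vanishing of coghosts gives this. By \<open>enough\<close>, every object of
  \<open>U\<close> ends such a triangle with middle term in \<open>X\<close>; right approximations
  and the vanishing of ghosts give that. The formulation is one-sided so that the opposite category
  can be an instance.\<close>

locale right_frobenius = tri C for C :: "('o, 'm, 'z) tcat_scheme" (structure) +
  fixes X U :: "'o set" and L :: "'o \<Rightarrow> ('o, 'm) tri"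
  assumes additive_X: "additive_subcategory C X"
    and additive_U: "additive_subcategory C U"
    and XU: "X \<subseteq> U"
    and ext: "closed_under_extensions C U"
    and L: "left_approx_choice C X U L"
    and LU: "A \<in> U \<Longrightarrow> Sigma_ob L A \<in> U"
    and mono_epi: "\<lbrakk>A \<in> U; dm d \<in> U; arr d; cd d = shift_ob C A;
        \<And>w. \<lbrakk>arr w; dm w = A; cd w \<in> X\<rbrakk> \<Longrightarrow> shift_map C w \<cdot> d = Zer C (dm d) (shift_ob C (cd w));
        arr y; dm y \<in> X; cd y = dm d\<rbrakk> \<Longrightarrow> d \<cdot> y = Zer C (dm y) (cd d)"
    and enough: "A \<in> U \<Longrightarrow> \<exists>j q d. dt j q d \<and> cd q = A \<and> dm j \<in> U \<and> cd j \<in> X \<and>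
        (\<forall>w. arr w \<longrightarrow> dm w = dm j \<longrightarrow> cd w \<in> X \<longrightarrow> shift_map C w \<cdot> d = Zer C (dm d) (shift_ob C (cd w)))"
begin

sublocale subfactor_cat C X U
proof
  show "\<exists>P. biproduct C A B P" if "A \<in> Ob C" "B \<in> Ob C" for A B
    using additive_C that by (simp add: additive_def)
qed (rule additive_X additive_U)+

lemma XU' [simp]: "A \<in> X \<Longrightarrow> A \<in> U"
  using XU by blast

lemma ext_dt: "dt f g h \<Longrightarrow> dm f \<in> U \<Longrightarrow> cd g \<in> U \<Longrightarrow> cd f \<in> U"
  using ext unfolding closed_under_extensions_def dt_def by force

section \<open>Congruence modulo \<open>X\<close> tested by the arrows \<open>h\<close>\<close>

abbreviation \<Sigma> :: "'o \<Rightarrow> 'o" where "\<Sigma> A \<equiv> Sigma_ob L A"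
abbreviation i :: "'o \<Rightarrow> 'm" where "i A \<equiv> arr1 (L A)"
abbreviation p :: "'o \<Rightarrow> 'm" where "p A \<equiv> arr2 (L A)"
abbreviation h :: "'o \<Rightarrow> 'm" where "h A \<equiv> arr3 (L A)"

lemma L_dt:
  assumes "A \<in> U"
  shows "dt (i A) (p A) (h A)" "dm (i A) = A" "cd (i A) \<in> X" "cd (p A) = \<Sigma> A" "L A = Tri A (cd (i A)) (\<Sigma> A) (i A) (p A) (h A)"
proof -
  have d: "L A \<in> Dist C" "ob1 (L A) = A" "left_approx C X A (ob2 (L A)) (i A)"
    using L assms unfolding left_approx_choice_def by blast+
  obtain B D f g k where t: "L A = Tri A B D f g k" using d(2) by (cases "L A") auto
  show "dt (i A) (p A) (h A)" "dm (i A) = A" "cd (i A) \<in> X" "cd (p A) = \<Sigma> A" "L A = Tri A (cd (i A)) (\<Sigma> A) (i A) (p A) (h A)"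
    using d t by (auto simp: Dist_iff left_approx_def)
qed

lemma L_simps [simp]:
  assumes "A \<in> U"
  shows "arr (i A)" "arr (p A)" "arr (h A)" "dm (i A) = A" "cd (i A) \<in> X" "dm (p A) = cd (i A)" "cd (p A) = \<Sigma> A"
    "dm (h A) = \<Sigma> A" "cd (h A) = So A" "\<Sigma> A \<in> U"
  using dt_arr[OF L_dt(1)[OF assms]] L_dt[OF assms] LU[OF assms] by auto

lemma i_extend:
  assumes "A \<in> U" "arr w" "dm w = A" "cd w \<in> X"
  shows "\<exists>e. arr e \<and> dm e = cd (i A) \<and> cd e = cd w \<and> e \<cdot> i A = w"
proof -
  have "left_approx C X A (ob2 (L A)) (i A)" using L assms unfolding left_approx_choice_def by blast
  moreover have "ob2 (L A) = cd (i A)" using arg_cong[OF L_dt(5)[OF assms(1)], of ob2] by simp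
  ultimately have "(\<lambda>u. u \<cdot> i A) ` Hom C (cd (i A)) (cd w) = Hom C A (cd w)"
    using assms(4) unfolding left_approx_def by simp
  moreover have "w \<in> Hom C A (cd w)" using assms by simp
  ultimately obtain e where "e \<in> Hom C (cd (i A)) (cd w)" "e \<cdot> i A = w" by force
  then show ?thesis using assms by auto
qed

lemma i_extend_fac:
  assumes "A \<in> U" "fac w" "dm w = A"
  shows "\<exists>e. arr e \<and> dm e = cd (i A) \<and> cd e = cd w \<and> e \<cdot> i A = w"
proof -
  from assms(2) obtain a b where w: "arr a" "arr b" "dm b = cd a" "cd a \<in> X" "w = b \<cdot> a" by (rule facE)
  obtain e where e: "arr e" "dm e = cd (i A)" "cd e = cd a" "e \<cdot> i A = a"
    using i_extend[of A a] w assms by auto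
  show ?thesis using w e(1-3) assms(1) by (intro exI[of _ "b \<cdot> e"]) (simp add: e(4))
qed

text \<open>Arrows classifying the extensions of \<open>dm d\<close> by \<open>A\<close> along which
  every arrow from \<open>A\<close> to \<open>X\<close> extends, that is, the conflations of an
  exact structure relative to \<open>X\<close>. By \<open>E_lift\<close>, \<open>E_h\<close> and
  \<open>E_precomp\<close> they are the arrows from objects of \<open>U\<close> that factor through
  \<open>h A\<close>.\<close>

definition E :: "'o \<Rightarrow> 'm \<Rightarrow> bool" where
  "E A d \<longleftrightarrow> A \<in> U \<and> dm d \<in> U \<and> arr d \<and> cd d = So A \<and>
     (\<forall>w. arr w \<longrightarrow> dm w = A \<longrightarrow> cd w \<in> X \<longrightarrow> S w \<cdot> d = Zer C (dm d) (So (cd w)))"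

lemma ED: "E A d \<Longrightarrow> A \<in> U" "E A d \<Longrightarrow> dm d \<in> U" "E A d \<Longrightarrow> arr d" "E A d \<Longrightarrow> cd d = So A"
  by (auto simp: E_def)

lemma E_zero: "E A d \<Longrightarrow> arr w \<Longrightarrow> dm w = A \<Longrightarrow> cd w \<in> X \<Longrightarrow> S w \<cdot> d = Zer C (dm d) (So (cd w))"
  by (auto simp: E_def)

lemma E_epi: "E A d \<Longrightarrow> arr y \<Longrightarrow> dm y \<in> X \<Longrightarrow> cd y = dm d \<Longrightarrow> d \<cdot> y = Zer C (dm y) (So A)"
  using mono_epi[of A d y] by (auto simp: E_def)

lemma Sw_h:
  assumes "A \<in> U" "arr w" "dm w = A" "fac w"
  shows "S w \<cdot> h A = Zer C (\<Sigma> A) (So (cd w))"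
proof -
  obtain e where e: "arr e" "dm e = cd (i A)" "cd e = cd w" "e \<cdot> i A = w"
    using i_extend_fac[OF assms(1,4,3)] by blast
  have "S (e \<cdot> i A) \<cdot> h A = Zer C (\<Sigma> A) (So (cd w))"
    using e(1-3) assms(1) by (simp add: dt_zero(3)[OF L_dt(1)[OF assms(1)]])
  then show ?thesis unfolding e(4) .
qed

lemma E_h: "A \<in> U \<Longrightarrow> E A (h A)"
  unfolding E_def
proof (intro conjI allI impI)
  fix w assume A: "A \<in> U" and w: "arr w" "dm w = A" "cd w \<in> X"
  have "fac (Ide C (cd w) \<cdot> w)" by (rule facI) (use w in auto)
  then show "S w \<cdot> h A = Zer C (dm (h A)) (So (cd w))" using Sw_h[of A w] A w by simp
qed auto

text \<open>Any arrow from \<open>A\<close> into \<open>X\<close> extends along the approximation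
  \<open>i A\<close>, so factoring through \<open>X\<close> amounts to extending along
  \<open>i A\<close>; the obstruction to such an extension is
  \<open>S f \<cdot> h A\<close>.\<close>

lemma fac_iff_shift:
  assumes "arr f" "dm f \<in> U"
  shows "fac f \<longleftrightarrow> S f \<cdot> h (dm f) = Zer C (\<Sigma> (dm f)) (So (cd f))"
proof
  assume "fac f" then show "S f \<cdot> h (dm f) = Zer C (\<Sigma> (dm f)) (So (cd f))"
    using Sw_h[of "dm f" f] assms by simp
next
  let ?A = "dm f"
  assume z: "S f \<cdot> h ?A = Zer C (\<Sigma> ?A) (So (cd f))"
  note r = dt_rot[OF L_dt(1)[OF assms(2)]]
  obtain x where x: "arr x" "dm x = cd (ng (S (i ?A)))" "cd x = cd (S f)" "x \<cdot> ng (S (i ?A)) = S f"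
    using dt_colift(2)[OF r, of "S f"] z assms by auto
  have "dm x = So (cd (i ?A))" "cd x = So (cd f)" using x(2,3) assms by auto
  then obtain e where e: "arr e" "dm e = cd (i ?A)" "cd e = cd f" "x = S e"
    using full[of "cd (i ?A)" "cd f" x] x(1) assms by auto
  have "f = ng e \<cdot> i ?A"
    by (rule faithful) (use x(4) e assms in auto)
  moreover have "fac (ng e \<cdot> i ?A)" by (rule facI) (use e assms in auto)
  ultimately show "fac f" by simp
qed

lemma eqv_iff_shift:
  assumes "arr f" "arr g" "dm f \<in> U" "dm f = dm g" "cd f = cd g"
  shows "eqv f g \<longleftrightarrow> S f \<cdot> h (dm f) = S g \<cdot> h (dm f)"
proof -
  have "eqv f g \<longleftrightarrow> fac (f \<boxplus> ng g)" using assms by (simp add: eqv_def)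
  also have "\<dots> \<longleftrightarrow> S (f \<boxplus> ng g) \<cdot> h (dm f) = Zer C (\<Sigma> (dm f)) (So (cd f))"
    using fac_iff_shift[of "f \<boxplus> ng g"] assms by simp
  also have "S (f \<boxplus> ng g) \<cdot> h (dm f) = S f \<cdot> h (dm f) \<boxplus> ng (S g \<cdot> h (dm f))"
    using assms by simp
  also have "\<dots> = Zer C (\<Sigma> (dm f)) (So (cd f)) \<longleftrightarrow> S f \<cdot> h (dm f) = S g \<cdot> h (dm f)"
    by (rule diff_eq_Zer_iff) (use assms in auto)
  finally show ?thesis .
qed

text \<open>By \<open>E_epi\<close> the arrow \<open>h B\<close> kills whatever starts in
  \<open>X\<close>. Conversely, what it kills lifts through \<open>p B\<close>, whose source is in
  \<open>X\<close>.\<close>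

lemma fac_iff_h:
  assumes "B \<in> U" "arr s" "cd s = \<Sigma> B"
  shows "fac s \<longleftrightarrow> h B \<cdot> s = Zer C (dm s) (So B)"
proof
  assume "fac s"
  then obtain a b where s: "arr a" "arr b" "dm b = cd a" "cd a \<in> X" "s = b \<cdot> a" by (rule facE)
  have cb: "cd b = \<Sigma> B" using s(1-3) assms(3) unfolding s(5) by simp
  have hb: "h B \<cdot> b = Zer C (dm b) (So B)" by (rule E_epi[OF E_h]) (use s(1-4) assms(1) cb in auto)
  show "h B \<cdot> s = Zer C (dm s) (So B)"
    unfolding s(5) using s(1-4) assms(1) cb by (simp add: comp_rewrite[OF hb])
next
  assume z: "h B \<cdot> s = Zer C (dm s) (So B)"
  obtain x where x: "arr x" "dm x = dm s" "cd x = cd (i B)" "p B \<cdot> x = s"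
    using dt_lift(2)[OF L_dt(1)[OF assms(1)], of s] z assms by auto
  have "fac (p B \<cdot> x)" by (rule facI) (use x(1-3) assms in auto)
  then show "fac s" unfolding x(4) .
qed

lemma eqv_iff_h:
  assumes "B \<in> U" "arr s" "arr s'" "cd s = \<Sigma> B" "cd s' = \<Sigma> B" "dm s = dm s'"
  shows "eqv s s' \<longleftrightarrow> h B \<cdot> s = h B \<cdot> s'"
proof -
  have "eqv s s' \<longleftrightarrow> fac (s \<boxplus> ng s')" using assms by (simp add: eqv_def)
  also have "\<dots> \<longleftrightarrow> h B \<cdot> (s \<boxplus> ng s') = Zer C (dm s') (So B)"
    using fac_iff_h[of B "s \<boxplus> ng s'"] assms by simp
  also have "h B \<cdot> (s \<boxplus> ng s') = h B \<cdot> s \<boxplus> ng (h B \<cdot> s')" using assms by simp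
  also have "\<dots> = Zer C (dm s') (So B) \<longleftrightarrow> h B \<cdot> s = h B \<cdot> s'"
    by (rule diff_eq_Zer_iff) (use assms in auto)
  finally show ?thesis .
qed

text \<open>The approximation \<open>i B\<close> is one of the arrows to \<open>X\<close> whose
  shift must kill \<open>d\<close>, and \<open>h B\<close> is a weak kernel of that shift.\<close>

lemma E_lift:
  assumes "E B d"
  shows "\<exists>s. arr s \<and> dm s = dm d \<and> cd s = \<Sigma> B \<and> h B \<cdot> s = d"
proof -
  note e = ED[OF assms]
  have "S (i B) \<cdot> d = Zer C (dm d) (So (cd (i B)))" by (rule E_zero[OF assms]) (use e in auto)
  then show ?thesis using dt_lift(3)[OF L_dt(1)[OF e(1)], of d] e by auto
qed

text \<open>Push-out of the extension along \<open>f\<close>: an arrow from \<open>cd f\<close> to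
  \<open>X\<close> is tested on \<open>A\<close> after composing it with \<open>f\<close>.\<close>

lemma E_comp:
  assumes "E A d" "arr f" "dm f = A" "cd f \<in> U"
  shows "E (cd f) (S f \<cdot> d)"
  unfolding E_def
proof (intro conjI allI impI)
  note e = ED[OF assms(1)]
  fix w assume w: "arr w" "dm w = cd f" "cd w \<in> X"
  have "S (w \<cdot> f) \<cdot> d = Zer C (dm d) (So (cd (w \<cdot> f)))" by (rule E_zero[OF assms(1)]) (use w assms in auto)
  then show "S w \<cdot> (S f \<cdot> d) = Zer C (dm (S f \<cdot> d)) (So (cd w))" using w assms e by simp
qed (use ED[OF assms(1)] assms in auto)

lemma Sigma_ex:
  assumes "arr f" "dm f \<in> U" "cd f \<in> U"
  shows "\<exists>s. arr s \<and> dm s = \<Sigma> (dm f) \<and> cd s = \<Sigma> (cd f) \<and> h (cd f) \<cdot> s = S f \<cdot> h (dm f)"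
  using E_lift[OF E_comp[OF E_h assms(1)]] assms by auto

end

locale frobenius_functor = right_frobenius C X U L for C :: "('o, 'm, 'z) tcat_scheme" (structure) and X U L +
  fixes F :: "('o, 'm set, 'o, 'm set) func"
  assumes F_ob: "A \<in> U \<Longrightarrow> fob F A = Sigma_ob L A"
    and F_map: "\<lbrakk>arr f; dm f \<in> U; cd f \<in> U; arr s; dm s = Sigma_ob L (dm f); cd s = Sigma_ob L (cd f);
      arr3 (L (cd f)) \<cdot> s = shift_map C f \<cdot> arr3 (L (dm f))\<rbrakk> \<Longrightarrow> fmap F (quot_class C X f) = quot_class C X s"
begin

section \<open>The shift and the right triangles on \<open>U/X\<close>\<close>

abbreviation D :: "('o, 'm set) tcat" where
  "D \<equiv> add_triangles Q F (right_triangles_for C X L F U)"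

sublocale D: preadd D
proof
  show "preadditive D" unfolding add_triangles_cong using preadd_Q by (simp add: preadd_def)
qed

lemmas D_expand = add_triangles_simps Q_simps

lemma D_Ob [simp]: "A \<in> U \<Longrightarrow> A \<in> Ob D"
  by (simp add: D_expand)

lemma D_Ob_U [simp]: "D.arr G \<Longrightarrow> D.dm G \<in> U" "D.arr G \<Longrightarrow> D.cd G \<in> U"
  using D.arr_Ob by (simp_all add: D_expand)

lemma D_hom_cls: "\<lbrakk>arr f; dm f \<in> U; cd f \<in> U\<rbrakk> \<Longrightarrow> cls f \<in> Hom D (dm f) (cd f)"
  by (simp add: D_expand)

lemma D_cls [simp]:
  assumes "arr f" "dm f \<in> U" "cd f \<in> U"
  shows "D.arr (cls f)" "D.dm (cls f) = dm f" "D.cd (cls f) = cd f"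
  using D.Hom_iff[of "dm f" "cd f" "cls f"] assms D_hom_cls[OF assms] by (auto simp del: D.Hom_iff)

lemma D_arrE:
  assumes "D.arr G"
  obtains f where "arr f" "dm f \<in> U" "cd f \<in> U" "G = cls f" "D.dm G = dm f" "D.cd G = cd f"
proof -
  have o: "D.dm G \<in> U" "D.cd G \<in> U" "G \<in> Hom D (D.dm G) (D.cd G)" using D.arrE[OF assms] assms by simp_all
  then obtain f where f: "f \<in> Hom C (D.dm G) (D.cd G)" "G = cls f"
    unfolding D_expand by blast
  have "arr f" "dm f = D.dm G" "cd f = D.cd G" using f(1) U_Ob[OF o(1)] U_Ob[OF o(2)] by (simp_all only: Hom_iff)
  then show ?thesis using that[of f] o(1,2) f(2) by metis
qed

lemma D_comp [simp]: "arr f \<Longrightarrow> arr g \<Longrightarrow> dm g = cd f \<Longrightarrow> cls g \<cdot>\<^bsub>D\<^esub> cls f = cls (g \<cdot> f)"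
  by (simp add: D_expand)

lemma D_add [simp]: "arr f \<Longrightarrow> arr g \<Longrightarrow> dm f = dm g \<Longrightarrow> cd f = cd g \<Longrightarrow> cls f \<boxplus>\<^bsub>D\<^esub> cls g = cls (f \<boxplus> g)"
  by (simp add: D_expand)

lemma D_Ide: "Ide D A = cls (Ide C A)" and D_Zer: "Zer D A B = cls (Zer C A B)"
  by (simp_all add: D_expand)

lemma D_ng [simp]:
  assumes "arr f" "dm f \<in> U" "cd f \<in> U"
  shows "D.ng (cls f) = cls (ng f)"
proof -
  have "cls f \<boxplus>\<^bsub>D\<^esub> cls (ng f) = Zer D (D.dm (cls (ng f))) (D.cd (cls (ng f))) \<longleftrightarrow> cls (ng f) = D.ng (cls f)"
    by (rule D.add_eq_Zer) (use assms in auto)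
  then show ?thesis using assms by (simp add: D_Zer)
qed

lemma D_eq: "arr f \<Longrightarrow> cls f = cls g \<longleftrightarrow> eqv f g"
  by (rule cls_eq_iff)

lemma D_isomI:
  assumes "arr f" "arr g" "dm f \<in> U" "cd f \<in> U" "dm g = cd f" "cd g = dm f"
    "eqv (g \<cdot> f) (Ide C (dm f))" "eqv (f \<cdot> g) (Ide C (cd f))"
  shows "D.isom (cls f)"
  by (rule D.isomI[of _ "cls g"]) (use assms in \<open>auto simp: D_eq D_Ide\<close>)

text \<open>The relation between \<open>f\<close> and \<open>s\<close> in \<open>F_map\<close>
  respects identities, composites and sums, so functoriality and additivity of \<open>F\<close> are
  read off from it.\<close>

sublocale D: shifted D
proof
  have a: "D.arr (fmap F G) \<and> D.dm (fmap F G) = fob F (D.dm G) \<and> D.cd (fmap F G) = fob F (D.cd G)" if G: "D.arr G" for G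
  proof -
    from G obtain f where f: "arr f" "dm f \<in> U" "cd f \<in> U" "G = cls f" "D.dm G = dm f" "D.cd G = cd f" by (rule D_arrE)
    obtain s where s: "arr s" "dm s = \<Sigma> (dm f)" "cd s = \<Sigma> (cd f)" "h (cd f) \<cdot> s = S f \<cdot> h (dm f)"
      using Sigma_ex[OF f(1-3)] by blast
    show ?thesis unfolding f(5,6) using f(1-3) s(1-3) by (simp add: f(4) F_map[OF f(1-3) s] F_ob)
  qed
  have c: "fmap F (G \<cdot>\<^bsub>D\<^esub> H) = fmap F G \<cdot>\<^bsub>D\<^esub> fmap F H" if GH: "D.arr G" "D.arr H" "D.dm G = D.cd H" for G H
  proof -
    from GH(1) obtain f where f: "arr f" "dm f \<in> U" "cd f \<in> U" "G = cls f" "D.dm G = dm f" "D.cd G = cd f" by (rule D_arrE)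
    from GH(2) obtain g where g: "arr g" "dm g \<in> U" "cd g \<in> U" "H = cls g" "D.dm H = dm g" "D.cd H = cd g" by (rule D_arrE)
    have fg: "dm f = cd g" using f g GH(3) by simp
    obtain s where s: "arr s" "dm s = \<Sigma> (dm f)" "cd s = \<Sigma> (cd f)" "h (cd f) \<cdot> s = S f \<cdot> h (dm f)"
      using Sigma_ex[OF f(1-3)] by blast
    obtain r where r: "arr r" "dm r = \<Sigma> (dm g)" "cd r = \<Sigma> (cd g)" "h (cd g) \<cdot> r = S g \<cdot> h (dm g)"
      using Sigma_ex[OF g(1-3)] by blast
    have "fmap F (cls (f \<cdot> g)) = cls (s \<cdot> r)"
    proof (rule F_map)
      show "h (cd (f \<cdot> g)) \<cdot> (s \<cdot> r) = S (f \<cdot> g) \<cdot> h (dm (f \<cdot> g))"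
        using f(1-3) g(1-3) s r fg by (simp add: comp_rewrite[OF s(4)])
    qed (use f(1-3) g(1-3) s(1-3) r(1-3) fg in auto)
    then show ?thesis unfolding f(4) g(4) F_map[OF f(1-3) s] F_map[OF g(1-3) r]
      using f(1-3) g(1-3) s(1-3) r(1-3) fg by simp
  qed
  have ad: "fmap F (G \<boxplus>\<^bsub>D\<^esub> H) = fmap F G \<boxplus>\<^bsub>D\<^esub> fmap F H" if GH: "D.arr G" "D.arr H" "D.dm G = D.dm H" "D.cd G = D.cd H" for G H
  proof -
    from GH(1) obtain f where f: "arr f" "dm f \<in> U" "cd f \<in> U" "G = cls f" "D.dm G = dm f" "D.cd G = cd f" by (rule D_arrE)
    from GH(2) obtain g where g: "arr g" "dm g \<in> U" "cd g \<in> U" "H = cls g" "D.dm H = dm g" "D.cd H = cd g" by (rule D_arrE)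
    have fg: "dm f = dm g" "cd f = cd g" using f g GH(3,4) by auto
    obtain s where s: "arr s" "dm s = \<Sigma> (dm f)" "cd s = \<Sigma> (cd f)" "h (cd f) \<cdot> s = S f \<cdot> h (dm f)"
      using Sigma_ex[OF f(1-3)] by blast
    obtain r where r: "arr r" "dm r = \<Sigma> (dm g)" "cd r = \<Sigma> (cd g)" "h (cd g) \<cdot> r = S g \<cdot> h (dm g)"
      using Sigma_ex[OF g(1-3)] by blast
    have "fmap F (cls (f \<boxplus> g)) = cls (s \<boxplus> r)"
    proof (rule F_map)
      have "h (cd g) \<cdot> s = S f \<cdot> h (dm g)" using s(4) fg by simp
      then show "h (cd (f \<boxplus> g)) \<cdot> (s \<boxplus> r) = S (f \<boxplus> g) \<cdot> h (dm (f \<boxplus> g))"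
        using f(1-3) g(1-3) s(1-3) r fg by simp
    qed (use f(1-3) g(1-3) s(1-3) r(1-3) fg in auto)
    then show ?thesis unfolding f(4) g(4) F_map[OF f(1-3) s] F_map[OF g(1-3) r]
      using f(1-3) g(1-3) s(1-3) r(1-3) fg by simp
  qed
  have "fmap F (Ide D A) = Ide D (fob F A)" if "A \<in> U" for A
  proof -
    have "fmap F (cls (Ide C A)) = cls (Ide C (\<Sigma> A))" by (rule F_map) (use that in auto)
    then show ?thesis using that by (simp add: F_ob D_Ide)
  qed
  then have "is_functor D D F" unfolding D.functor_iff using a c by (auto simp: F_ob add_triangles_simps(1))
  moreover have "\<forall>A\<in>Ob D. \<forall>B\<in>Ob D. \<forall>G\<in>Hom D A B. \<forall>H\<in>Hom D A B. fmap F (G \<boxplus>\<^bsub>D\<^esub> H) = fmap F G \<boxplus>\<^bsub>D\<^esub> fmap F H"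
  proof (intro ballI)
    fix A B G H assume "A \<in> Ob D" "B \<in> Ob D" "G \<in> Hom D A B" "H \<in> Hom D A B"
    then show "fmap F (G \<boxplus>\<^bsub>D\<^esub> H) = fmap F G \<boxplus>\<^bsub>D\<^esub> fmap F H"
      by (intro ad) simp_all
  qed
  ultimately show "additive_functor D D (Shift D)"
    unfolding additive_functor_def by (simp only: add_triangles_simps)
  show "\<forall>t\<in>Dist D. candidate D (Shift D) t"
    by (auto simp: right_triangles_for_def tri_isomorphic_def add_triangles_cong add_triangles_simps(7,8))
qed

lemma D_S: "\<lbrakk>arr f; dm f \<in> U; cd f \<in> U; arr s; dm s = \<Sigma> (dm f); cd s = \<Sigma> (cd f); h (cd f) \<cdot> s = S f \<cdot> h (dm f)\<rbrakk>
    \<Longrightarrow> D.S (cls f) = cls s"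
  using F_map by (simp add: add_triangles_simps)

lemma D_So [simp]: "A \<in> U \<Longrightarrow> D.So A = \<Sigma> A"
  by (simp add: F_ob add_triangles_simps)

text \<open>The homotopy push-out of \<open>f\<close> along \<open>i (dm f)\<close>, in the rotated
  form of \<open>right_triangles\<close>. Extension closure puts its third object into
  \<open>U\<close>.\<close>

definition std :: "'m \<Rightarrow> 'm \<Rightarrow> 'm \<Rightarrow> bool" where
  "std f g k \<longleftrightarrow> arr f \<and> dm f \<in> U \<and> cd f \<in> U \<and> dm g = cd f \<and> dt g k (S f \<cdot> h (dm f))"

lemma std_arr:
  assumes "std f g k"
  shows "arr f" "arr g" "arr k" "dm f \<in> U" "cd f \<in> U" "dm g = cd f" "cd g \<in> U" "dm k = cd g" "cd k = \<Sigma> (dm f)"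
    "dt g k (S f \<cdot> h (dm f))"
proof -
  show f: "arr f" "dm f \<in> U" "cd f \<in> U" "dm g = cd f" "dt g k (S f \<cdot> h (dm f))"
    using assms by (auto simp: std_def)
  note t = dt_arr[OF f(5)]
  show "arr g" "arr k" "dm k = cd g" using t by auto
  show k: "cd k = \<Sigma> (dm f)" using t(5) f(1-3) by simp
  show "cd g \<in> U" by (rule ext_dt[OF f(5)]) (use f k in auto)
qed

lemma std_ex:
  assumes "arr f" "dm f \<in> U" "cd f \<in> U"
  shows "\<exists>g k. std f g k"
  using dt_ex_thd[of "S f \<cdot> h (dm f)" "cd f"] assms by (auto simp: std_def)

lemma std_cnd: "std f g k \<Longrightarrow> D.cnd (cls f) (cls g) (cls k)"
  using std_arr[of f g k] by (auto simp: D.cnd_def)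

lemma D_dt_iff: "D.dt G H K \<longleftrightarrow> D.cnd G H K \<and> (\<exists>f g k a b c. std f g k \<and>
    D.tmor (cls f) (cls g) (cls k) G H K a b c \<and> D.isom a \<and> D.isom b \<and> D.isom c)" (is "?l \<longleftrightarrow> ?r")
proof
  have iso: "tri_isomorphic Q F = tri_isomorphic D (Shift D)"
    by (simp add: add_triangles_cong add_triangles_simps)
  have mem: "t \<in> right_triangles_for C X L F U \<longleftrightarrow> (\<exists>A\<in>U. \<exists>B\<in>U. \<exists>f\<in>Hom C A B. \<exists>C' g k.
     Tri B C' (\<Sigma> A) g k (S f \<cdot> h A) \<in> Dist C \<and>
     tri_isomorphic D (Shift D) (Tri A B C' (cls f) (cls g) (cls k)) t)" for t
    unfolding iso[symmetric] by (simp only: right_triangles_for_def mem_Collect_eq)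
  {
    assume ?l
    then have "Tri (D.dm G) (D.cd G) (D.cd H) G H K \<in> right_triangles_for C X L F U"
      unfolding D.dt_def add_triangles_simps .
    then obtain A B f C' g k where t: "A \<in> U" "B \<in> U" "f \<in> Hom C A B" "Tri B C' (\<Sigma> A) g k (S f \<cdot> h A) \<in> Dist C"
      and i: "tri_isomorphic D (Shift D) (Tri A B C' (cls f) (cls g) (cls k)) (Tri (D.dm G) (D.cd G) (D.cd H) G H K)"
      unfolding mem by blast
    have f: "arr f" "dm f = A" "cd f = B" using t(1-3) by simp_all
    have "dt g k (S f \<cdot> h A)" "dm g = B" using t(4)[unfolded Dist_iff] by simp_all
    then have "std f g k" unfolding std_def f(2,3) using t(1,2) f(1) by blast
    then show ?r using i unfolding D.tri_isomorphic_iff by blast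
  }
  {
    assume ?r
    then obtain f g k a b c where c: "D.cnd G H K" and s: "std f g k"
      and m: "D.tmor (cls f) (cls g) (cls k) G H K a b c" "D.isom a" "D.isom b" "D.isom c" by blast
    note t = std_arr[OF s]
    have "tri_isomorphic D (Shift D) (Tri (dm f) (cd f) (cd g) (cls f) (cls g) (cls k)) (Tri (D.dm G) (D.cd G) (D.cd H) G H K)"
      unfolding D.tri_isomorphic_iff using c m std_cnd[OF s] t by auto
    moreover have "f \<in> Hom C (dm f) (cd f)" "Tri (cd f) (cd g) (\<Sigma> (dm f)) g k (S f \<cdot> h (dm f)) \<in> Dist C"
      using t by (auto simp: Dist_iff)
    ultimately have "Tri (D.dm G) (D.cd G) (D.cd H) G H K \<in> right_triangles_for C X L F U"
      unfolding mem using t by blast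
    then show ?l unfolding D.dt_def add_triangles_simps .
  }
qed

lemma D_dt_iso:
  assumes "D.dt G H K" "D.cnd G' H' K'" "D.tmor G H K G' H' K' a b c" "D.isom a" "D.isom b" "D.isom c"
  shows "D.dt G' H' K'"
proof -
  obtain f g k a' b' c' where s: "std f g k" "D.tmor (cls f) (cls g) (cls k) G H K a' b' c'" "D.isom a'" "D.isom b'" "D.isom c'"
    using assms(1) D_dt_iff by blast
  have "D.tmor (cls f) (cls g) (cls k) G' H' K' (a \<cdot>\<^bsub>D\<^esub> a') (b \<cdot>\<^bsub>D\<^esub> b') (c \<cdot>\<^bsub>D\<^esub> c')"
    by (rule D.tmor_comp[OF s(2) assms(3) std_cnd[OF s(1)] D.dt_cnd[OF assms(1)] assms(2)])
  moreover have "D.isom (a \<cdot>\<^bsub>D\<^esub> a')" "D.isom (b \<cdot>\<^bsub>D\<^esub> b')" "D.isom (c \<cdot>\<^bsub>D\<^esub> c')"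
    using s assms unfolding D.tmor_def by (auto intro!: D.isom_comp)
  ultimately show ?thesis using D_dt_iff assms(2) s(1) by blast
qed

lemma std_dt:
  assumes "std f g k"
  shows "D.dt (cls f) (cls g) (cls k)"
proof -
  note t = std_arr[OF assms]
  have "D.tmor (cls f) (cls g) (cls k) (cls f) (cls g) (cls k) (Ide D (dm f)) (Ide D (cd f)) (Ide D (cd g))"
    using D.tmor_Ide[OF std_cnd[OF assms]] t by simp
  moreover have "D.isom (Ide D (dm f))" "D.isom (Ide D (cd f))" "D.isom (Ide D (cd g))" using t by simp_all
  ultimately show ?thesis using D_dt_iff std_cnd[OF assms] assms by blast
qed

text \<open>A triangle \<open>B \<rightarrow> Y \<rightarrow> Z \<rightarrow> B[1]\<close> whose last arrow factors through \<open>\<Sigma>B \<rightarrow> B[1]\<close> becomes a right triangle: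
  by the octahedral axiom the homotopy push-out of \<open>Y \<leftarrow> B \<rightarrow> X\<^sup>B\<close> is an extension of \<open>Z\<close> by \<open>X\<^sup>B\<close>, and it splits.\<close>

lemma conflation_dt:
  assumes d: "dt g k d" and E: "E (dm g) d" and Y: "cd g \<in> U"
    and s: "arr s" "dm s = dm d" "cd s = \<Sigma> (dm g)" "h (dm g) \<cdot> s = d"
  shows "D.dt (cls g) (cls k) (D.ng (cls s))"
proof -
  let ?B = "dm g"
  note e = ED[OF E] and tg = dt_arr[OF d]
  note lB = L_dt(1)[OF e(1)]
  obtain g' k' where st: "std g g' k'" using std_ex[of g] tg e Y by auto
  note t = std_arr[OF st]
  have 1: "dt (h ?B) (ng (S (i ?B))) (ng (S (p ?B)))" by (rule dt_rot[OF dt_rot[OF lB]])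
  have 2: "dt (S g) (ng (S k)) (S d)" using dt_sign(2)[OF dt_rot3[OF d]] tg by simp
  have 3: "dt (S g \<cdot> h ?B) (ng (S g')) (ng (S k'))" by (rule dt_rot[OF dt_rot[OF t(10)]])
  have 4: "dm (S g) = cd (h ?B)" using tg e by simp
  \<comment> \<open>The octahedron on \<open>S g\<close> after \<open>h B\<close>. Up to sign and
    shift its cones are \<open>cd (i B)\<close>, \<open>dm d\<close> and the push-out
    \<open>cd g'\<close>.\<close>
  obtain u v where uv: "dt u v (S (ng (S (i ?B))) \<cdot> S d)" and ty: "arr u" "arr v" "dm u = cd (ng (S (i ?B)))"
    "cd u = cd (ng (S g'))" "dm v = cd (ng (S g'))" "cd v = cd (ng (S k))"
    and eq: "u \<cdot> ng (S (i ?B)) = ng (S g') \<cdot> S g" "ng (S k') \<cdot> u = ng (S (p ?B))" "v \<cdot> ng (S g') = ng (S k)"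
      "S d \<cdot> v = S (h ?B) \<cdot> ng (S k')"
    by (rule octahedron[OF 1 2 3 4])
  have ty': "dm u = So (cd (i ?B))" "cd u = So (cd g')" "dm v = So (cd g')" "cd v = So (dm d)"
    using ty tg t e by simp_all
  obtain m where m: "arr m" "dm m = cd g'" "cd m = dm d" "v = S m"
    using full[of "cd g'" "dm d" v] ty(2) ty' t e by auto
  obtain u0 where u0: "arr u0" "dm u0 = cd (i ?B)" "cd u0 = cd g'" "u = S u0"
    using full[of "cd (i ?B)" "cd g'" u] ty(1) ty' t e by auto
  have mg: "m \<cdot> g' = k"
  proof (rule faithful)
    show "S (m \<cdot> g') = S k" using eq(3) m t tg by (simp add: ng_inject)
  qed (use m(1-3) t tg in auto)
  have dm: "d \<cdot> m = ng (h ?B \<cdot> k')"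
  proof (rule faithful)
    show "S (d \<cdot> m) = S (ng (h ?B \<cdot> k'))" using eq(4) m t tg e by simp
  qed (use m(1-3) t tg e in auto)
  \<comment> \<open>This is where the condition on \<open>d\<close> enters: the connecting arrow of
    the new triangle vanishes, so \<open>m\<close> has a section \<open>n\<close>.\<close>
  have "S (i ?B) \<cdot> d = Zer C (dm d) (So (cd (i ?B)))" by (rule E_zero[OF E]) (use e in auto)
  then have "S (S (i ?B)) \<cdot> S d = S (Zer C (dm d) (So (cd (i ?B))))"
    by (rule shift_comp) (use e in auto)
  then have z: "S (ng (S (i ?B))) \<cdot> S d = Zer C (So (dm d)) (So (So (cd (i ?B))))" using e by simp
  note uv' = uv[unfolded z m(4) u0(4)]
  obtain x where x: "arr x" "dm x = So (dm d)" "cd x = So (cd g')" "S m \<cdot> x = Ide C (So (dm d))"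
    using dt_lift(2)[OF uv', of "Ide C (So (dm d))"] m(1-3) u0(1-3) e t by auto
  obtain n where n: "arr n" "dm n = dm d" "cd n = cd g'" "x = S n" using full[of "dm d" "cd g'" x] x e t by auto
  have mn: "m \<cdot> n = Ide C (dm d)"
    by (rule faithful) (use x(4) n m(1-3) e in auto)
  \<comment> \<open>The defect of \<open>n \<cdot> m\<close> from the identity is killed by
    \<open>m\<close>, hence lifts through \<open>u0\<close>, which starts in \<open>X\<close>. Thus
    \<open>n\<close> inverts \<open>m\<close> modulo \<open>X\<close>.\<close>
  let ?r = "n \<cdot> m \<boxplus> ng (Ide C (cd g'))"
  have r: "arr ?r" "dm ?r = cd g'" "cd ?r = cd g'" using n(1-3) m(1-3) t by auto
  have "m \<cdot> ?r = Zer C (cd g') (dm d)" using n(1-3) m(1-3) t e by (simp add: comp_rewrite[OF mn])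
  then have "S m \<cdot> S ?r = S (Zer C (cd g') (dm d))" by (rule shift_comp) (use r m(1-3) in auto)
  then have sz: "S m \<cdot> S ?r = Zer C (dm (S ?r)) (cd (S m))" using r m(1-3) e t by simp
  obtain y where y: "arr y" "dm y = dm (S ?r)" "cd y = dm (S u0)" "S u0 \<cdot> y = S ?r"
    using dt_lift(1)[OF uv', of "S ?r"] sz shift_simps(3)[OF r(1)] shift_simps(5)[OF r(1)] r(3) shift_simps(5)[OF u0(1)] u0(3)
    by metis
  obtain y0 where y0: "arr y0" "dm y0 = cd g'" "cd y0 = cd (i ?B)" "y = S y0"
    using full[of "cd g'" "cd (i ?B)" y] y(1-3) r u0(1-3) e t by auto
  have "u0 \<cdot> y0 = ?r"
    by (rule faithful) (use y(4) y0 u0(1-3) r in auto)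
  moreover have "fac (u0 \<cdot> y0)" by (rule facI) (use y0 u0 e in auto)
  ultimately have nm: "eqv (n \<cdot> m) (Ide C (dm m))" using n(1-3) m(1-3) t by (simp add: eqv_def)
  have im: "D.isom (cls m)"
    by (rule D_isomI[of m n]) (use m(1-3) n(1-3) t e mn nm eqv_refl in auto)
  \<comment> \<open>The octahedron gives \<open>d \<cdot> m = ng (h ?B \<cdot> k')\<close>; this is
    the origin of the sign on \<open>cls s\<close>.\<close>
  have "h ?B \<cdot> (ng s \<cdot> m) = ng (d \<cdot> m)" using s(1-3) m(1-3) e by (simp add: comp_rewrite[OF s(4)])
  also have "\<dots> = h ?B \<cdot> k'" unfolding dm using t e by simp
  finally have "eqv (ng s \<cdot> m) k'"
    by (subst eqv_iff_h[of ?B]) (use s(1-3) m(1-3) t e in auto)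
  then have sk: "cls (ng s \<cdot> m) = cls k'" using s(1-3) m(1-3) by (simp add: D_eq)
  have cn: "D.cnd (cls g) (cls k) (D.ng (cls s))"
    unfolding D.cnd_def using tg s(1-3) e Y by simp
  have "D.tmor (cls g) (cls g') (cls k') (cls g) (cls k) (D.ng (cls s)) (Ide D ?B) (Ide D (cd g)) (cls m)"
    unfolding D.tmor_def
  proof (intro conjI)
    show "cls m \<cdot>\<^bsub>D\<^esub> cls g' = cls k \<cdot>\<^bsub>D\<^esub> Ide D (cd g)"
      using m(1-3) t tg e Y by (simp add: mg)
    show "D.S (Ide D ?B) \<cdot>\<^bsub>D\<^esub> cls k' = D.ng (cls s) \<cdot>\<^bsub>D\<^esub> cls m"
      using m(1-3) t e s(1-3) sk by simp
  qed (use m(1-3) t tg e Y in auto)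
  then show ?thesis
    by (rule D_dt_iso[OF std_dt[OF st] cn]) (use im e Y in auto)
qed

section \<open>Full faithfulness and density of the shift, and TR1 to TR3\<close>

lemma Sigma_arr:
  assumes "D.arr G"
  obtains f s where "arr f" "dm f \<in> U" "cd f \<in> U" "G = cls f" "D.dm G = dm f" "D.cd G = cd f"
    "arr s" "dm s = \<Sigma> (dm f)" "cd s = \<Sigma> (cd f)" "h (cd f) \<cdot> s = S f \<cdot> h (dm f)" "D.S G = cls s"
proof -
  from assms obtain f where f: "arr f" "dm f \<in> U" "cd f \<in> U" "G = cls f" "D.dm G = dm f" "D.cd G = cd f"
    by (rule D_arrE)
  obtain s where s: "arr s" "dm s = \<Sigma> (dm f)" "cd s = \<Sigma> (cd f)" "h (cd f) \<cdot> s = S f \<cdot> h (dm f)"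
    using Sigma_ex[OF f(1-3)] by blast
  show ?thesis using that[OF f s] D_S[OF f(1-3) s] f(4) by simp
qed

lemma D_faithful:
  assumes "D.arr G" "D.arr H" "D.dm G = D.dm H" "D.cd G = D.cd H" "D.S G = D.S H"
  shows "G = H"
proof -
  from assms(1) obtain f s where f: "arr f" "dm f \<in> U" "cd f \<in> U" "G = cls f" "D.dm G = dm f" "D.cd G = cd f"
    and s: "arr s" "dm s = \<Sigma> (dm f)" "cd s = \<Sigma> (cd f)" "h (cd f) \<cdot> s = S f \<cdot> h (dm f)" "D.S G = cls s"
    by (rule Sigma_arr)
  from assms(2) obtain g r where g: "arr g" "dm g \<in> U" "cd g \<in> U" "H = cls g" "D.dm H = dm g" "D.cd H = cd g"
    and r: "arr r" "dm r = \<Sigma> (dm g)" "cd r = \<Sigma> (cd g)" "h (cd g) \<cdot> r = S g \<cdot> h (dm g)" "D.S H = cls r"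
    by (rule Sigma_arr)
  have fg: "dm f = dm g" "cd f = cd g" using f(5,6) g(5,6) assms(3,4) by simp_all
  have "eqv s r" using s(1,5) r(5) assms(5) D_eq[of s r] by simp
  moreover have "eqv s r \<longleftrightarrow> h (cd f) \<cdot> s = h (cd f) \<cdot> r"
    by (rule eqv_iff_h) (use f(1-3) s(1-3) r(1-3) fg in auto)
  ultimately have "S f \<cdot> h (dm f) = S g \<cdot> h (dm f)" using s(4) r(4) fg by simp
  then have "eqv f g" using eqv_iff_shift[OF f(1) g(1) f(2) fg] by simp
  then show ?thesis using f(1,4) g(4) D_eq by simp
qed

text \<open>For \<open>s\<close> from \<open>\<Sigma> A\<close> to \<open>\<Sigma> B\<close>, the
  composite \<open>h B \<cdot> s \<cdot> p A\<close> vanishes because \<open>p A\<close> starts in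
  \<open>X\<close>. So \<open>h B \<cdot> s\<close> extends along \<open>h A\<close>, and the
  extension is the shift of a preimage.\<close>

lemma D_full:
  assumes "A \<in> U" "B \<in> U" "D.arr H" "D.dm H = \<Sigma> A" "D.cd H = \<Sigma> B"
  shows "\<exists>f. D.arr f \<and> D.dm f = A \<and> D.cd f = B \<and> D.S f = H"
proof -
  from assms(3) obtain s where s: "arr s" "H = cls s" "D.dm H = dm s" "D.cd H = cd s" by (rule D_arrE)
  have ty: "dm s = \<Sigma> A" "cd s = \<Sigma> B" using s(3,4) assms(4,5) by simp_all
  have "h B \<cdot> (s \<cdot> p A) = Zer C (dm (s \<cdot> p A)) (So B)"
    by (rule E_epi[OF E_h]) (use assms(1,2) s(1) ty in auto)
  then have z: "(h B \<cdot> s) \<cdot> p A = Zer C (dm (p A)) (cd (h B \<cdot> s))" using assms(1,2) s(1) ty by simp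
  obtain x where x: "arr x" "dm x = So A" "cd x = So B" "x \<cdot> h A = h B \<cdot> s"
    using dt_colift(2)[OF L_dt(1)[OF assms(1)], of "h B \<cdot> s"] z assms(1,2) s(1) ty by auto
  obtain f where f: "arr f" "dm f = A" "cd f = B" "x = S f" using full[of A B x] x assms(1,2) by auto
  have "D.S (cls f) = cls s" by (rule D_S) (use f assms(1,2) s(1) ty x(4) in auto)
  then show ?thesis using f assms(1,2) s(2) by (intro exI[of _ "cls f"]) simp
qed

text \<open>The triangle from \<open>enough\<close> is compared with the chosen triangle of its
  first object \<open>B\<close>: \<open>d\<close> lifts to an arrow \<open>s\<close> from
  \<open>A\<close> to \<open>\<Sigma> B\<close>, and \<open>h B\<close> lifts to \<open>x\<close> in
  the other direction because \<open>j\<close> ends in \<open>X\<close>. The two are inverse modulo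
  \<open>X\<close>.\<close>

lemma D_dense:
  assumes "A \<in> U"
  shows "\<exists>B e. B \<in> U \<and> D.isom e \<and> D.dm e = \<Sigma> B \<and> D.cd e = A"
proof -
  obtain j q d where d: "dt j q d" "cd q = A" "dm j \<in> U" "cd j \<in> X"
    and w: "\<And>w. arr w \<Longrightarrow> dm w = dm j \<Longrightarrow> cd w \<in> X \<Longrightarrow> S w \<cdot> d = Zer C (dm d) (So (cd w))"
    using enough[OF assms] by blast
  let ?B = "dm j"
  note t = dt_arr[OF d(1)]
  have "E ?B d" unfolding E_def using w d t assms by simp
  then obtain s where s: "arr s" "dm s = dm d" "cd s = \<Sigma> ?B" "h ?B \<cdot> s = d" using E_lift by blast
  have "fac (Ide C (cd j) \<cdot> j)" by (rule facI) (use d t in auto)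
  then have "fac j" using t by simp
  then have "S j \<cdot> h ?B = Zer C (dm (h ?B)) (So (cd j))" using fac_iff_shift[of j] t d by simp
  then obtain x where x: "arr x" "dm x = dm (h ?B)" "cd x = cd q" "d \<cdot> x = h ?B"
    using dt_lift(3)[OF d(1), of "h ?B"] d by auto
  have ty: "dm x = \<Sigma> ?B" "cd x = A" "dm s = A" using x(2,3) s(2) d t by simp_all
  have "eqv (s \<cdot> x) (Ide C (dm x))"
    by (subst eqv_iff_h[of ?B]) (use x(1,4) s(1,3) ty d(3) comp_rewrite[OF s(4)] t(3) in auto)
  \<comment> \<open>\<open>d\<close> kills the difference from the identity, which therefore lifts
    through \<open>q\<close> and so factors through \<open>cd j\<close> in \<open>X\<close>.\<close>
  moreover have "eqv (x \<cdot> s) (Ide C (cd x))"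
  proof -
    let ?r = "x \<cdot> s \<boxplus> ng (Ide C A)"
    have r: "arr ?r" "dm ?r = A" "cd ?r = A" using x(1) s(1,3) ty assms by simp_all
    have "d \<cdot> ?r = Zer C (dm ?r) (cd d)"
      using x(1) s(1,3) ty assms d(2,3) t r by (simp add: comp_rewrite[OF x(4)] s(4))
    then obtain y where y: "arr y" "dm y = dm ?r" "cd y = cd j" "q \<cdot> y = ?r"
      using dt_lift(2)[OF d(1), of ?r] r d(2) by auto
    have "fac (q \<cdot> y)" by (rule facI) (use y(1-3) t d(4) in auto)
    then show ?thesis unfolding y(4) using x(1) s(1,3) ty assms by (simp add: eqv_def)
  qed
  ultimately have "D.isom (cls x)" by (intro D_isomI[of x s]) (use x(1) s(1,3) ty assms d in auto)
  then show ?thesis using x(1) ty d assms by (intro exI[of _ ?B] exI[of _ "cls x"]) simp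
qed

text \<open>The standard triangle on the identity of \<open>A\<close> is the chosen triangle of
  \<open>A\<close> itself, and its middle term, lying in \<open>X\<close>, is a zero object of
  \<open>U/X\<close>.\<close>

lemma D_dt_Ide:
  assumes "A \<in> U" "D.zob Z"
  shows "D.dt (Ide D A) (Zer D A Z) (Zer D Z (\<Sigma> A))"
proof -
  have Z: "Z \<in> U" using D.zobD(1)[OF assms(2)] by (simp add: D_expand)
  have st: "std (Ide C A) (i A) (p A)" using assms L_dt(1)[OF assms(1)] by (simp add: std_def)
  note t = std_arr[OF st]
  let ?Y = "cd (i A)"
  have "fac (Ide C ?Y \<cdot> Ide C ?Y)" by (rule facI) (use assms in auto)
  then have "cls (Ide C ?Y) = cls (Zer C ?Y ?Y)" using cls_eq_zero_iff[of "Ide C ?Y"] assms by simp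
  then have Y: "D.zob ?Y" unfolding D.zob_def D_Ide D_Zer using assms by simp
  note YZ = D.zobD(2)[OF Y] D.zobD(3)[OF assms(2)] D.zobD(3)[OF Y] D.zobD(2)[OF assms(2)]
  have iso: "D.isom (Zer D ?Y Z)"
    by (rule D.isomI[of _ "Zer D Z ?Y"]) (use assms Z Y in \<open>auto simp: D.zob_def\<close>)
  have cn: "D.cnd (Ide D A) (Zer D A Z) (Zer D Z (\<Sigma> A))" unfolding D.cnd_def using assms Z by simp
  have "D.tmor (cls (Ide C A)) (cls (i A)) (cls (p A)) (Ide D A) (Zer D A Z) (Zer D Z (\<Sigma> A)) (Ide D A) (Ide D A) (Zer D ?Y Z)"
    unfolding D.tmor_def
  proof (intro conjI)
    show "Zer D ?Y Z \<cdot>\<^bsub>D\<^esub> cls (i A) = Zer D A Z \<cdot>\<^bsub>D\<^esub> Ide D A" using assms Z t by simp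
    have "cls (p A) = Zer D ?Y (\<Sigma> A)" using YZ(1)[of "cls (p A)"] assms t by simp
    then show "D.S (Ide D A) \<cdot>\<^bsub>D\<^esub> cls (p A) = Zer D Z (\<Sigma> A) \<cdot>\<^bsub>D\<^esub> Zer D ?Y Z" using assms Z t by simp
  qed (use assms Z t in \<open>auto simp: D_Ide[symmetric]\<close>)
  then show ?thesis
    by (rule D_dt_iso[OF std_dt[OF st] cn]) (use iso assms in auto)
qed

text \<open>A standard triangle comes from an ambient triangle whose last arrow
  \<open>S f \<cdot> h (dm f)\<close> classifies a conflation. \<open>conflation_dt\<close> turns
  that triangle into the rotated one, including the sign.\<close>

lemma D_dt_rot:
  assumes "D.dt G H K"
  shows "D.dt H K (D.ng (D.S G))"
proof -
  obtain f g k a b c where st: "std f g k" and m: "D.tmor (cls f) (cls g) (cls k) G H K a b c" "D.isom a" "D.isom b" "D.isom c"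
    using assms D_dt_iff by blast
  note t = std_arr[OF st] and tG = D.dt_arr[OF assms]
  obtain s where s: "arr s" "dm s = \<Sigma> (dm f)" "cd s = \<Sigma> (cd f)" "h (cd f) \<cdot> s = S f \<cdot> h (dm f)"
    using Sigma_ex[of f] t by blast
  have "D.dt (cls g) (cls k) (D.ng (cls s))"
  proof (rule conflation_dt[OF t(10)])
    show "E (dm g) (S f \<cdot> h (dm f))" using E_comp[OF E_h[OF t(4)] t(1)] t by simp
  qed (use s t in auto)
  moreover have "D.S (cls f) = cls s" by (rule D_S) (use s t in auto)
  ultimately have d: "D.dt (cls g) (cls k) (D.ng (D.S (cls f)))" by simp
  have "D.tmor (cls g) (cls k) (D.ng (D.S (cls f))) H K (D.ng (D.S G)) b c (D.S a)"
    by (rule D.tmor_rot[OF m(1) std_cnd[OF st] D.dt_cnd[OF assms]])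
  then show ?thesis
    by (rule D_dt_iso[OF d, rotated]) (use m(2-4) tG D.shift_isom in \<open>auto simp: D.cnd_def\<close>)
qed

text \<open>By \<open>eqv_iff_shift\<close> a square commuting modulo \<open>X\<close> becomes an
  honest equation between the last arrows of the two ambient triangles, so the fill-in exists
  already there.\<close>

lemma std_fill:
  assumes st: "std f g k" and st': "std f' g' k'"
    and A: "D.arr A" "D.dm A = dm f" "D.cd A = dm f'" and B: "D.arr B" "D.dm B = cd f" "D.cd B = cd f'"
    and sq: "B \<cdot>\<^bsub>D\<^esub> cls f = cls f' \<cdot>\<^bsub>D\<^esub> A"
  shows "\<exists>c. D.tmor (cls f) (cls g) (cls k) (cls f') (cls g') (cls k') A B c"
proof -
  note t = std_arr[OF st] and t' = std_arr[OF st']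
  from A(1) obtain a s where a: "arr a" "dm a \<in> U" "cd a \<in> U" "A = cls a" "D.dm A = dm a" "D.cd A = cd a"
    and s: "arr s" "dm s = \<Sigma> (dm a)" "cd s = \<Sigma> (cd a)" "h (cd a) \<cdot> s = S a \<cdot> h (dm a)" "D.S A = cls s"
    by (rule Sigma_arr)
  from B(1) obtain b where b: "arr b" "B = cls b" "D.dm B = dm b" "D.cd B = cd b" by (rule D_arrE)
  have ty: "dm a = dm f" "cd a = dm f'" "dm b = cd f" "cd b = cd f'" using a(5,6) b(3,4) A B by simp_all
  have "cls (b \<cdot> f) = cls (f' \<cdot> a)" using sq a(1,4) b(1,2) ty t t' by simp
  then have "eqv (b \<cdot> f) (f' \<cdot> a)" using b(1) t ty by (simp add: D_eq)
  moreover have "eqv (b \<cdot> f) (f' \<cdot> a) \<longleftrightarrow> S (b \<cdot> f) \<cdot> h (dm (b \<cdot> f)) = S (f' \<cdot> a) \<cdot> h (dm (b \<cdot> f))"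
    by (rule eqv_iff_shift) (use a(1) b(1) ty t t' in auto)
  ultimately have "S (b \<cdot> f) \<cdot> h (dm f) = S (f' \<cdot> a) \<cdot> h (dm f)" using a(1) b(1) ty t t' by simp
  also have "\<dots> = S f' \<cdot> (S a \<cdot> h (dm a))" using a(1) ty t t' by simp
  also have "\<dots> = (S f' \<cdot> h (dm f')) \<cdot> s"
    unfolding s(4)[symmetric] using a(1) ty t t' s(1-3) by simp
  finally have "S b \<cdot> (S f \<cdot> h (dm f)) = (S f' \<cdot> h (dm f')) \<cdot> s" using b(1) ty t by simp
  then have "\<exists>c. tmor g k (S f \<cdot> h (dm f)) g' k' (S f' \<cdot> h (dm f')) b c s"
    by (intro dt_fill_snd[OF t(10) t'(10)]) (use a(1) b(1) s(1-3) ty t t' in auto)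
  then obtain c where c: "arr c" "dm c = cd g" "cd c = cd g'" "c \<cdot> g = g' \<cdot> b" "s \<cdot> k = k' \<cdot> c"
    unfolding tmor_def by blast
  have "D.tmor (cls f) (cls g) (cls k) (cls f') (cls g') (cls k') A B (cls c)"
    unfolding D.tmor_def
  proof (intro conjI)
    show "cls c \<cdot>\<^bsub>D\<^esub> cls g = cls g' \<cdot>\<^bsub>D\<^esub> B" using b(1,2) ty t t' c by simp
    show "D.S A \<cdot>\<^bsub>D\<^esub> cls k = cls k' \<cdot>\<^bsub>D\<^esub> cls c" unfolding s(5) using s(1-3) ty t t' c by simp
  qed (use A B sq t t' c in auto)
  then show ?thesis by blast
qed

sublocale D: pretri D
proof
  show "\<exists>Z. D.zob Z"
    using additive_Q unfolding D.zob_iff[symmetric] add_triangles_cong(2)[of Q F "right_triangles_for C X L F U", symmetric]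
    by (simp add: additive_def)
  show "G = H" if "D.arr G" "D.arr H" "D.dm G = D.dm H" "D.cd G = D.cd H" "D.S G = D.S H" for G H
    by (rule D_faithful[OF that])
  show "\<exists>f. D.arr f \<and> D.dm f = A \<and> D.cd f = B \<and> D.S f = H"
    if "A \<in> Ob D" "B \<in> Ob D" "D.arr H" "D.dm H = D.So A" "D.cd H = D.So B" for A B H
    using that D_full[of A B H] by (simp add: add_triangles_simps(1))
  show "D.dt G' H' K'" if "D.dt G H K" "D.cnd G' H' K'" "D.tmor G H K G' H' K' a b c" "D.isom a" "D.isom b" "D.isom c"
    for G H K G' H' K' a b c by (rule D_dt_iso[OF that])
  show "D.dt (Ide D A) (Zer D A Z) (Zer D Z (D.So A))" if "A \<in> Ob D" "D.zob Z" for A Z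
    using that D_dt_Ide[of A Z] by (simp add: add_triangles_simps(1))
  show "\<exists>H K. D.dt G H K" if G: "D.arr G" for G
  proof -
    from G obtain f where f: "arr f" "dm f \<in> U" "cd f \<in> U" "G = cls f" by (rule D_arrE)
    then show ?thesis using std_ex[OF f(1-3)] std_dt by blast
  qed
  show "D.dt H K (D.ng (D.S G))" if "D.dt G H K" for G H K by (rule D_dt_rot[OF that])
  show "\<exists>c. D.tmor G H K G' H' K' A B c"
    if d: "D.dt G H K" "D.dt G' H' K'" and A: "D.arr A" "D.arr B" "D.dm A = D.dm G" "D.cd A = D.dm G'" "D.dm B = D.cd G" "D.cd B = D.cd G'"
      and sq: "B \<cdot>\<^bsub>D\<^esub> G = G' \<cdot>\<^bsub>D\<^esub> A" for G H K G' H' K' A B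
  proof -
    obtain f g k a b c where st: "std f g k" and m: "D.tmor (cls f) (cls g) (cls k) G H K a b c" "D.isom a" "D.isom b" "D.isom c"
      using d(1) D_dt_iff by blast
    obtain f' g' k' a' b' c' where st': "std f' g' k'" and m': "D.tmor (cls f') (cls g') (cls k') G' H' K' a' b' c'" "D.isom a'" "D.isom b'" "D.isom c'"
      using d(2) D_dt_iff by blast
    note t = std_arr[OF st] and t' = std_arr[OF st'] and tG = D.dt_arr[OF d(1)] D.dt_arr[OF d(2)]
    obtain a1 b1 c1 where n: "D.tmor G H K (cls f) (cls g) (cls k) a1 b1 c1"
      and n1: "a \<cdot>\<^bsub>D\<^esub> a1 = Ide D (D.dm G)" "b \<cdot>\<^bsub>D\<^esub> b1 = Ide D (D.cd G)"
      by (rule D.tmor_inverse[OF m std_cnd[OF st] D.dt_cnd[OF d(1)]])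
    obtain a2 b2 c2 where n': "D.tmor G' H' K' (cls f') (cls g') (cls k') a2 b2 c2"
      and n2: "a' \<cdot>\<^bsub>D\<^esub> a2 = Ide D (D.dm G')" "b' \<cdot>\<^bsub>D\<^esub> b2 = Ide D (D.cd G')"
      by (rule D.tmor_inverse[OF m' std_cnd[OF st'] D.dt_cnd[OF d(2)]])
    note mm = D.tmor_arr[OF m(1)] D.tmor_arr[OF m'(1)] D.tmor_arr[OF n] D.tmor_arr[OF n']
    have ty: "D.arr a" "D.dm a = dm f" "D.cd a = D.dm G" "D.arr a1" "D.dm a1 = D.dm G" "D.cd a1 = dm f"
      "D.arr b" "D.dm b = cd f" "D.cd b = D.cd G" "D.arr b1" "D.dm b1 = D.cd G" "D.cd b1 = cd f"
      "D.arr a'" "D.dm a' = dm f'" "D.cd a' = D.dm G'" "D.arr a2" "D.dm a2 = D.dm G'" "D.cd a2 = dm f'"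
      "D.arr b'" "D.dm b' = cd f'" "D.cd b' = D.cd G'" "D.arr b2" "D.dm b2 = D.cd G'" "D.cd b2 = cd f'"
      by (simp_all add: mm t t')
    \<comment> \<open>Conjugation carries the square to the standard triangles, where
      \<open>std_fill\<close> applies.\<close>
    let ?A = "a2 \<cdot>\<^bsub>D\<^esub> A \<cdot>\<^bsub>D\<^esub> a" and ?B = "b2 \<cdot>\<^bsub>D\<^esub> B \<cdot>\<^bsub>D\<^esub> b"
    have e1: "b \<cdot>\<^bsub>D\<^esub> cls f = G \<cdot>\<^bsub>D\<^esub> a" and e2: "b2 \<cdot>\<^bsub>D\<^esub> G' = cls f' \<cdot>\<^bsub>D\<^esub> a2"
      using m(1) n' unfolding D.tmor_def by blast+
    have "?B \<cdot>\<^bsub>D\<^esub> cls f = cls f' \<cdot>\<^bsub>D\<^esub> ?A"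
      using ty A t t' tG by (simp add: e1 D.comp_rewrite[OF sq] D.comp_rewrite[OF e2])
    then obtain c3 where c3: "D.tmor (cls f) (cls g) (cls k) (cls f') (cls g') (cls k') ?A ?B c3"
      using std_fill[OF st st', of ?A ?B] ty A tG by auto
    have "D.tmor G H K G' H' K' (a' \<cdot>\<^bsub>D\<^esub> (?A \<cdot>\<^bsub>D\<^esub> a1)) (b' \<cdot>\<^bsub>D\<^esub> (?B \<cdot>\<^bsub>D\<^esub> b1)) (c' \<cdot>\<^bsub>D\<^esub> (c3 \<cdot>\<^bsub>D\<^esub> c1))"
      by (rule D.tmor_comp[OF D.tmor_comp[OF n c3] m'(1)]) (use std_cnd[OF st] std_cnd[OF st'] D.dt_cnd[OF d(1)] D.dt_cnd[OF d(2)] in auto)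
    moreover have "a' \<cdot>\<^bsub>D\<^esub> (?A \<cdot>\<^bsub>D\<^esub> a1) = A"
      using ty A tG by (simp add: n1 D.comp_rewrite[OF n2(1)])
    moreover have "b' \<cdot>\<^bsub>D\<^esub> (?B \<cdot>\<^bsub>D\<^esub> b1) = B"
      using ty A tG by (simp add: n1 D.comp_rewrite[OF n2(2)])
    ultimately show ?thesis by auto
  qed
qed

end

section \<open>The octahedral axiom\<close>

context frobenius_functor
begin

lemma E_precomp:
  assumes "E A d" "arr x" "cd x = dm d" "dm x \<in> U"
  shows "E A (d \<cdot> x)"
  unfolding E_def
proof (intro conjI allI impI)
  note e = ED[OF assms(1)]
  fix w assume w: "arr w" "dm w = A" "cd w \<in> X"
  show "S w \<cdot> (d \<cdot> x) = Zer C (dm (d \<cdot> x)) (So (cd w))"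
    using w assms(2-4) e by (simp add: comp_rewrite[OF E_zero[OF assms(1) w]])
qed (use ED[OF assms(1)] assms(2-4) in auto)

text \<open>For an arbitrary representative of \<open>G2\<close> the third object of the right
  triangle is a push-out. \<open>G2\<close> is therefore replaced, up to an isomorphism
  \<open>P\<close>, by the class of an arrow \<open>g1\<close> whose ambient cone is that third
  object; then the ambient octahedron for \<open>S g1\<close> after \<open>S f \<cdot> h\<close>
  yields all that is needed.\<close>

lemma D_octahedron:
  assumes G1: "D.arr G1" and G2: "D.arr G2" and G12: "D.dm G2 = D.cd G1"
  shows "\<exists>I I' J J' K K' V W. D.dt G1 I I' \<and> D.dt G2 J J' \<and> D.dt (G2 \<cdot>\<^bsub>D\<^esub> G1) K K' \<and>
     D.dt V W (D.S I \<cdot>\<^bsub>D\<^esub> J') \<and> D.dm V = D.cd I \<and> D.cd V = D.cd K \<and> D.cd W = D.cd J \<and>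
     V \<cdot>\<^bsub>D\<^esub> I = K \<cdot>\<^bsub>D\<^esub> G2 \<and> K' \<cdot>\<^bsub>D\<^esub> V = I' \<and> W \<cdot>\<^bsub>D\<^esub> K = J \<and> J' \<cdot>\<^bsub>D\<^esub> W = D.S G1 \<cdot>\<^bsub>D\<^esub> K'"
proof -
  from G1 obtain f sf where f: "arr f" "dm f \<in> U" "cd f \<in> U" "G1 = cls f" "D.dm G1 = dm f" "D.cd G1 = cd f"
    and sf: "arr sf" "dm sf = \<Sigma> (dm f)" "cd sf = \<Sigma> (cd f)" "h (cd f) \<cdot> sf = S f \<cdot> h (dm f)" "D.S G1 = cls sf"
    by (rule Sigma_arr)
  let ?A = "dm f" and ?B = "cd f"
  let ?d = "S f \<cdot> h ?A"
  obtain c c' where st: "std f c c'" using std_ex[OF f(1-3)] by blast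
  note t1 = std_arr[OF st]
  obtain J J' where dJ: "D.dt G2 J J'" using D.dt_ex[OF G2] by blast
  note tJ = D.dt_arr[OF dJ]
  have cJ: "D.cd J' = \<Sigma> ?B" using tJ(6) G12 f(3,6) by simp
  from tJ(3) obtain j' where j': "arr j'" "J' = cls j'" "D.dm J' = dm j'" "D.cd J' = cd j'" by (rule D_arrE)
  have tj': "dm j' = D.cd J" "cd j' = \<Sigma> ?B" using j'(3,4) tJ(5) cJ by simp_all
  have jU: "D.cd J \<in> U" using tJ by simp
  \<comment> \<open>The sign cancels the one in \<open>conflation_dt\<close>, so that the triangle
    built from \<open>g1\<close> has last arrow \<open>J'\<close> itself.\<close>
  let ?e = "h ?B \<cdot> ng j'"
  have e: "E ?B ?e" by (rule E_precomp[OF E_h]) (use f j'(1) tj' jU in auto)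
  obtain g1 j1 where d2: "dt g1 j1 ?e" "dm g1 = ?B"
    using dt_ex_thd[of ?e ?B] f(3) j'(1) tj'(2) by auto
  note t2 = dt_arr[OF d2(1)]
  have cj1: "cd j1 = D.cd J" using t2(5) f(3) j'(1) tj' by simp
  have C1: "cd g1 \<in> U" by (rule ext_dt[OF d2(1)]) (use d2(2) f(3) cj1 jU in auto)
  have "D.dt (cls g1) (cls j1) (D.ng (cls (ng j')))"
    by (rule conflation_dt[OF d2(1)]) (use e d2(2) C1 f(3) j'(1) tj' in auto)
  then have dg: "D.dt (cls g1) (cls j1) J'" using j'(1,2) tj' jU f(3) by simp
  \<comment> \<open>Both triangles have last arrow \<open>J'\<close>, so identities at the outer
    vertices extend to a morphism. Its middle component identifies \<open>cls g1\<close> with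
    \<open>G2\<close>.\<close>
  have "\<exists>b. D.tmor (cls g1) (cls j1) J' G2 J J' (Ide D ?B) b (Ide D (D.cd J))"
    by (rule D.dt_fill_snd[OF dg dJ]) (use tJ(1-5) t2(1-4) d2(2) C1 cj1 f(3,6) G12 jU cJ in auto)
  then obtain P where P: "D.tmor (cls g1) (cls j1) J' G2 J J' (Ide D ?B) P (Ide D (D.cd J))" by blast
  have Pi: "D.isom P" by (rule D.tmor_isom_snd[OF dg dJ P]) (use f(3) jU in auto)
  have tP: "D.arr P" "D.dm P = cd g1" "D.cd P = D.cd G2"
    using D.tmor_arr(2,6,7)[OF P] t2(1) d2(2) C1 f(3) by simp_all
  have P1: "P \<cdot>\<^bsub>D\<^esub> cls g1 = G2" and P2: "J \<cdot>\<^bsub>D\<^esub> P = cls j1"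
  proof -
    have "P \<cdot>\<^bsub>D\<^esub> cls g1 = G2 \<cdot>\<^bsub>D\<^esub> Ide D ?B" "Ide D (D.cd J) \<cdot>\<^bsub>D\<^esub> cls j1 = J \<cdot>\<^bsub>D\<^esub> P"
      using P unfolding D.tmor_def by blast+
    moreover have "G2 \<cdot>\<^bsub>D\<^esub> Ide D ?B = G2" using G2 G12 f(6) by simp
    moreover have "Ide D (D.cd J) \<cdot>\<^bsub>D\<^esub> cls j1 = cls j1" using t2(2,4) C1 cj1 jU by simp
    ultimately show "P \<cdot>\<^bsub>D\<^esub> cls g1 = G2" "J \<cdot>\<^bsub>D\<^esub> P = cls j1" by simp_all
  qed
  obtain P' where P': "D.arr P'" "D.dm P' = D.cd G2" "D.cd P' = cd g1"
    "P' \<cdot>\<^bsub>D\<^esub> P = Ide D (cd g1)" "P \<cdot>\<^bsub>D\<^esub> P' = Ide D (D.cd G2)"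
    using D.isom_inverse[OF Pi] tP by auto
  let ?gf = "g1 \<cdot> f"
  have gf: "arr ?gf" "dm ?gf = ?A" "cd ?gf = cd g1" using t2(1) f(1) d2(2) by simp_all
  obtain k k' where st3: "std ?gf k k'" using std_ex[of ?gf] gf f(2) C1 by auto
  note t3 = std_arr[OF st3, unfolded gf]
  have 1: "dt ?d (ng (S c)) (ng (S c'))" by (rule dt_rot[OF dt_rot[OF t1(10)]])
  have 2: "dt (S g1) (ng (S j1)) (S ?e)" using dt_sign(2)[OF dt_rot3[OF d2(1)]] t2(1,3) by simp
  have eq3: "S ?gf \<cdot> h ?A = S g1 \<cdot> ?d" using t2(1) f(1,2) d2(2) by simp
  have 3: "dt (S g1 \<cdot> ?d) (ng (S k)) (ng (S k'))"
    by (rule dt_rot[OF dt_rot[OF t3(10)[unfolded eq3]]])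
  have 4: "dm (S g1) = cd ?d" using t2(1) d2(2) f(1,2) by simp
  \<comment> \<open>Up to sign and shift the three cones are the third objects of the triangles on
    \<open>f\<close>, on \<open>g1\<close> and on their composite.\<close>
  obtain u v where uv: "dt u v (S (ng (S c)) \<cdot> S ?e)" and ty: "arr u" "arr v" "dm u = cd (ng (S c))"
    "cd u = cd (ng (S k))" "dm v = cd (ng (S k))" "cd v = cd (ng (S j1))"
    and eq: "u \<cdot> ng (S c) = ng (S k) \<cdot> S g1" "ng (S k') \<cdot> u = ng (S c')" "v \<cdot> ng (S k) = ng (S j1)"
      "S ?e \<cdot> v = S ?d \<cdot> ng (S k')"
    by (rule octahedron[OF 1 2 3 4])
  have ty': "dm u = So (cd c)" "cd u = So (cd k)" "dm v = So (cd k)" "cd v = So (D.cd J)"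
    using ty(3-6) t1(2) t2(2) t3(2) cj1 by simp_all
  obtain u0 where u0: "arr u0" "dm u0 = cd c" "cd u0 = cd k" "u = S u0"
    using full[of "cd c" "cd k" u] ty(1) ty'(1,2) t1(7) t3(7) by auto
  obtain v0 where v0: "arr v0" "dm v0 = cd k" "cd v0 = D.cd J" "v = S v0"
    using full[of "cd k" "D.cd J" v] ty(2) ty'(3,4) jU t3(7) by auto
  have ez: "dm ?e = D.cd J" "arr ?e" "cd ?e = So ?B" using f(3) j'(1) tj' by simp_all
  have E1: "u0 \<cdot> c = k \<cdot> g1"
  proof (rule faithful)
    show "S (u0 \<cdot> c) = S (k \<cdot> g1)" using eq(1) u0 t1(2) t3(2,6) t2(1) by (simp add: ng_inject)
  qed (use u0(1-3) t1(2,6) t3(2,6) t2(1) d2(2) in auto)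
  have E2: "k' \<cdot> u0 = c'"
  proof (rule faithful)
    show "S (k' \<cdot> u0) = S c'" using eq(2) u0 t1(3) t3(3,8) by (simp add: ng_inject)
  qed (use u0(1-3) t1(3,8,9) t3(3,8,9) f(2) in auto)
  have E3: "v0 \<cdot> k = j1"
  proof (rule faithful)
    show "S (v0 \<cdot> k) = S j1" using eq(3) v0 t3(2) t2(2) by (simp add: ng_inject)
  qed (use v0(1-3) t3(2,6) t2(2,4) cj1 in auto)
  have E4: "?e \<cdot> v0 = ng (?d \<cdot> k')"
  proof (rule faithful)
    have "S (?e \<cdot> v0) = S ?e \<cdot> S v0" by (rule shift_simps(6)) (use v0(1-3) ez in auto)
    also have "\<dots> = S ?d \<cdot> ng (S k')" using eq(4) unfolding v0(4) .
    finally show "S (?e \<cdot> v0) = S (ng (?d \<cdot> k'))" using t3(3,9) f(1,2) by simp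
  qed (use v0(1-3) ez t3(3,8,9) f(1,2) in auto)
  \<comment> \<open>The octahedral triangle, desuspended, is again a conflation: its last arrow is
    the push-out of \<open>?e\<close> along \<open>c\<close>, and it lifts through \<open>h\<close>
    to \<open>sc \<cdot> ng j'\<close>.\<close>
  have "dt u0 v0 (S c \<cdot> ?e)"
  proof (rule dt_shift_iff[THEN iffD2])
    show "cnd u0 v0 (S c \<cdot> ?e)" unfolding cnd_def using u0(1-3) v0(1-3) ez t1(2,6) by simp
    have "S (ng (S c)) \<cdot> S ?e = ng (S (S c \<cdot> ?e))" using t1(2,6) ez by (simp del: assoc comp_ng)
    then show "dt (S u0) (S v0) (ng (S (S c \<cdot> ?e)))" using uv unfolding u0(4) v0(4) by simp
  qed
  moreover obtain sc where sc: "arr sc" "dm sc = \<Sigma> ?B" "cd sc = \<Sigma> (cd c)" "h (cd c) \<cdot> sc = S c \<cdot> h ?B"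
    using Sigma_ex[of c] t1(2,6,7) f(3) by auto
  ultimately have "D.dt (cls u0) (cls v0) (D.ng (cls (sc \<cdot> ng j')))"
  proof (intro conflation_dt)
    show "E (dm u0) (S c \<cdot> ?e)" using E_comp[OF e t1(2,6,7)] u0(2) by simp
    show "h (dm u0) \<cdot> (sc \<cdot> ng j') = S c \<cdot> ?e"
      using u0(2) sc(1-3) j'(1) tj' t1(2,6,7) f(3) by (simp add: comp_rewrite[OF sc(4)])
  qed (use u0(1-3) v0(1-3) sc(1-3) j'(1) tj' t1(2,6,7) t3(7) f(3) jU ez in auto)
  then have "D.dt (cls u0) (cls v0) (cls (sc \<cdot> j'))" using sc(1-3) j'(1) tj' jU t1(7) f(3) by simp
  moreover have "D.S (cls c) = cls sc" by (rule D_S) (use sc t1(2,6,7) f(3) in auto)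
  ultimately have d4: "D.dt (cls u0) (cls v0) (D.S (cls c) \<cdot>\<^bsub>D\<^esub> J')" using sc(1-3) j'(1,2) tj' by simp
  \<comment> \<open>The standard triangle belongs to \<open>g1 \<cdot> f\<close>; the inverse of
    \<open>P\<close> carries its second arrow over to \<open>G2\<close>.\<close>
  let ?K = "cls k \<cdot>\<^bsub>D\<^esub> P'"
  have tk: "D.arr (cls k)" "D.dm (cls k) = cd g1" "D.cd (cls k) = cd k" using t3(2,6,7) C1 by simp_all
  have tk': "D.arr (cls k')" "D.dm (cls k') = cd k" "D.cd (cls k') = \<Sigma> ?A" using t3(3,7,8,9) f(2) by simp_all
  have tg1: "D.arr (cls g1)" "D.dm (cls g1) = ?B" "D.cd (cls g1) = cd g1" using t2(1) d2(2) f(3) C1 by simp_all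
  have cf: "D.arr (cls f)" "D.dm (cls f) = ?A" "D.cd (cls f) = ?B" using f(1-3) by simp_all
  have GP: "G2 \<cdot>\<^bsub>D\<^esub> G1 = P \<cdot>\<^bsub>D\<^esub> cls ?gf"
  proof -
    have "P \<cdot>\<^bsub>D\<^esub> (cls g1 \<cdot>\<^bsub>D\<^esub> cls f) = G2 \<cdot>\<^bsub>D\<^esub> cls f"
      by (rule D.comp_rewrite[OF P1]) (use tP tg1 cf in auto)
    then show ?thesis using f(1,4) t2(1) d2(2) by simp
  qed
  have KP: "?K \<cdot>\<^bsub>D\<^esub> P = cls k"
    using tk tP P' by simp
  have d3: "D.dt (G2 \<cdot>\<^bsub>D\<^esub> G1) ?K (cls k')"
  proof (rule D_dt_iso[OF std_dt[OF st3]])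
    show "D.cnd (G2 \<cdot>\<^bsub>D\<^esub> G1) ?K (cls k')" unfolding D.cnd_def
      using G1 G2 G12 tk tk' P'(1-3) f(2,5) by simp
    show "D.tmor (cls ?gf) (cls k) (cls k') (G2 \<cdot>\<^bsub>D\<^esub> G1) ?K (cls k') (Ide D ?A) P (Ide D (cd k))"
      unfolding D.tmor_def
    proof (intro conjI)
      show "P \<cdot>\<^bsub>D\<^esub> cls ?gf = (G2 \<cdot>\<^bsub>D\<^esub> G1) \<cdot>\<^bsub>D\<^esub> Ide D ?A" unfolding GP[symmetric]
        using G1 G2 G12 f(5) by simp
      show "Ide D (cd k) \<cdot>\<^bsub>D\<^esub> cls k = ?K \<cdot>\<^bsub>D\<^esub> P" unfolding KP using tk by simp
    qed (use G1 G2 G12 f(2,5) tk tk' P'(1-3) tP gf C1 t3(7) in auto)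
  qed (use Pi f(2) t3(7) in auto)
  have dG1: "D.dt G1 (cls c) (cls c')" unfolding f(4) by (rule std_dt[OF st])
  have "D.dm (cls u0) = D.cd (cls c)" "D.cd (cls u0) = D.cd ?K" "D.cd (cls v0) = D.cd J"
    using u0(1-3) v0(1-3) t1(2,6,7) t3(7) f(3) tk P' jU by simp_all
  moreover have "cls u0 \<cdot>\<^bsub>D\<^esub> cls c = ?K \<cdot>\<^bsub>D\<^esub> G2"
  proof -
    have "?K \<cdot>\<^bsub>D\<^esub> (P \<cdot>\<^bsub>D\<^esub> cls g1) = cls k \<cdot>\<^bsub>D\<^esub> cls g1"
      by (rule D.comp_rewrite[OF KP]) (use tk tP tg1 P' in auto)
    then show ?thesis unfolding P1 using u0(1-3) t1(2) t3(2,6) t2(1) by (simp add: E1)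
  qed
  moreover have "cls k' \<cdot>\<^bsub>D\<^esub> cls u0 = cls c'" using u0(1-3) t3(3,8) by (simp add: E2)
  moreover have "cls v0 \<cdot>\<^bsub>D\<^esub> ?K = J"
  proof -
    have "cls v0 \<cdot>\<^bsub>D\<^esub> cls k = cls j1" using v0(1-3) t3(2) by (simp add: E3)
    then have "cls v0 \<cdot>\<^bsub>D\<^esub> ?K = cls j1 \<cdot>\<^bsub>D\<^esub> P'"
      by (rule D.comp_rewrite) (use v0(1-3) tk P' jU t3(7) in auto)
    also have "\<dots> = J \<cdot>\<^bsub>D\<^esub> (P \<cdot>\<^bsub>D\<^esub> P')" unfolding P2[symmetric] by (rule D.assoc) (use tJ tP P' in auto)
    also have "\<dots> = J" unfolding P'(5) using tJ by simp
    finally show ?thesis .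
  qed
  moreover have "J' \<cdot>\<^bsub>D\<^esub> cls v0 = D.S G1 \<cdot>\<^bsub>D\<^esub> cls k'"
  proof -
    have "h ?B \<cdot> (j' \<cdot> v0) = ng (?e \<cdot> v0)" using f(3) j'(1) tj' v0(1-3) by simp
    also have "\<dots> = h ?B \<cdot> (sf \<cdot> k')"
      unfolding E4 using f(1-3) sf(1-3) t3(3,9) by (simp add: comp_rewrite[OF sf(4)])
    finally have "eqv (j' \<cdot> v0) (sf \<cdot> k')"
      by (subst eqv_iff_h[of ?B]) (use f(3) j'(1) tj' v0(1-3) sf(1-3) t3(3,8,9) in auto)
    then show ?thesis unfolding sf(5) j'(2)
      using j'(1) tj' v0(1-3) sf(1-3) t3(3,9) by (simp add: D_eq)
  qed
  ultimately show ?thesis using dG1 dJ d3 d4 by blast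
qed

theorem triangulated_D: "triangulated D"
proof (rule D.triangulatedI)
  show "additive D" unfolding add_triangles_cong by (rule additive_Q)
  show "\<exists>B e. B \<in> Ob D \<and> D.isom e \<and> D.dm e = D.So B \<and> D.cd e = A" if A: "A \<in> Ob D" for A
  proof -
    obtain B e where "B \<in> U" "D.isom e" "D.dm e = \<Sigma> B" "D.cd e = A"
      using D_dense[of A] A by (auto simp: add_triangles_simps(1))
    then show ?thesis by (intro exI[of _ B] exI[of _ e]) simp
  qed
qed (rule D_octahedron)

end

section \<open>Frobenius subcategories\<close>

lemma right_triangles_eq: "right_triangles T X L U = right_triangles_for T X L (Sigma_functor T X L) U"
  by (simp add: right_triangles_def right_triangles_for_def)

context right_frobenius
begin

text \<open>Every member of the union defining \<open>Sigma_functor\<close> comes from some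
  \<open>s'\<close> with \<open>h \<cdot> s' = S f' \<cdot> h\<close> and \<open>f'\<close>
  congruent to \<open>f\<close>, which determines its class. The union is not empty because
  \<open>f\<close> and \<open>s\<close> complete to a morphism of the chosen triangles.\<close>

lemma frobenius_functor_Sigma: "frobenius_functor C X U L (Sigma_functor C X L)"
proof
  show "fob (Sigma_functor C X L) A = \<Sigma> A" for A by (simp add: Sigma_functor_def)
  fix f s assume f: "arr f" "dm f \<in> U" "cd f \<in> U" and s: "arr s" "dm s = \<Sigma> (dm f)" "cd s = \<Sigma> (cd f)"
    "h (cd f) \<cdot> s = S f \<cdot> h (dm f)"
  let ?K = "{cls s' | s'. \<exists>A\<in>Ob C. \<exists>B\<in>Ob C. \<exists>f'\<in>cls f \<inter> Hom C A B. \<exists>x. tri_mor C (Shift C) (L A) (L B) f' x s'}"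
  have tm: "tri_mor C (Shift C) (L (dm f)) (L (cd f)) f' x s' \<longleftrightarrow>
     tmor (i (dm f)) (p (dm f)) (h (dm f)) (i (cd f)) (p (cd f)) (h (cd f)) f' x s'" for f' x s'
    by (subst L_dt(5)[OF f(2)], subst L_dt(5)[OF f(3)], rule tri_mor_iff)
      (use f dt_cnd[OF L_dt(1)] in auto)
  have k1: "K = cls s" if "K \<in> ?K" for K
  proof -
    from that obtain s' A B f' x where K: "K = cls s'" and AB: "A \<in> Ob C" "B \<in> Ob C" and f': "f' \<in> cls f" "f' \<in> Hom C A B"
      and m: "tri_mor C (Shift C) (L A) (L B) f' x s'" by blast
    have e: "eqv f f'" using f'(1) by (simp add: mem_cls)
    have f2: "arr f'" "dm f' = A" "cd f' = B" using f'(2) AB by simp_all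
    have A: "A = dm f" "B = cd f" using f2 eqvD(3,4)[OF e] by simp_all
    have mt: "tmor (i (dm f)) (p (dm f)) (h (dm f)) (i (cd f)) (p (cd f)) (h (cd f)) f' x s'"
      using m tm unfolding A by blast
    have m': "arr s'" "dm s' = \<Sigma> (dm f)" "cd s' = \<Sigma> (cd f)"
      using tmor_arr(3,8,9)[OF mt] f(2,3) by simp_all
    have m4: "S f' \<cdot> h (dm f) = h (cd f) \<cdot> s'" using mt unfolding tmor_def by blast
    have "S f \<cdot> h (dm f) = S f' \<cdot> h (dm f)"
      using eqv_iff_shift[OF f(1) f2(1) f(2) eqvD(3,4)[OF e]] e by simp
    then have "h (cd f) \<cdot> s' = h (cd f) \<cdot> s" using m4 s(4) by simp
    then have "eqv s' s" using eqv_iff_h[OF f(3) m'(1) s(1) m'(3) s(3)] m'(2) s(2) by simp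
    then show ?thesis using K m'(1) by (simp add: cls_eq_iff)
  qed
  have k2: "cls s \<in> ?K"
  proof -
    have "\<exists>x. tmor (i (dm f)) (p (dm f)) (h (dm f)) (i (cd f)) (p (cd f)) (h (cd f)) f x s"
      by (rule dt_fill_snd[OF L_dt(1)[OF f(2)] L_dt(1)[OF f(3)]]) (use f s in simp_all)
    then obtain x where "tmor (i (dm f)) (p (dm f)) (h (dm f)) (i (cd f)) (p (cd f)) (h (cd f)) f x s" by blast
    then have "tri_mor C (Shift C) (L (dm f)) (L (cd f)) f x s" using tm by simp
    moreover have "f \<in> cls f \<inter> Hom C (dm f) (cd f)" using f cls_self[OF f(1)] by simp
    moreover have "dm f \<in> Ob C" "cd f \<in> Ob C" using f(1) by simp_all
    ultimately show ?thesis by blast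
  qed
  have "A = {a}" if "\<And>x. x \<in> A \<Longrightarrow> x = a" "a \<in> A" for A and a :: "'m set" using that by blast
  from this[OF k1 k2] have "?K = {cls s}" .
  then show "fmap (Sigma_functor C X L) (cls f) = cls s"
    unfolding Sigma_functor_def by simp
qed

end

section \<open>From vanishing ghosts and coghosts to the one-sided hypotheses\<close>

context tri
begin

lemma isomorphic_sym: "isomorphic C A B \<Longrightarrow> isomorphic C B A"
  unfolding isomorphic_iff using isom_inverse by metis

text \<open>\<open>mono_epi\<close> is the vanishing of coghosts after desuspending
  \<open>d \<cdot> y\<close>. For \<open>enough\<close> the triangle \<open>R A\<close> serves, and
  the vanishing of ghosts supplies the condition on its last arrow.\<close>

lemma frobenius_imp_right_frobenius:
  assumes X: "subcategory C X" and L: "left_approx_choice C X U L" and R: "right_approx_choice C X U R"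
    and F: "frobenius C X L R U"
  shows "right_frobenius C X U L"
proof
  show aX: "additive_subcategory C X" using X by (simp add: subcategory_def)
  show aU: "additive_subcategory C U" using F by (simp add: frobenius_def subcategory_def)
  show XU: "X \<subseteq> U" using F by (simp add: frobenius_def functorially_finite_def)
  show "closed_under_extensions C U" using F by (simp add: frobenius_def)
  show "left_approx_choice C X U L" by (rule L)
  show "Sigma_ob L A \<in> U" if "A \<in> U" for A using F that by (simp add: frobenius_def)
  have UO: "\<And>A. A \<in> U \<Longrightarrow> A \<in> Ob C" using aU unfolding additive_subcategory_def by blast
  show "d \<cdot>\<^bsub>C\<^esub> y = Zer C (dm y) (cd d)"
    if A: "A \<in> U" "dm d \<in> U" "arr d" "cd d = So A"
      and z: "\<And>w. \<lbrakk>arr w; dm w = A; cd w \<in> X\<rbrakk> \<Longrightarrow> S w \<cdot>\<^bsub>C\<^esub> d = Zer C (dm d) (So (cd w))"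
      and y: "arr y" "dm y \<in> X" "cd y = dm d" for A d y
  proof -
    \<comment> \<open>\<open>V\<close> plays the role of the source of \<open>y\<close> shifted back
      by one. The composite of \<open>d\<close>, \<open>y\<close> and \<open>e\<close> desuspends to
      an arrow \<open>x\<close> from \<open>V\<close> to \<open>A\<close>, and \<open>x\<close> is a
      coghost by the hypothesis on \<open>d\<close>.\<close>
    obtain V e where V: "V \<in> Ob C" "isom e" "dm e = So V" "cd e = dm y" using dense[of "dm y"] y(1) by auto
    obtain x where x: "arr x" "dm x = V" "cd x = A" "S x = d \<cdot> (y \<cdot> e)"
      using full[of V A "d \<cdot> (y \<cdot> e)"] V A y UO by auto
    have "isomorphic C (So V) (dm y)" using V unfolding isomorphic_iff by blast
    then have c: "CoGh C X V A = {Zer C V A}" using F A(1) y(2) V(1) unfolding frobenius_def by blast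
    have "u \<cdot> x = Zer C V Y" if "Y \<in> X" "u \<in> Hom C A Y" for Y u
    proof (rule faithful)
      have Y: "Y \<in> Ob C" "A \<in> Ob C" using that XU UO A(1) by blast+
      have u: "arr u" "dm u = A" "cd u = Y" using that Y by simp_all
      have "S u \<cdot> d = Zer C (dm d) (So (cd u))" by (rule z) (use u that in auto)
      note zz = comp_rewrite[OF this]
      show "S (u \<cdot> x) = S (Zer C V Y)" using u x V y A Y by (simp add: zz)
      show "arr (u \<cdot> x)" "arr (Zer C V Y)" "dm (u \<cdot> x) = dm (Zer C V Y)" "cd (u \<cdot> x) = cd (Zer C V Y)"
        using u x(1-3) V Y by simp_all
    qed
    moreover have "x \<in> Hom C V A" using x(1-3) V(1) UO[OF A(1)] by simp
    ultimately have "x \<in> CoGh C X V A" unfolding CoGh_def by blast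
    then have "x = Zer C V A" using c by simp
    then have "d \<cdot> (y \<cdot> e) = Zer C (So V) (So A)" using x(4) V(1) UO[OF A(1)] by simp
    then have "(d \<cdot> y) \<cdot> e = Zer C (dm y) (cd d) \<cdot> e" using V A(3,4) y UO[OF A(1)] by simp
    then show ?thesis
      by (rule isom_cancel_right[OF V(2), rotated -1]) (use V A(3,4) y UO[OF A(1)] in simp_all)
  qed
  show "\<exists>j q d. dt j q d \<and> cd q = A \<and> dm j \<in> U \<and> cd j \<in> X \<and>
        (\<forall>w. arr w \<longrightarrow> dm w = dm j \<longrightarrow> cd w \<in> X \<longrightarrow> S w \<cdot>\<^bsub>C\<^esub> d = Zer C (dm d) (So (cd w)))" if A: "A \<in> U" for A
  proof -
    have r: "R A \<in> Dist C" "ob3 (R A) = A" "right_approx C X A (ob2 (R A)) (arr2 (R A))"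
      using R A unfolding right_approx_choice_def by blast+
    obtain K Y j q d where RA: "R A = Tri K Y A j q d" using r(2) by (cases "R A") auto
    have dt: "dt j q d" "K = dm j" "Y = cd j" "A = cd q" using r(1) RA by (auto simp: Dist_iff)
    have KU: "K \<in> U" using F A RA unfolding frobenius_def by fastforce
    have YX: "Y \<in> X" and ap: "\<And>X'. X' \<in> X \<Longrightarrow> (\<lambda>u. q \<cdot> u) ` Hom C X' Y = Hom C X' A"
      using r(3) RA unfolding right_approx_def by auto
    note t = dt_arr[OF dt(1)]
    \<comment> \<open>This composite is a ghost: every arrow from \<open>X\<close> to
      \<open>A\<close> lifts through the approximation \<open>q\<close>, and
      \<open>d \<cdot> q\<close> vanishes.\<close>
    have "S w \<cdot> d = Zer C (dm d) (So (cd w))" if w: "arr w" "dm w = dm j" "cd w \<in> X" for w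
    proof -
      have g: "Gh C X A (So (cd w)) = {Zer C A (So (cd w))}" using F A w(3) unfolding frobenius_def by blast
      have "(S w \<cdot> d) \<cdot> u = Zer C X' (So (cd w))" if X': "X' \<in> X" "u \<in> Hom C X' A" for X' u
      proof -
        have o: "X' \<in> Ob C" "Y \<in> Ob C" using X' YX XU UO by blast+
        have "u \<in> (\<lambda>u. q \<cdot> u) ` Hom C X' Y" unfolding ap[OF X'(1)] by (rule X'(2))
        then obtain u' where u': "u' \<in> Hom C X' Y" "q \<cdot> u' = u" by blast
        have "arr u'" "dm u' = X'" "cd u' = cd j" using u'(1) o dt(3) by simp_all
        then show ?thesis unfolding u'(2)[symmetric] using w t o
          by (simp add: comp_rewrite[OF dt_zero(2)[OF dt(1)]])
      qed
      moreover have "S w \<cdot> d \<in> Hom C A (So (cd w))" using w t dt(4) by simp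
      ultimately have "S w \<cdot> d \<in> Gh C X A (So (cd w))" unfolding Gh_def by blast
      then show ?thesis using g t dt(4) by simp
    qed
    then show ?thesis using dt KU YX by blast
  qed
qed

end

section \<open>Left triangles as right triangles of the opposite category\<close>

context opp
begin

definition op_tri :: "('o, 'm) tri \<Rightarrow> ('o, 'm) tri" where
  "op_tri t = Tri (ob3 t) (ob2 t) (ob1 t) (arr2 t) (arr1 t) (phi (ob1 t) (arr3 t))"

lemma op_tri_simps [simp]: "ob1 (op_tri t) = ob3 t" "ob2 (op_tri t) = ob2 t" "ob3 (op_tri t) = ob1 t"
  "arr1 (op_tri t) = arr2 t" "arr2 (op_tri t) = arr1 t" "arr3 (op_tri t) = phi (ob1 t) (arr3 t)"
  by (simp_all add: op_tri_def)

lemma op_tri_Dist: "t \<in> Dist C \<Longrightarrow> op_tri t \<in> Dist opc"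
proof -
  assume t: "t \<in> Dist C"
  obtain A B D f g h where e: "t = Tri A B D f g h" by (cases t)
  have d: "dt f g h" "A = dm f" "B = cd f" "D = cd g" using t unfolding e Dist_iff by simp_all
  have "O.dt g f (phi (dm f) h)" using d(1) O_dt by blast
  then show "op_tri t \<in> Dist opc"
    unfolding e op_tri_def tri.sel O.Dist_iff using d(2-4) dt_arr[OF d(1)] by simp
qed

lemma Dist_opcE:
  assumes "t \<in> Dist opc"
  obtains t' where "t' \<in> Dist C" "t = op_tri t'"
proof -
  obtain f g h where t: "t = Tri (cd g) (cd f) (dm f) g f (phi (dm f) h)" "dt f g h"
    using assms by (auto simp: opc_def)
  then show ?thesis using that[of "Tri (dm f) (cd f) (cd g) f g h"] by (simp add: op_tri_def dt_def)
qed

lemma O_additive_subcategory: "additive_subcategory opc W \<longleftrightarrow> additive_subcategory C W"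
  unfolding additive_subcategory_def O_zero_object O_biproduct O_isomorphic opc_simps(1)
  using isomorphic_sym by blast

lemma O_subcategory: "subcategory opc W \<longleftrightarrow> subcategory C W"
  unfolding subcategory_def O_additive_subcategory closed_under_summands_def O_biproduct ..

lemma O_closed_under_extensions: "closed_under_extensions C W \<Longrightarrow> closed_under_extensions opc W"
  unfolding closed_under_extensions_def by (auto elim!: Dist_opcE)

lemma O_approx [simp]:
  "left_approx opc X A Y f \<longleftrightarrow> right_approx C X A Y f" "right_approx opc X A Y f \<longleftrightarrow> left_approx C X A Y f"
  by (simp_all add: left_approx_def right_approx_def)

lemma O_left_approx_choice: "right_approx_choice C X U R \<Longrightarrow> left_approx_choice opc X U (op_tri \<circ> R)"
  unfolding left_approx_choice_def right_approx_choice_def by (auto simp: op_tri_Dist)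

lemma O_right_approx_choice: "left_approx_choice C X U L \<Longrightarrow> right_approx_choice opc X U (op_tri \<circ> L)"
  unfolding left_approx_choice_def right_approx_choice_def by (auto simp: op_tri_Dist)

lemma O_Gh: "Gh opc X A B = CoGh C X B A" "CoGh opc X A B = Gh C X B A"
  by (simp_all add: Gh_def CoGh_def)

lemma isomorphic_shift_G: "Y \<in> Ob C \<Longrightarrow> isomorphic C (So (Go Y)) Y"
  unfolding isomorphic_iff using \<eta> by blast

text \<open>The ghost condition speaks of \<open>So Y\<close>, whereas the opposite asks for it at
  every \<open>V\<close> with \<open>Go V\<close> isomorphic to \<open>Y\<close>. Such a
  \<open>V\<close> is isomorphic to \<open>So Y\<close>.\<close>

lemma Gh_transport:
  assumes z: "Gh C X A B = {Zer C A B}" and e: "isom e" "dm e = B'" "cd e = B"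
    and o: "A \<in> Ob C" "X \<subseteq> Ob C"
  shows "Gh C X A B' = {Zer C A B'}"
proof -
  have B: "B \<in> Ob C" "B' \<in> Ob C" using e by auto
  have "f = Zer C A B'" if "f \<in> Gh C X A B'" for f
  proof -
    have f: "arr f" "dm f = A" "cd f = B'" using that B o by (simp_all add: Gh_def)
    have "(e \<cdot> f) \<cdot> u = Zer C X' B" if u: "X' \<in> X" "u \<in> Hom C X' A" for X' u
    proof -
      have "f \<cdot> u = Zer C X' B'" using \<open>f \<in> Gh C X A B'\<close> u unfolding Gh_def by blast
      moreover have "X' \<in> Ob C" using u o by blast
      ultimately show ?thesis using f e B u o by simp
    qed
    moreover have "e \<cdot> f \<in> Hom C A B" using f e o B by simp
    ultimately have "e \<cdot> f \<in> Gh C X A B" unfolding Gh_def by blast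
    then have "e \<cdot> f = e \<cdot> Zer C A B'" using z e o B by simp
    then show ?thesis by (rule isom_cancel[rotated -1]) (use e f o B in auto)
  qed
  moreover have "Zer C A B' \<in> Gh C X A B'" using o B by (auto simp: Gh_def)
  ultimately show ?thesis by blast
qed

text \<open>Ghosts and coghosts change places. \<open>Go Y\<close> is an admissible desuspension of
  \<open>Y\<close>, so the coghost condition covers the new ghosts; the converse passage uses
  \<open>Gh_transport\<close>.\<close>

lemma O_frobenius:
  assumes F: "frobenius C X L R U"
  shows "frobenius opc X (op_tri \<circ> R) (op_tri \<circ> L) U"
proof -
  have U: "U \<subseteq> Ob C" using F by (simp add: frobenius_def subcategory_def additive_subcategory_def)
  have XU: "X \<subseteq> U" using F by (simp add: frobenius_def functorially_finite_def)
  have "Gh opc X A (Go Y) = {Zer C (Go Y) A}" if "A \<in> U" "Y \<in> X" for A Y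
  proof -
    have Y: "Y \<in> Ob C" using that U XU by blast
    have "Go Y \<in> Ob C" "isomorphic C (So (Go Y)) Y" using Y isomorphic_shift_G by simp_all
    then show ?thesis unfolding O_Gh using F that unfolding frobenius_def by blast
  qed
  moreover have "CoGh opc X V A = {Zer C A V}"
    if h: "A \<in> U" "Y \<in> X" "V \<in> Ob C" "isomorphic opc (Go V) Y" for A Y V
  proof -
    have Y: "Y \<in> Ob C" "A \<in> Ob C" using h U XU by blast+
    obtain a where a: "isom a" "dm a = Go V" "cd a = Y"
      using h(4) isomorphic_sym[of Y "Go V"] unfolding O_isomorphic isomorphic_iff by blast
    obtain e where e: "isom e" "dm e = V" "cd e = So (Go V)"
      using isom_inverse[OF \<eta>_simps(1)[OF h(3)]] h(3) by auto
    \<comment> \<open>The composite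
      \<open>V \<rightarrow> So (Go V) \<rightarrow> So Y\<close>.\<close>
    have "isom (S a \<cdot> e)" by (rule isom_comp[OF e(1) shift_isom[OF a(1)]]) (use a e in simp)
    then show ?thesis unfolding O_Gh
      by (rule Gh_transport[rotated]) (use F h a e Y U XU in \<open>auto simp: frobenius_def\<close>)
  qed
  moreover have "functorially_finite opc X U"
    using F by (auto simp: frobenius_def functorially_finite_def)
  moreover have "subcategory opc U" using F by (simp add: frobenius_def O_subcategory)
  moreover have "closed_under_extensions opc U"
    by (rule O_closed_under_extensions) (use F in \<open>simp add: frobenius_def\<close>)
  ultimately show ?thesis using F unfolding frobenius_def by simp
qed

section \<open>Quotients and left triangles in the opposite category\<close>

lemma O_cong_mod: "cong_mod opc X = cong_mod C X"
proof -
  have "factoring opc X A B = factoring C X B A" for A B unfolding factoring_def by auto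
  then show ?thesis unfolding cong_mod_def by auto
qed

lemma O_quot_class [simp]: "quot_class opc X = quot_class C X"
  by (intro ext) (simp add: quot_class_def O_cong_mod)

text \<open>Left triangles are stated in the \<open>op_cat\<close> of the subfactor, the transported
  theorems in the subfactor of \<open>opc\<close>. This identifies the two.\<close>

lemma O_subfactor: "subfactor opc X U = op_cat (subfactor C X U)"
  unfolding subfactor_def quot_cat_def op_cat_def O_cong_mod O_quot_class opc_simps
  by (auto simp: fun_eq_iff add_comm)

lemma R_dt:
  assumes R: "right_approx_choice C X U R" and A: "A \<in> U"
  shows "dt (arr1 (R A)) (arr2 (R A)) (arr3 (R A))" "R A = Tri (dm (arr1 (R A))) (cd (arr1 (R A))) A (arr1 (R A)) (arr2 (R A)) (arr3 (R A))"
    "cd (arr2 (R A)) = A"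
proof -
  have r: "R A \<in> Dist C" "ob3 (R A) = A" using R A unfolding right_approx_choice_def by blast+
  show "dt (arr1 (R A)) (arr2 (R A)) (arr3 (R A))" "R A = Tri (dm (arr1 (R A))) (cd (arr1 (R A))) A (arr1 (R A)) (arr2 (R A)) (arr3 (R A))"
    "cd (arr2 (R A)) = A"
    using r by (cases "R A", auto simp: Dist_iff)+
qed

lemma O_tri_mor:
  assumes "t \<in> Dist C" "t' \<in> Dist C"
  shows "tri_mor opc (Shift opc) (op_tri t) (op_tri t') c b a \<longleftrightarrow> tri_mor C (Shift C) t' t a b c"
proof -
  obtain A B D f g h where t: "t = Tri A B D f g h" by (cases t)
  obtain A' B' D' f' g' h' where t': "t' = Tri A' B' D' f' g' h'" by (cases t')
  have d: "dt f g h" "A = dm f" "B = cd f" "D = cd g" "dt f' g' h'" "A' = dm f'" "B' = cd f'" "D' = cd g'"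
    using assms t t' by (auto simp: Dist_iff)
  note c = dt_cnd[OF d(1)] dt_cnd[OF d(5)]
  note tt = dt_arr[OF d(1)] dt_arr[OF d(5)]
  have o: "O.cnd g f (phi (dm f) h)" "O.cnd g' f' (phi (dm f') h')" by (rule O_cnd[OF c(1)], rule O_cnd[OF c(2)])
  have "tri_mor opc (Shift opc) (op_tri t) (op_tri t') c b a \<longleftrightarrow> O.tmor g f (phi (dm f) h) g' f' (phi (dm f') h') c b a"
    unfolding t t' op_tri_def tri.sel d(2,6) by (rule O.tri_mor_iff[OF o]) (use d tt in auto)
  also have "\<dots> \<longleftrightarrow> tmor f' g' h' f g h a b c" by (rule O_tmor[OF c])
  also have "\<dots> \<longleftrightarrow> tri_mor C (Shift C) t' t a b c"
    unfolding t t' using tri_mor_iff[OF c(2,1)] d by simp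
  finally show ?thesis .
qed

text \<open>By \<open>O_tri_mor\<close> the morphisms of chosen triangles occurring in the two
  unions correspond. The arrow is kept in \<open>U\<close> because \<open>R\<close> is a choice of
  triangles only there.\<close>

lemma O_Omega_map:
  assumes R: "right_approx_choice C X U R" and U: "U \<subseteq> Ob C" and q: "subfactor_cat C X U"
    and f: "arr f" "dm f \<in> U" "cd f \<in> U"
  shows "fmap (Omega_functor C X R) (quot_class C X f) = fmap (Sigma_functor opc X (op_tri \<circ> R)) (quot_class C X f)"
proof -
  interpret subfactor_cat C X U by (rule q)
  have "{cls w | w. \<exists>A\<in>Ob C. \<exists>B\<in>Ob C. \<exists>f'\<in>cls f \<inter> Hom C A B. \<exists>x. tri_mor C (Shift C) (R A) (R B) w x f'} =
    {cls s | s. \<exists>A\<in>Ob C. \<exists>B\<in>Ob C. \<exists>f'\<in>cls f \<inter> Hom C B A. \<exists>x.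
        tri_mor opc (Shift opc) (op_tri (R A)) (op_tri (R B)) f' x s}" (is "?l = ?r")
  proof -
    have tm: "tri_mor opc (Shift opc) (op_tri (R A)) (op_tri (R B)) f' x s \<longleftrightarrow> tri_mor C (Shift C) (R B) (R A) s x f'"
      if "A \<in> Ob C" "B \<in> Ob C" "f' \<in> cls f \<inter> Hom C B A" for A B f' x s
    proof (rule O_tri_mor)
      have "eqv f f'" "arr f'" "dm f' = B" "cd f' = A" using that by (simp_all add: mem_cls)
      then have "A \<in> U" "B \<in> U" using eqvD(3,4)[of f f'] f by simp_all
      then show "R A \<in> Dist C" "R B \<in> Dist C" using R unfolding right_approx_choice_def by blast+
    qed
    show ?thesis
    proof (intro equalityI subsetI)
      fix K assume "K \<in> ?l"
      then obtain w A B f' x where "K = cls w" "A \<in> Ob C" "B \<in> Ob C" "f' \<in> cls f \<inter> Hom C A B"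
        "tri_mor C (Shift C) (R A) (R B) w x f'" by blast
      then show "K \<in> ?r" using tm[of B A f' x w] by blast
    next
      fix K assume "K \<in> ?r"
      then obtain w A B f' x where "K = cls w" "A \<in> Ob C" "B \<in> Ob C" "f' \<in> cls f \<inter> Hom C B A"
        "tri_mor opc (Shift opc) (op_tri (R A)) (op_tri (R B)) f' x w" by blast
      then show "K \<in> ?l" using tm[of A B f' x w] by blast
    qed
  qed
  then show ?thesis unfolding Omega_functor_def Sigma_functor_def by (simp only: func.simps opc_simps O_quot_class comp_apply)
qed

lemma O_frobenius_functor:
  assumes X: "subcategory C X" and L: "left_approx_choice C X U L" and R: "right_approx_choice C X U R"
    and F: "frobenius C X L R U"
  shows "frobenius_functor opc X U (op_tri \<circ> R) (Omega_functor C X R)"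
proof -
  interpret f0: right_frobenius opc X U "op_tri \<circ> R"
    by (rule O.frobenius_imp_right_frobenius[OF _ O_left_approx_choice[OF R] O_right_approx_choice[OF L] O_frobenius[OF F]])
      (use X in \<open>simp add: O_subcategory\<close>)
  interpret f1: frobenius_functor opc X U "op_tri \<circ> R" "Sigma_functor opc X (op_tri \<circ> R)" by (rule f0.frobenius_functor_Sigma)
  interpret g0: right_frobenius C X U L by (rule frobenius_imp_right_frobenius[OF X L R F])
  have U: "U \<subseteq> Ob C" using F by (simp add: frobenius_def subcategory_def additive_subcategory_def)
  show ?thesis
  proof
    show "fob (Omega_functor C X R) A = Sigma_ob (op_tri \<circ> R) A" for A by (simp add: Omega_functor_def)
    fix f s assume f: "O.arr f" "O.dm f \<in> U" "O.cd f \<in> U" and s: "O.arr s" "O.dm s = Sigma_ob (op_tri \<circ> R) (O.dm f)"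
      "O.cd s = Sigma_ob (op_tri \<circ> R) (O.cd f)"
      "arr3 ((op_tri \<circ> R) (O.cd f)) \<cdot>\<^bsub>opc\<^esub> s = O.S f \<cdot>\<^bsub>opc\<^esub> arr3 ((op_tri \<circ> R) (O.dm f))"
    have "fmap (Sigma_functor opc X (op_tri \<circ> R)) (quot_class opc X f) = quot_class opc X s"
      by (rule f1.F_map[OF f s])
    moreover have "fmap (Omega_functor C X R) (quot_class C X f) = fmap (Sigma_functor opc X (op_tri \<circ> R)) (quot_class C X f)"
      by (rule O_Omega_map[OF R U g0.subfactor_cat_axioms]) (use f in auto)
    ultimately show "fmap (Omega_functor C X R) (quot_class opc X f) = quot_class opc X s" by simp
  qed
qed

text \<open>Transposing the last arrow of the homotopy pull-back triangle gives the last arrow of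
  the push-out triangle in \<open>opc\<close>, by naturality of \<open>phi\<close>. Injectivity of
  \<open>phi\<close> gives the way back.\<close>

lemma O_left_triangles:
  assumes R: "right_approx_choice C X U R" and U: "U \<subseteq> Ob C"
  shows "left_triangles C X R U = right_triangles_for opc X (op_tri \<circ> R) (Omega_functor C X R) U"
proof -
  have d: "Tri (Omega_ob R A) K B k g (arr3 (R A) \<cdot> f) \<in> Dist C \<longleftrightarrow>
      Tri B K (Sigma_ob (op_tri \<circ> R) A) g k (O.S f \<cdot>\<^bsub>opc\<^esub> arr3 ((op_tri \<circ> R) A)) \<in> Dist opc"
    if "A \<in> U" "B \<in> U" "f \<in> Hom C B A" for A B K f g k
  proof -
    have o: "A \<in> Ob C" "B \<in> Ob C" using that U by blast+
    have f: "arr f" "dm f = B" "cd f = A" using that(3) o by simp_all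
    note r = R_dt[OF R that(1)]
    note t = dt_arr[OF r(1)]
    have om: "Omega_ob R A = dm (arr1 (R A))" using arg_cong[OF r(2), of ob1] by simp
    let ?O = "Omega_ob R A" and ?h = "arr3 (R A)"
    have hh: "arr ?h" "dm ?h = A" "cd ?h = So ?O" "?O \<in> Ob C" using t r(3) om by simp_all
    have p: "phi ?O (?h \<cdot> f) = phi ?O ?h \<cdot> Gm f"
      using phi_nat[of ?h ?O "Ide C ?O" f] hh f by simp
    have "Tri B K ?O g k (phi ?O ?h \<cdot> Gm f) \<in> Dist opc \<longleftrightarrow> Tri ?O K B k g (?h \<cdot> f) \<in> Dist C"
    proof
      assume "Tri ?O K B k g (?h \<cdot> f) \<in> Dist C"
      from op_tri_Dist[OF this] show "Tri B K ?O g k (phi ?O ?h \<cdot> Gm f) \<in> Dist opc" by (simp add: op_tri_def p)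
    next
      assume "Tri B K ?O g k (phi ?O ?h \<cdot> Gm f) \<in> Dist opc"
      then obtain t' where t': "t' \<in> Dist C" "Tri B K ?O g k (phi ?O ?h \<cdot> Gm f) = op_tri t'" by (rule Dist_opcE)
      obtain A1 B1 D1 f1 g1 h1 where tt: "t' = Tri A1 B1 D1 f1 g1 h1" by (cases t')
      have e: "A1 = ?O" "B1 = K" "D1 = B" "f1 = k" "g1 = g" "phi ?O (?h \<cdot> f) = phi ?O h1"
        using t'(2) unfolding tt op_tri_def p by auto
      have d1: "dt k g h1" "?O = dm k" "K = cd k" "B = cd g" using t'(1) unfolding tt e Dist_iff by simp_all
      note t1 = dt_arr[OF d1(1)]
      have "?h \<cdot> f = h1" by (rule phi_inject[OF _ _ _ _ _ _ e(6)]) (use hh f t1 d1(2-4) in auto)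
      then show "Tri ?O K B k g (?h \<cdot> f) \<in> Dist C" using t'(1) unfolding tt e by simp
    qed
    then show ?thesis by simp
  qed
  have "t \<in> left_triangles C X R U \<longleftrightarrow> t \<in> right_triangles_for opc X (op_tri \<circ> R) (Omega_functor C X R) U" for t
  proof -
    have "t \<in> left_triangles C X R U \<longleftrightarrow> (\<exists>A\<in>U. \<exists>B\<in>U. \<exists>f\<in>Hom C B A. \<exists>K g k.
       Tri (Omega_ob R A) K B k g (arr3 (R A) \<cdot> f) \<in> Dist C \<and>
       tri_isomorphic (subfactor opc X U) (Omega_functor C X R)
       (Tri A B K (quot_class C X f) (quot_class C X g) (quot_class C X k)) t)"
      unfolding left_triangles_def O_subfactor by blast
    also have "\<dots> \<longleftrightarrow> (\<exists>A\<in>U. \<exists>B\<in>U. \<exists>f\<in>Hom C B A. \<exists>K g k.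
       Tri B K (Sigma_ob (op_tri \<circ> R) A) g k (O.S f \<cdot>\<^bsub>opc\<^esub> arr3 ((op_tri \<circ> R) A)) \<in> Dist opc \<and>
       tri_isomorphic (subfactor opc X U) (Omega_functor C X R)
       (Tri A B K (quot_class C X f) (quot_class C X g) (quot_class C X k)) t)"
      using d by (intro bex_cong ex_cong1 conj_cong refl) blast
    also have "\<dots> \<longleftrightarrow> t \<in> right_triangles_for opc X (op_tri \<circ> R) (Omega_functor C X R) U"
      unfolding right_triangles_for_def O_quot_class opc_simps(2) by simp
    finally show ?thesis .
  qed
  then show ?thesis by blast
qed

lemma O_left_structure:
  assumes R: "right_approx_choice C X U R" and U: "U \<subseteq> Ob C"
  shows "left_structure C X R U = add_triangles (subfactor opc X U) (Omega_functor C X R)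
    (right_triangles_for opc X (op_tri \<circ> R) (Omega_functor C X R) U)"
  unfolding left_structure_def O_left_triangles[OF R U] O_subfactor ..

end

section \<open>Frobenius subfactors are triangulated on both sides\<close>

context tri
begin

lemma frobenius_right_triangulated:
  assumes "subcategory C X" "left_approx_choice C X U L" "right_approx_choice C X U R" "frobenius C X L R U"
  shows "triangulated (right_structure C X L U)"
proof -
  interpret f0: right_frobenius C X U L by (rule frobenius_imp_right_frobenius[OF assms])
  interpret f1: frobenius_functor C X U L "Sigma_functor C X L" by (rule f0.frobenius_functor_Sigma)
  show ?thesis unfolding right_structure_def right_triangles_eq by (rule f1.triangulated_D)
qed

lemma frobenius_left_triangulated:
  assumes "subcategory C X" "left_approx_choice C X U L" "right_approx_choice C X U R" "frobenius C X L R U"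
  shows "triangulated (left_structure C X R U)"
proof -
  obtain G \<eta> where "opp C G \<eta>" using opp_ex by blast
  then interpret opp C G \<eta> .
  interpret f: frobenius_functor opc X U "op_tri \<circ> R" "Omega_functor C X R" by (rule O_frobenius_functor[OF assms])
  have U: "U \<subseteq> Ob C" using assms(4) by (simp add: frobenius_def subcategory_def additive_subcategory_def)
  show ?thesis unfolding O_left_structure[OF assms(3) U] by (rule f.triangulated_D)
qed

lemma frobenius_triangulated:
  assumes "subcategory C X" "left_approx_choice C X U L" "right_approx_choice C X U R" "frobenius C X L R U"
  shows "subfactor_triangulated C X L R U"
  unfolding subfactor_triangulated_def
  using frobenius_right_triangulated[OF assms] frobenius_left_triangulated[OF assms] by blast

end

section \<open>Thick subcategories of the quotient\<close>

lemma iso_arrow_op_cat: "iso_arrow (op_cat K) A B f \<longleftrightarrow> iso_arrow K B A f"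
  by (auto simp: iso_arrow_def op_cat_def)

lemma isomorphic_op_cat: "isomorphic (op_cat K) A B \<longleftrightarrow> isomorphic K B A"
  unfolding isomorphic_def iso_arrow_op_cat by (auto simp: op_cat_def)

lemma quot_cat_eq_subfactor: "quot_cat K X = subfactor K X (Ob K)"
  by (simp add: subfactor_def quot_cat_def)

context subfactor_cat
begin

text \<open>If \<open>rs\<close> differs from the identity of \<open>A\<close> by \<open>ba\<close> through \<open>Y \<in> X\<close>, then \<open>A\<close> is a direct summand of \<open>P \<oplus> Y\<close>.\<close>

lemma retract_closed:
  assumes si: "split_idempotents C" and XW: "X \<subseteq> W" and W: "subcategory C W" and P: "P \<in> W"
    and r: "arr r" "dm r = P" "cd r = A" and s: "arr s" "dm s = A" "cd s = P" and e: "eqv (r \<cdot> s) (Ide C A)"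
  shows "A \<in> W"
proof -
  have o: "A \<in> Ob C" "P \<in> Ob C" using r by auto
  have "fac (r \<cdot> s \<boxplus> ng (Ide C A))" using e by (simp add: eqv_def)
  then obtain a b where ab: "arr a" "arr b" "dm b = cd a" "cd a \<in> X" "r \<cdot> s \<boxplus> ng (Ide C A) = b \<cdot> a" by (rule facE)
  have "dm (r \<cdot> s \<boxplus> ng (Ide C A)) = A" "cd (r \<cdot> s \<boxplus> ng (Ide C A)) = A" using r s o by simp_all
  then have ta: "dm a = A" "cd b = A" unfolding ab(5) using ab(1-3) by simp_all
  let ?Y = "cd a"
  obtain Z where Z: "biproduct C P ?Y Z" using biproducts[of P ?Y] o ab(1) by auto
  then have ZW: "Z \<in> W" using W P ab(4) XW unfolding subcategory_def additive_subcategory_def by blast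
  obtain i j p q where bp: "biprod i j p q" "dm i = P" "dm j = ?Y" "cd i = Z" using Z unfolding biproduct_iff by blast
  have t: "arr i" "arr j" "arr p" "arr q" "cd j = Z" "dm p = Z" "dm q = Z" "cd p = P" "cd q = ?Y"
    and eq: "p \<cdot> i = Ide C P" "q \<cdot> j = Ide C ?Y" "p \<cdot> j = Zer C ?Y P" "q \<cdot> i = Zer C P ?Y"
    using bp unfolding biprod_def by auto
  have ZO: "Z \<in> Ob C" using t(1) bp(4) by auto
  \<comment> \<open>In matrix form \<open>\<sigma>\<close> is the column of \<open>s\<close> and
    minus \<open>a\<close>, and \<open>\<rho>\<close> the row of \<open>r\<close> and
    \<open>b\<close>; their product is \<open>r \<cdot> s\<close> minus \<open>b \<cdot> a\<close>,
    the identity.\<close>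
  define \<sigma> where "\<sigma> = i \<cdot> s \<boxplus> ng (j \<cdot> a)"
  define \<rho> where "\<rho> = r \<cdot> p \<boxplus> b \<cdot> q"
  have st: "arr \<sigma>" "dm \<sigma> = A" "cd \<sigma> = Z" "arr \<rho>" "dm \<rho> = Z" "cd \<rho> = A"
    unfolding \<sigma>_def \<rho>_def using r s ab(1-3) ta t bp(2-4) o by simp_all
  have "\<rho> \<cdot> \<sigma> = r \<cdot> s \<boxplus> ng (b \<cdot> a)"
    unfolding \<sigma>_def \<rho>_def using r s ab(1-3) ta t bp(2-4) o
    by (simp add: comp_rewrite[OF eq(1)] comp_rewrite[OF eq(2)] comp_rewrite[OF eq(3)] comp_rewrite[OF eq(4)])
  also have "\<dots> = r \<cdot> s \<boxplus> ng (r \<cdot> s \<boxplus> ng (Ide C A))" unfolding ab(5) ..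
  also have "ng (r \<cdot> s \<boxplus> ng (Ide C A)) = ng (r \<cdot> s) \<boxplus> ng (ng (Ide C A))" by (rule ng_add) (use r s o in auto)
  also have "r \<cdot> s \<boxplus> (ng (r \<cdot> s) \<boxplus> ng (ng (Ide C A))) = Ide C A" using r s o by simp
  finally have rs: "\<rho> \<cdot> \<sigma> = Ide C A" .
  \<comment> \<open>Closure under summands is phrased with biproducts, so a retraction alone does
    not suffice. Splitting the complementary idempotent supplies the other summand.\<close>
  define c where "c = Ide C Z \<boxplus> ng (\<sigma> \<cdot> \<rho>)"
  have tc: "arr c" "dm c = Z" "cd c = Z" unfolding c_def using st ZO by simp_all
  have cs: "c \<cdot> \<sigma> = Zer C A Z" and rc: "\<rho> \<cdot> c = Zer C Z A"
    unfolding c_def using st ZO o by (simp_all add: rs comp_rewrite[OF rs])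
  have "c \<cdot> c = c \<boxplus> ng (c \<cdot> (\<sigma> \<cdot> \<rho>))" by (subst (2) c_def) (use tc st ZO in simp)
  also have "c \<cdot> (\<sigma> \<cdot> \<rho>) = Zer C Z Z" using tc st ZO o by (simp add: comp_rewrite[OF cs])
  finally have cc: "c \<cdot> c = c" using tc ZO by simp
  have "c \<in> Hom C Z Z" using tc ZO by simp
  then obtain B r' s' where B: "B \<in> Ob C" "r' \<in> Hom C Z B" "s' \<in> Hom C B Z" "s' \<cdot> r' = c" "r' \<cdot> s' = Ide C B"
    using si cc ZO unfolding split_idempotents_def by blast
  have tt: "arr r'" "dm r' = Z" "cd r' = B" "arr s'" "dm s' = B" "cd s' = Z" using B ZO by simp_all
  have 1: "\<rho> \<cdot> s' = Zer C B A"
  proof -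
    have "(\<rho> \<cdot> c) \<cdot> s' = \<rho> \<cdot> s'" unfolding B(4)[symmetric] using st tt B(1) by (simp add: B(5))
    then show ?thesis unfolding rc using tt o by simp
  qed
  have 2: "r' \<cdot> \<sigma> = Zer C A B"
  proof -
    have "r' \<cdot> (c \<cdot> \<sigma>) = r' \<cdot> \<sigma>" unfolding B(4)[symmetric] using st tt B(1) by (simp add: comp_rewrite[OF B(5)])
    then show ?thesis unfolding cs using tt o by simp
  qed
  have 3: "\<sigma> \<cdot> \<rho> \<boxplus> s' \<cdot> r' = Ide C Z"
    unfolding B(4) c_def using st ZO by (simp add: add_left_comm[of "\<sigma> \<cdot> \<rho>" "Ide C Z"])
  have "biprod \<sigma> s' \<rho> r'" unfolding biprod_def using st tt rs B(5) 1 2 3 by simp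
  then have "biproduct C A B Z" unfolding biproduct_iff using st tt by blast
  then show ?thesis using W ZW unfolding subcategory_def closed_under_summands_def by blast
qed

section \<open>Subcategories of \<open>C\<close> against subcategories of the quotient\<close>

lemma Q_retract_closed:
  assumes "split_idempotents C" "X \<subseteq> W" "subcategory C W" "P \<in> W" "P \<in> U" "A \<in> U"
    and G: "G \<in> Hom Q P A" and H: "H \<in> Hom Q A P" and GH: "G \<cdot>\<^bsub>Q\<^esub> H = Ide Q A"
  shows "A \<in> W"
proof -
  have o: "A \<in> Ob C" "P \<in> Ob C" using assms by simp_all
  obtain r where r: "r \<in> Hom C P A" "G = cls r" using G unfolding Q_simps by blast
  obtain s where s: "s \<in> Hom C A P" "H = cls s" using H unfolding Q_simps by blast
  have t: "arr r" "dm r = P" "cd r = A" "arr s" "dm s = A" "cd s = P" using r s o by simp_all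
  have "cls (r \<cdot> s) = cls (Ide C A)" using GH unfolding r(2) s(2) using t by simp
  then have "eqv (r \<cdot> s) (Ide C A)" using t by (simp add: cls_eq_iff)
  then show ?thesis using retract_closed[OF assms(1-4) t] by blast
qed

lemma Q_isomorphic_closed:
  assumes "split_idempotents C" "X \<subseteq> W" "subcategory C W" "isomorphic Q A B" "A \<in> W"
  shows "B \<in> W"
proof -
  obtain G H where "A \<in> U" "B \<in> U" "G \<in> Hom Q A B" "H \<in> Hom Q B A" "G \<cdot>\<^bsub>Q\<^esub> H = Ide Q B"
    using assms(4) unfolding isomorphic_def iso_arrow_def Q_simps(1) by blast
  then show ?thesis using Q_retract_closed[OF assms(1-3,5)] by blast
qed

lemma Q_isomorphic_sym: "isomorphic Q A B \<Longrightarrow> isomorphic Q B A"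
  unfolding isomorphic_def iso_arrow_def by blast

text \<open>A biproduct formed in the quotient is, modulo \<open>X\<close>, a retract of the
  biproduct formed in \<open>C\<close>, and \<open>retract_closed\<close> admits it; summands and
  isomorphic objects are retracts modulo \<open>X\<close> as well.\<close>

lemma subcategory_Q:
  assumes si: "split_idempotents C" and XW: "X \<subseteq> W" and W: "subcategory C W" and WU: "W \<subseteq> U"
  shows "additive_subcategory Q W" "closed_under_summands Q W"
proof -
  show "closed_under_summands Q W"
    unfolding closed_under_summands_def
  proof (intro ballI allI impI)
    fix P A B assume P: "P \<in> W" "biproduct Q A B P"
    then obtain i p where "A \<in> U" "P \<in> U" "i \<in> Hom Q A P" "p \<in> Hom Q P A" "p \<cdot>\<^bsub>Q\<^esub> i = Ide Q A"
      unfolding biproduct_def Q_simps(1) by blast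
    then show "A \<in> W" using Q_retract_closed[OF si XW W P(1)] by blast
  qed
  have "P \<in> W" if AB: "A \<in> W" "B \<in> W" and P: "biproduct Q A B P" for A B P
  proof -
    have o: "A \<in> Ob C" "B \<in> Ob C" using AB WU by auto
    have PU: "P \<in> U" and PO: "P \<in> Ob C" using P unfolding biproduct_def Q_simps(1) by auto
    obtain I J K M where IJ: "I \<in> Hom Q A P" "J \<in> Hom Q B P" "K \<in> Hom Q P A" "M \<in> Hom Q P B"
      "I \<cdot>\<^bsub>Q\<^esub> K \<boxplus>\<^bsub>Q\<^esub> J \<cdot>\<^bsub>Q\<^esub> M = Ide Q P" using P unfolding biproduct_def by blast
    obtain i j p q where c: "i \<in> Hom C A P" "I = cls i" "j \<in> Hom C B P" "J = cls j" "p \<in> Hom C P A" "K = cls p"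
      "q \<in> Hom C P B" "M = cls q" using IJ(1-4) unfolding Q_simps by blast
    have t: "arr i" "dm i = A" "cd i = P" "arr j" "dm j = B" "cd j = P" "arr p" "dm p = P" "cd p = A"
      "arr q" "dm q = P" "cd q = B" using c o PO by simp_all
    have "cls (i \<cdot> p \<boxplus> j \<cdot> q) = cls (Ide C P)" using IJ(5) unfolding c(2,4,6,8) using t by simp
    then have e: "eqv (i \<cdot> p \<boxplus> j \<cdot> q) (Ide C P)" using t by (simp add: cls_eq_iff)
    obtain Z where Z: "biproduct C A B Z" using biproducts[OF o] by blast
    then have ZW: "Z \<in> W" using W AB unfolding subcategory_def additive_subcategory_def by blast
    obtain i' j' p' q' where b: "biprod i' j' p' q'" "dm i' = A" "dm j' = B" "cd i' = Z" using Z unfolding biproduct_iff by blast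
    have t': "arr i'" "arr j'" "arr p'" "arr q'" "cd j' = Z" "dm p' = Z" "dm q' = Z" "cd p' = A" "cd q' = B"
      and eq: "p' \<cdot> i' = Ide C A" "q' \<cdot> j' = Ide C B" "p' \<cdot> j' = Zer C B A" "q' \<cdot> i' = Zer C A B"
      using b unfolding biprod_def by auto
    have "(i \<cdot> p' \<boxplus> j \<cdot> q') \<cdot> (i' \<cdot> p \<boxplus> j' \<cdot> q) = i \<cdot> p \<boxplus> j \<cdot> q"
      using t t' b(2-4) o PO
      by (simp add: comp_rewrite[OF eq(1)] comp_rewrite[OF eq(2)] comp_rewrite[OF eq(3)] comp_rewrite[OF eq(4)])
    then show ?thesis
      by (intro retract_closed[OF si XW W ZW, of "i \<cdot> p' \<boxplus> j \<cdot> q'" P "i' \<cdot> p \<boxplus> j' \<cdot> q"]) (use t t' b(2-4) e in auto)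
  qed
  moreover have "\<exists>Z\<in>W. zero_object Q Z"
    using W zero_object_Q WU unfolding subcategory_def additive_subcategory_def by blast
  moreover have "B \<in> W" if "A \<in> W" "isomorphic Q A B" for A B
    using Q_isomorphic_closed[OF si XW W that(2,1)] .
  ultimately show "additive_subcategory Q W" unfolding additive_subcategory_def Q_simps(1) using WU by blast
qed

lemma isomorphic_Q:
  assumes "isomorphic C A B" "A \<in> U" "B \<in> U"
  shows "isomorphic Q A B"
proof -
  obtain f g where f: "f \<in> Hom C A B" "g \<in> Hom C B A" "g \<cdot> f = Ide C A" "f \<cdot> g = Ide C B"
    using assms(1) unfolding isomorphic_def iso_arrow_def by blast
  then have t: "arr f" "dm f = A" "cd f = B" "arr g" "dm g = B" "cd g = A" using assms(2,3) by simp_all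
  have "cls f \<in> Hom Q A B" "cls g \<in> Hom Q B A" using f(1,2) by simp_all
  moreover have "cls g \<cdot>\<^bsub>Q\<^esub> cls f = Ide Q A" "cls f \<cdot>\<^bsub>Q\<^esub> cls g = Ide Q B" using t f(3,4) by simp_all
  moreover have "A \<in> Ob Q" "B \<in> Ob Q" using assms(2,3) by simp_all
  ultimately show ?thesis unfolding isomorphic_def iso_arrow_def by blast
qed

text \<open>Objects of \<open>X\<close> become zero objects in the quotient, and \<open>W\<close>
  contains all objects isomorphic to one of its zero objects.\<close>

lemma X_subset:
  assumes S: "additive_subcategory Q W" and XU: "X \<subseteq> U"
  shows "X \<subseteq> W"
proof
  fix Y assume Y: "Y \<in> X"
  interpret Q: preadd Q by (rule preadd_Q)
  obtain Z where Z: "Z \<in> W" "Q.zob Z" using S unfolding additive_subcategory_def Q.zob_iff by blast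
  have YU: "Y \<in> U" using Y XU by blast
  have "fac (Ide C Y \<cdot> Ide C Y)" by (rule facI) (use Y in auto)
  then have "cls (Ide C Y) = cls (Zer C Y Y)" using cls_eq_zero_iff[of "Ide C Y"] Y by simp
  then have zY: "Q.zob Y" using YU by (simp add: Q.zob_def)
  have o: "Y \<in> Ob Q" "Z \<in> Ob Q" using YU Q.zobD(1)[OF Z(2)] by simp_all
  have "Q.isom (Zer Q Z Y)"
  proof (rule Q.isomI)
    show "Zer Q Y Z \<cdot>\<^bsub>Q\<^esub> Zer Q Z Y = Ide Q (Q.dm (Zer Q Z Y))"
      using Q.Zer_comp[of "Zer Q Z Y" Z Y] Z(2) o by (simp only: Q.Zer_arr Q.zob_def)
    show "Zer Q Z Y \<cdot>\<^bsub>Q\<^esub> Zer Q Y Z = Ide Q (Q.cd (Zer Q Z Y))"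
      using Q.Zer_comp[of "Zer Q Y Z" Y Z] zY o by (simp only: Q.Zer_arr Q.zob_def)
  qed (use o in \<open>simp_all only: Q.Zer_arr\<close>)
  then have "isomorphic Q Z Y" unfolding Q.isomorphic_iff using o Q.Zer_arr by blast
  then show "Y \<in> W" using S Z(1) unfolding additive_subcategory_def by blast
qed

lemma subcategory_of_Q:
  assumes S: "additive_subcategory Q W" "closed_under_summands Q W" and XU: "X \<subseteq> U" and U: "U = Ob C"
  shows "subcategory C W"
proof -
  have WU: "W \<subseteq> U" using S(1) unfolding additive_subcategory_def Q_simps(1) by blast
  have XW: "X \<subseteq> W" by (rule X_subset[OF S(1) XU])
  have "\<exists>Z\<in>W. zero_object C Z" using additive_X XW unfolding additive_subcategory_def by blast
  moreover have "P \<in> W" if "A \<in> W" "B \<in> W" "biproduct C A B P" for A B P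
  proof -
    have "biproduct Q A B P" by (rule biproduct_Q[OF that(3)]) (use that WU U in \<open>auto simp: biproduct_def\<close>)
    then show ?thesis using S(1) that unfolding additive_subcategory_def by blast
  qed
  moreover have "B \<in> W" if "A \<in> W" "isomorphic C A B" for A B
  proof -
    have "isomorphic Q A B" by (rule isomorphic_Q[OF that(2)]) (use that WU U in \<open>auto simp: isomorphic_def\<close>)
    then show ?thesis using S(1) that unfolding additive_subcategory_def by blast
  qed
  moreover have "A \<in> W" if "P \<in> W" "biproduct C A B P" for A B P
  proof -
    have "biproduct Q A B P" by (rule biproduct_Q[OF that(2)]) (use that WU U in \<open>auto simp: biproduct_def\<close>)
    then show ?thesis using S(2) that unfolding closed_under_summands_def by blast
  qed
  ultimately show ?thesis
    unfolding subcategory_def additive_subcategory_def closed_under_summands_def using WU U by blast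
qed

end

section \<open>Restricting the triangulated structure to a subcategory\<close>

lemma tri_isomorphic_subfactor:
  assumes "W \<subseteq> Ob K"
  shows "tri_isomorphic (subfactor K X W) F s t \<longleftrightarrow> tri_isomorphic (subfactor K X (Ob K)) F s t \<and>
    ob1 s \<in> W \<and> ob2 s \<in> W \<and> ob3 s \<in> W \<and> ob1 t \<in> W \<and> ob2 t \<in> W \<and> ob3 t \<in> W"
  using assms unfolding tri_isomorphic_def candidate_def tri_mor_def iso_arrow_def subfactor_def by auto

lemma tri_isomorphic_isomorphic:
  assumes "tri_isomorphic K F s t"
  shows "isomorphic K (ob1 s) (ob1 t)" "isomorphic K (ob2 s) (ob2 t)" "isomorphic K (ob3 s) (ob3 t)"
  using assms unfolding tri_isomorphic_def candidate_def isomorphic_def by blast+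

context
  fixes K :: "('o, 'm, 'z) tcat_scheme" and X W :: "'o set" and L :: "'o \<Rightarrow> ('o, 'm) tri" and F :: "('o, 'm set, 'o, 'm set) func"
  assumes W: "W \<subseteq> Ob K"
    and iso: "\<And>A B. isomorphic (subfactor K X (Ob K)) A B \<Longrightarrow> A \<in> W \<longleftrightarrow> B \<in> W"
    and ext: "closed_under_extensions K W"
    and L: "\<And>A. A \<in> W \<Longrightarrow> Sigma_ob L A \<in> W"
begin

text \<open>A right triangle is represented by an ambient triangle \<open>B \<rightarrow> D
  \<rightarrow> \<Sigma> A \<rightarrow> B[1]\<close> whose outer terms lie in \<open>W\<close>, so
  extension closure captures \<open>D\<close>.\<close>

lemma right_triangles_for_closed:
  assumes "t \<in> right_triangles_for K X L F (Ob K)" "ob1 t \<in> W" "ob2 t \<in> W"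
  shows "ob3 t \<in> W" "t \<in> right_triangles_for K X L F W"
proof -
  obtain A B f D g k where AB: "A \<in> Ob K" "B \<in> Ob K" "f \<in> Hom K A B"
    and d: "Tri B D (Sigma_ob L A) g k (shift_map K f \<cdot>\<^bsub>K\<^esub> arr3 (L A)) \<in> Dist K"
    and i: "tri_isomorphic (subfactor K X (Ob K)) F (Tri A B D (quot_class K X f) (quot_class K X g) (quot_class K X k)) t"
    using assms(1) unfolding right_triangles_for_def by blast
  note ii = tri_isomorphic_isomorphic[OF i]
  have AW: "A \<in> W" "B \<in> W" using iso[OF ii(1)] iso[OF ii(2)] assms(2,3) by simp_all
  have DW: "D \<in> W" using ext d AW(2) L[OF AW(1)] unfolding closed_under_extensions_def by fastforce
  then show t3: "ob3 t \<in> W" using iso[OF ii(3)] by simp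
  have "tri_isomorphic (subfactor K X W) F (Tri A B D (quot_class K X f) (quot_class K X g) (quot_class K X k)) t"
    unfolding tri_isomorphic_subfactor[OF W] using i AW DW assms t3 by simp
  then show "t \<in> right_triangles_for K X L F W"
    unfolding right_triangles_for_def using AW AB d by blast
qed

text \<open>This links the two halves of the theorem: restricting the structure of the full quotient
  gives the structure built on \<open>W\<close> itself. \<open>K\<close> and \<open>F\<close> are
  left general so that it serves on both sides.\<close>

lemma restrict_right_triangles_for:
  "restrict_tcat (add_triangles (subfactor K X (Ob K)) F (right_triangles_for K X L F (Ob K))) W =
    add_triangles (subfactor K X W) F (right_triangles_for K X L F W)"
proof -
  have "t \<in> right_triangles_for K X L F (Ob K) \<and> ob1 t \<in> W \<and> ob2 t \<in> W \<and> ob3 t \<in> W"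
    if "t \<in> right_triangles_for K X L F W" for t
    using that W unfolding right_triangles_for_def tri_isomorphic_subfactor[OF W] by blast
  then have "{t \<in> right_triangles_for K X L F (Ob K). ob1 t \<in> W \<and> ob2 t \<in> W \<and> ob3 t \<in> W} = right_triangles_for K X L F W"
    using right_triangles_for_closed by blast
  then show ?thesis unfolding restrict_tcat_def add_triangles_def subfactor_def by simp
qed

end

section \<open>Frobenius subcategories and thick subcategories\<close>

context tri
begin

lemma additive_subcategory_Ob: "additive_subcategory C (Ob C)"
  using additive_C unfolding additive_subcategory_def additive_def isomorphic_def biproduct_def zero_object_def by blast

lemma subfactor_cat_Ob:
  assumes "additive_subcategory C X"
  shows "subfactor_cat C X (Ob C)"
proof
  show "\<exists>P. biproduct C A B P" if "A \<in> Ob C" "B \<in> Ob C" for A B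
    using additive_C that by (simp add: additive_def)
qed (rule assms additive_subcategory_Ob)+

text \<open>The restricted structures coincide with those built on \<open>W\<close>, so the
  triangulation of \<open>W/X\<close> already proved applies to them; the left one is treated in the
  opposite category.\<close>

lemma frobenius_thick:
  assumes si: "split_idempotents C" and X: "subcategory C X"
    and L: "left_approx_choice C X (Ob C) L" and R: "right_approx_choice C X (Ob C) R"
    and F: "frobenius C X L R W"
  shows "thick_subcategory C X L R W"
proof -
  obtain G \<eta> where "opp C G \<eta>" using opp_ex by blast
  then interpret opp C G \<eta> .
  interpret subfactor_cat C X "Ob C" by (rule subfactor_cat_Ob) (use X in \<open>simp add: subcategory_def\<close>)
  have W: "subcategory C W" "closed_under_extensions C W" "X \<subseteq> W" and SO: "\<And>A. A \<in> W \<Longrightarrow> Sigma_ob L A \<in> W \<and> Omega_ob R A \<in> W"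
    using F by (simp_all add: frobenius_def functorially_finite_def)
  have WO: "W \<subseteq> Ob C" using W(1) by (simp add: subcategory_def additive_subcategory_def)
  have LW: "left_approx_choice C X W L" and RW: "right_approx_choice C X W R"
    using L R WO unfolding left_approx_choice_def right_approx_choice_def by blast+
  have iso: "A \<in> W \<longleftrightarrow> B \<in> W" if "isomorphic (subfactor C X (Ob C)) A B" for A B
    using Q_isomorphic_closed[OF si W(3,1)] that Q_isomorphic_sym by blast
  have iso': "A \<in> W \<longleftrightarrow> B \<in> W" if "isomorphic (subfactor opc X (Ob opc)) A B" for A B
    using iso[of B A] that unfolding opc_simps(1) O_subfactor isomorphic_op_cat by blast
  note r = right_triangles_for_closed[where K=C and X=X and W=W and L=L, OF WO iso W(2)]
    restrict_right_triangles_for[where K=C and X=X and W=W and L=L, OF WO iso W(2)]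
  have WO': "W \<subseteq> Ob opc" using WO by simp
  have SO': "A \<in> W \<Longrightarrow> Sigma_ob (op_tri \<circ> R) A \<in> W" for A using SO by simp
  note l = right_triangles_for_closed[where K=opc and X=X and W=W and L="op_tri \<circ> R", OF WO' iso' O_closed_under_extensions[OF W(2)] SO']
    restrict_right_triangles_for[where K=opc and X=X and W=W and L="op_tri \<circ> R", OF WO' iso' O_closed_under_extensions[OF W(2)] SO']
  have "restrict_tcat (right_structure C X L (Ob C)) W = right_structure C X L W"
    unfolding right_structure_def right_triangles_eq using r(3) SO by blast
  then have "triangulated (restrict_tcat (right_structure C X L (Ob C)) W)"
    using frobenius_right_triangulated[OF X LW RW F] by simp
  moreover have "restrict_tcat (left_structure C X R (Ob C)) W = left_structure C X R W"
    unfolding O_left_structure[OF R order_refl] O_left_structure[OF RW WO] using l(3) by simp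
  then have "triangulated (restrict_tcat (left_structure C X R (Ob C)) W)"
    using frobenius_left_triangulated[OF X LW RW F] by simp
  moreover have "ob3 t \<in> W" if "t \<in> right_triangles C X L (Ob C)" "ob1 t \<in> W" "ob2 t \<in> W" for t
    using r(1) SO that unfolding right_triangles_eq by blast
  moreover have "ob3 t \<in> W" if "t \<in> left_triangles C X R (Ob C)" "ob1 t \<in> W" "ob2 t \<in> W" for t
    using l(1) that unfolding O_left_triangles[OF R order_refl] by simp
  ultimately show ?thesis
    unfolding thick_subcategory_def triangulated_subcategory_def quot_cat_eq_subfactor
    using subcategory_Q[OF si W(3,1) WO] SO by blast
qed

text \<open>Up to a summand through \<open>X\<close>, every object of \<open>W\<close> is some \<open>\<Sigma>B\<close>; a ghost \<open>\<Sigma>B \<rightarrow> Y[1]\<close> factors as \<open>w[1] \<circ> h\<close>,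
  and \<open>w : B \<rightarrow> Y\<close> extends along \<open>B \<rightarrow> X\<^sup>B\<close>.\<close>

lemma Gh_shift_zero:
  assumes q: "subfactor_cat C X (Ob C)" and L: "left_approx_choice C X (Ob C) L" and W: "W \<subseteq> Ob C"
    and Fo: "\<And>A. A \<in> W \<Longrightarrow> fob F A = Sigma_ob L A"
    and M: "triangulated (restrict_tcat (add_triangles (subfactor C X (Ob C)) F \<Delta>) W)"
    and A: "A \<in> W" and Y: "Y \<in> X"
  shows "Gh C X A (So Y) = {Zer C A (So Y)}"
proof -
  interpret subfactor_cat C X "Ob C" by (rule q)
  let ?M = "restrict_tcat (add_triangles (subfactor C X (Ob C)) F \<Delta>) W"
  interpret M: tri ?M by (rule triangulated_tri[OF M])
  have m: "Ob ?M = W" "Hom ?M = Hom Q" "Comp ?M = Comp Q" "Ide ?M = Ide Q" "Shift ?M = F"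
    by (simp_all add: restrict_tcat_def add_triangles_def)
  obtain B e where B: "B \<in> W" "M.isom e" "M.dm e = fob F B" "M.cd e = A"
    using M.dense[of A] A unfolding m by blast
  have "fob F B \<in> Ob ?M" using M.shift_simps(1)[of B] B(1) unfolding m by simp
  then have ia: "iso_arrow ?M (fob F B) A e" using M.iso_arrow_iff[of "fob F B" A e] B A unfolding m by simp
  let ?S = "Sigma_ob L B"
  obtain g where g: "e \<in> Hom Q ?S A" "g \<in> Hom Q A ?S" "e \<cdot>\<^bsub>Q\<^esub> g = Ide Q A"
    using ia Fo[OF B(1)] unfolding iso_arrow_def m by auto
  have BO: "B \<in> Ob C" "A \<in> Ob C" "Y \<in> Ob C" using B(1) A W Y by auto
  have d: "L B \<in> Dist C" "ob1 (L B) = B" "left_approx C X B (ob2 (L B)) (arr1 (L B))"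
    using L BO unfolding left_approx_choice_def by blast+
  obtain X0 D i p h where LB: "L B = Tri B X0 D i p h" using d(2) by (cases "L B") auto
  have dt: "dt i p h" "B = dm i" "X0 = cd i" "D = cd p" using d(1) unfolding LB Dist_iff by simp_all
  note t = dt_arr[OF dt(1)]
  have X0: "X0 \<in> X" and ap: "(\<lambda>u. u \<cdot> i) ` Hom C X0 Y = Hom C B Y"
    using d(3) Y unfolding LB left_approx_def by simp_all
  have S: "?S = D" "D \<in> Ob C" using LB dt(4) t by simp_all
  obtain u v where u: "u \<in> Hom C D A" "e = cls u" and v: "v \<in> Hom C A D" "g = cls v"
    using g(1,2) unfolding S Q_simps by blast
  have tu: "arr u" "dm u = D" "cd u = A" "arr v" "dm v = A" "cd v = D" using u v S BO by simp_all
  have "cls (u \<cdot> v) = cls (Ide C A)" using g(3) unfolding u(2) v(2) using tu by simp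
  then have "fac (u \<cdot> v \<boxplus> ng (Ide C A))" using tu by (simp add: cls_eq_iff eqv_def)
  \<comment> \<open>In the ambient category \<open>A\<close> is a retract of
    \<open>\<Sigma> B\<close> only up to this defect. A ghost kills the defect because it factors
    through \<open>X\<close>, so killing \<open>u\<close> is enough.\<close>
  then obtain a b where ab: "arr a" "arr b" "dm b = cd a" "cd a \<in> X" "u \<cdot> v \<boxplus> ng (Ide C A) = b \<cdot> a" by (rule facE)
  have "cd (u \<cdot> v \<boxplus> ng (Ide C A)) = A" "dm (u \<cdot> v \<boxplus> ng (Ide C A)) = A" using tu BO by simp_all
  then have cb: "cd b = A" "dm a = A" unfolding ab(5) using ab(1-3) by simp_all
  have "f = Zer C A (So Y)" if f: "f \<in> Gh C X A (So Y)" for f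
  proof -
    have tf: "arr f" "dm f = A" "cd f = So Y" using f BO by (simp_all add: Gh_def)
    have gh: "f \<cdot> x = Zer C (dm x) (So Y)" if "arr x" "dm x \<in> X" "cd x = A" for x
      using f that BO unfolding Gh_def by force
    have "f \<cdot> (u \<cdot> p) = Zer C (dm (u \<cdot> p)) (So Y)" by (rule gh) (use tu t dt X0 in auto)
    then have "(f \<cdot> u) \<cdot> p = Zer C (dm p) (cd (f \<cdot> u))" using tf tu t dt by simp
    then obtain x where x: "arr x" "dm x = So B" "cd x = So Y" "x \<cdot> h = f \<cdot> u"
      using dt_colift(2)[OF dt(1), of "f \<cdot> u"] tf tu t dt by auto
    obtain w where w: "arr w" "dm w = B" "cd w = Y" "x = S w" using full[of B Y x] x BO by auto
    have "w \<in> (\<lambda>u. u \<cdot> i) ` Hom C X0 Y" unfolding ap using w(1-3) BO by simp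
    then obtain y where y: "y \<in> Hom C X0 Y" "y \<cdot> i = w" by blast
    have ty: "arr y" "dm y = cd i" "cd y = Y" using y(1) X0 BO dt(3) by simp_all
    have "S (y \<cdot> i) \<cdot> h = Zer C D (So Y)" using ty t dt BO by (simp add: dt_zero(3)[OF dt(1)])
    then have fu: "f \<cdot> u = Zer C D (So Y)" using x(4) w(4) y(2) by simp
    have "f \<cdot> b = Zer C (dm b) (So Y)" by (rule gh) (use ab cb in auto)
    note fb = comp_rewrite[OF this]
    have "f \<cdot> (u \<cdot> v \<boxplus> ng (Ide C A)) = Zer C A (So Y)"
      unfolding ab(5) using ab(1-3) cb tf BO by (simp add: fb)
    then have "ng f = Zer C A (So Y)" using tf tu BO by (simp add: comp_rewrite[OF fu])
    then show ?thesis using ng_eq_Zer_iff[OF tf(1)] tf by simp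
  qed
  moreover have "Zer C A (So Y) \<in> Gh C X A (So Y)" using BO by (auto simp: Gh_def)
  ultimately show ?thesis by blast
qed

text \<open>\<open>Gh_shift_zero\<close> is applied twice. In the opposite category it yields the
  coghost condition at \<open>Go Y\<close>, which is then moved to every \<open>V\<close> whose
  shift is isomorphic to \<open>Y\<close>.\<close>

lemma thick_frobenius:
  assumes X: "subcategory C X" and ff: "functorially_finite C X (Ob C)"
    and L: "left_approx_choice C X (Ob C) L" and R: "right_approx_choice C X (Ob C) R"
    and T: "thick_subcategory C X L R W" and ext: "closed_under_extensions C W"
  shows "frobenius C X L R W"
proof -
  obtain G \<eta> where "opp C G \<eta>" using opp_ex by blast
  then interpret opp C G \<eta> .
  have aX: "additive_subcategory C X" using X by (simp add: subcategory_def)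
  have q: "subfactor_cat C X (Ob C)" by (rule subfactor_cat_Ob[OF aX])
  then interpret subfactor_cat C X "Ob C" .
  have q': "subfactor_cat opc X (Ob opc)" by (rule O.subfactor_cat_Ob) (use aX in \<open>simp add: O_additive_subcategory\<close>)
  have S: "additive_subcategory Q W" "closed_under_summands Q W"
    and SO: "\<And>A. A \<in> W \<Longrightarrow> Sigma_ob L A \<in> W \<and> Omega_ob R A \<in> W"
    and r: "triangulated (restrict_tcat (right_structure C X L (Ob C)) W)"
    and l: "triangulated (restrict_tcat (left_structure C X R (Ob C)) W)"
    using T unfolding thick_subcategory_def triangulated_subcategory_def quot_cat_eq_subfactor by blast+
  have XO: "X \<subseteq> Ob C" using aX by (simp add: additive_subcategory_def)
  have WO: "W \<subseteq> Ob C" using S(1) by (simp add: additive_subcategory_def)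
  have XW: "X \<subseteq> W" by (rule X_subset[OF S(1) XO])
  have W: "subcategory C W" by (rule subcategory_of_Q[OF S XO refl])
  have g: "Gh C X A (So Y) = {Zer C A (So Y)}" if "A \<in> W" "Y \<in> X" for A Y
    by (rule Gh_shift_zero[OF q L WO _ r[unfolded right_structure_def] that]) (simp add: Sigma_functor_def)
  have g': "Gh opc X A (Go Y) = {Zer opc A (Go Y)}" if "A \<in> W" "Y \<in> X" for A Y
  proof -
    note ch = O_left_approx_choice[OF R]
    have "Gh opc X A (O.So Y) = {Zer opc A (O.So Y)}"
      by (rule O.Gh_shift_zero[OF q' _ _ _ _ that, where L="op_tri \<circ> R"])
        (use ch WO l[unfolded O_left_structure[OF R order_refl]] in \<open>simp_all add: Omega_functor_def\<close>)
    then show ?thesis by simp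
  qed
  have "CoGh C X V A = {Zer C V A}" if h: "A \<in> W" "Y \<in> X" "V \<in> Ob C" "isomorphic C (So V) Y" for A Y V
  proof -
    have o: "A \<in> Ob C" "Y \<in> Ob C" using h WO XO by auto
    obtain a where a: "isom a" "dm a = So V" "cd a = Y" using h(4) unfolding isomorphic_iff by blast
    obtain a' where a': "isom a'" "dm a' = Y" "cd a' = So V" using isom_inverse[OF a(1)] a by auto
    have i: "isom (a' \<cdot> \<eta> Y)" by (rule isom_comp) (use a' o in auto)
    \<comment> \<open>The shifts of \<open>Go Y\<close> and of \<open>V\<close> are both isomorphic
      to \<open>Y\<close>; the resulting isomorphism between them desuspends.\<close>
    obtain e where e: "arr e" "dm e = Go Y" "cd e = V" "S e = a' \<cdot> \<eta> Y"
      using full[of "Go Y" V "a' \<cdot> \<eta> Y"] a' o h(3) by auto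
    have ie: "isom e" by (rule isom_shiftD) (use e i in auto)
    have "f = Zer C V A" if f: "f \<in> CoGh C X V A" for f
    proof -
      have tf: "arr f" "dm f = V" "cd f = A" using f o h(3) by (simp_all add: CoGh_def)
      have "x \<cdot> (f \<cdot> e) = Zer C (Go Y) Z" if "Z \<in> X" "x \<in> Hom C A Z" for Z x
      proof -
        have Z: "Z \<in> Ob C" using that XO by blast
        have "x \<cdot> f = Zer C V Z" using f that unfolding CoGh_def by blast
        then show ?thesis using that Z o tf e by (simp add: comp_rewrite)
      qed
      moreover have "f \<cdot> e \<in> Hom C (Go Y) A" using tf e(1-3) o by simp
      ultimately have "f \<cdot> e \<in> CoGh C X (Go Y) A" unfolding CoGh_def by blast
      then have "f \<cdot> e = Zer C V A \<cdot> e" using g'[OF h(1,2)] e(1-3) o h(3) unfolding O_Gh by simp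
      then show ?thesis by (rule isom_cancel_right[OF ie, rotated -1]) (use tf e(1-3) o h(3) in auto)
    qed
    moreover have "Zer C V A \<in> CoGh C X V A" using o h(3) XO by (auto simp: CoGh_def)
    ultimately show ?thesis by blast
  qed
  moreover have "functorially_finite C X W" using ff XW WO unfolding functorially_finite_def by blast
  ultimately show ?thesis unfolding frobenius_def using W ext g SO by blast
qed

end

theorem theoremD:
  fixes T :: "('o, 'm) tcat" and X :: "'o set"
  assumes "triangulated T" and "split_idempotents T" and "subcategory T X"
  shows
    "(\<forall>U L R. X \<subseteq> U \<and> subcategory T U \<and>
        left_approx_choice T X U L \<and> right_approx_choice T X U R \<and> frobenius T X L R U
        \<longrightarrow> subfactor_triangulated T X L R U)
     \<and>
     (\<forall>L R. functorially_finite T X (Ob T) \<and>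
        left_approx_choice T X (Ob T) L \<and> right_approx_choice T X (Ob T) R
        \<longrightarrow> (let frob = {U. frobenius T X L R U};
                 thick = {S. thick_subcategory T X L R S \<and>
                             closed_under_extensions T (quot_preimage T X S)}
             in bij_betw (quot_image T X) frob thick \<and>
                bij_betw (quot_preimage T X) thick frob \<and>
                (\<forall>U\<in>frob. quot_preimage T X (quot_image T X U) = U) \<and>
                (\<forall>S\<in>thick. quot_image T X (quot_preimage T X S) = S)))"
proof (intro conjI allI impI)
  interpret tri T by (rule triangulated_tri[OF assms(1)])
  show "subfactor_triangulated T X L R U"
    if "X \<subseteq> U \<and> subcategory T U \<and> left_approx_choice T X U L \<and> right_approx_choice T X U R \<and> frobenius T X L R U"
    for U L R
    using frobenius_triangulated[OF assms(3)] that by blast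
  fix L R
  assume h: "functorially_finite T X (Ob T) \<and> left_approx_choice T X (Ob T) L \<and> right_approx_choice T X (Ob T) R"
  let ?F = "{U. frobenius T X L R U}"
  let ?T = "{S. thick_subcategory T X L R S \<and> closed_under_extensions T (quot_preimage T X S)}"
  \<comment> \<open>The projection functor is the identity on objects, so both maps fix the
    subcategories concerned, and the bijections reduce to the equality of the two
    collections.\<close>
  have im: "quot_image T X U = U" for U by (simp add: quot_image_def quot_functor_def)
  have pre: "quot_preimage T X U = U" if "U \<subseteq> Ob T" for U
    using that by (auto simp: quot_preimage_def quot_functor_def)
  have FO: "U \<subseteq> Ob T" if "frobenius T X L R U" for U
    using that by (simp add: frobenius_def subcategory_def additive_subcategory_def)
  have TO: "U \<subseteq> Ob T" if "thick_subcategory T X L R U" for U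
    using that by (simp add: thick_subcategory_def triangulated_subcategory_def additive_subcategory_def quot_cat_def)
  have "thick_subcategory T X L R U \<and> closed_under_extensions T (quot_preimage T X U)" if U: "frobenius T X L R U" for U
    using frobenius_thick[OF assms(2,3) _ _ U] h U pre[OF FO[OF U]] by (simp add: frobenius_def)
  moreover have "frobenius T X L R U"
    if U: "thick_subcategory T X L R U" "closed_under_extensions T (quot_preimage T X U)" for U
    using thick_frobenius[OF assms(3) _ _ _ U(1)] h U(2) pre[OF TO[OF U(1)]] by simp
  ultimately have eq: "?F = ?T" by blast
  have p: "quot_preimage T X U = U" if "U \<in> ?F" for U using pre FO that by blast
  have "bij_betw (quot_image T X) ?F ?T" unfolding eq[symmetric] by (simp add: bij_betw_def inj_on_def im)
  moreover have "bij_betw (quot_preimage T X) ?T ?F"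
    unfolding eq[symmetric] using p by (simp add: bij_betw_def inj_on_def)
  moreover have "\<forall>U\<in>?F. quot_preimage T X (quot_image T X U) = U" using p im by simp
  moreover have "\<forall>S\<in>?T. quot_image T X (quot_preimage T X S) = S" unfolding eq[symmetric] using p im by simp
  ultimately show "let frob = ?F; thick = ?T
             in bij_betw (quot_image T X) frob thick \<and>
                bij_betw (quot_preimage T X) thick frob \<and>
                (\<forall>U\<in>frob. quot_preimage T X (quot_image T X U) = U) \<and>
                (\<forall>S\<in>thick. quot_image T X (quot_preimage T X S) = S)"
    unfolding Let_def by blast
qed

end
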